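(* Let $E$ be an r.i. space on $[0,1]$. The operator $K$ acts boundedly on $E$ if and only if the sequence of operators $T_n$, $n\ge1$, is uniformly bounded in $E$, i.e. $\sup_n\|T_n\|_{E\to E}<\infty$.
   Context: Let $\mathrm{mes}$ be Lebesgue measure on $[0,1]$. Two measurable functions are equimeasurable if their absolute values have the same distribution function. R.i. spaces. A (nonzero) Banach space $E$ of measurable functions on $[0,1]$ is rearrangement invariant (r.i.) if (i) $|x|\le|y|$ a.e. and $y\in E$ imply $x\in E$ and $\|x\|_E\le\|y\|_E$; (ii) if $x,y$ are equimeasurable and $y\in E$, then $x\in E$ and $\|x\|_E=\|y\|_E$. The Köthe dual $E'$ consists of all $x$ with $\|x\|_{E'}=\sup_{\|y\|_E\le1}\int_0^1x(t)y(t)\,dt<\infty$. Standing convention: every r.i. space $E$ is assumed to be either separable or to coincide with its second Köthe dual $E''$. Kruglov operator. Let $\{B_n\}_{n\ge1}$ be mutually disjoint measurable subsets of $[0,1]$ with $\mathrm{mes}\,B_n=\frac1{e\,n!}$, and let $(\Omega,P)=\prod_{n=0}^\infty([0,1],\mathrm{mes})$. For $f\in L_1[0,1]$, $$Kf(\omega_0,\omega_1,\ldots)=\sum_{n=1}^\infty\sum_{k=1}^n f(\omega_k)\chi_{B_n}(\omega_0).$$ "$K$ acts boundedly on $E$" means that $K$ is a bounded operator from $E$ to $E(\Omega,P)$, the space of measurable functions on $\Omega$ whose decreasing rearrangement lies in $E$, with norm $\|g\|_{E(\Omega,P)}=\|g^*\|_E$. Operators $T_n$. Let $S_n$ be the set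 of permutations of $\{1,\dots,n\}$, identified (in an arbitrary fixed way) with $\{1,\dots,n!\}$. Define $A_n:\mathbb{R}^n\to\mathbb{R}^{n!}$ by $A_nx(\pi)=\sum_{i:\pi(i)=i}x_i$, $\pi\in S_n$; define $B_n:L_1[0,1]\to\mathbb{R}^n$ by $(B_nx)_i=n\int_{(i-1)/n}^{i/n}x(t)\,dt$; define $C_n$ on $\mathbb{R}^n$ by $C_nx=\sum_{k=1}^nx_k\chi_{(\frac{k-1}n,\frac kn)}$. Then $T_n=C_{n!}A_nB_n$. (The sets $B_n$ in the definition of $K$ and the operators $B_n$ here are unrelated.) *)

theory Defs
  imports "HOL-Probability.Probability" "HOL-Combinatorics.Permutations"
begin

text \<open>
  A normed space of measurable functions is given by a set of honest functions together with a
  norm; the measure-theoretic identification of functions that agree almost everywhere is left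
  implicit (the norm vanishes exactly on the functions that are zero almost everywhere).
\<close>

record 'a fspace =
  fcarrier :: "('a \<Rightarrow> real) set"
  fnorm :: "('a \<Rightarrow> real) \<Rightarrow> real"

abbreviation mes :: "real measure" where
  "mes \<equiv> lebesgue_on {0..1}"

definition banach_fspace :: "'a measure \<Rightarrow> 'a fspace \<Rightarrow> bool" where
  "banach_fspace M X \<longleftrightarrow>
     fcarrier X \<subseteq> borel_measurable M \<and>
     (\<lambda>t. 0) \<in> fcarrier X \<and>
     (\<forall>x\<in>fcarrier X. \<forall>y\<in>fcarrier X. (\<lambda>t. x t + y t) \<in> fcarrier X) \<and>
     (\<forall>c. \<forall>x\<in>fcarrier X. (\<lambda>t. c * x t) \<in> fcarrier X) \<and>
     (\<forall>x\<in>fcarrier X. 0 \<le> fnorm X x) \<and>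
     (\<forall>x\<in>fcarrier X. fnorm X x = 0 \<longleftrightarrow> (AE t in M. x t = 0)) \<and>
     (\<forall>c. \<forall>x\<in>fcarrier X. fnorm X (\<lambda>t. c * x t) = \<bar>c\<bar> * fnorm X x) \<and>
     (\<forall>x\<in>fcarrier X. \<forall>y\<in>fcarrier X. fnorm X (\<lambda>t. x t + y t) \<le> fnorm X x + fnorm X y) \<and>
     (\<forall>u. (\<forall>n::nat. u n \<in> fcarrier X) \<and>
          (\<forall>\<epsilon>>0. \<exists>N. \<forall>m\<ge>N. \<forall>n\<ge>N. fnorm X (\<lambda>t. u m t - u n t) < \<epsilon>) \<longrightarrow>
          (\<exists>x\<in>fcarrier X. (\<lambda>n. fnorm X (\<lambda>t. u n t - x t)) \<longlonglongrightarrow> 0))"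

definition distribution_fun :: "'a measure \<Rightarrow> ('a \<Rightarrow> real) \<Rightarrow> real \<Rightarrow> real" where
  "distribution_fun M x \<tau> = measure M {t \<in> space M. \<tau> < x t}"

definition equimeasurable :: "'a measure \<Rightarrow> ('a \<Rightarrow> real) \<Rightarrow> ('a \<Rightarrow> real) \<Rightarrow> bool" where
  "equimeasurable M x y \<longleftrightarrow>
     distribution_fun M (\<lambda>t. \<bar>x t\<bar>) = distribution_fun M (\<lambda>t. \<bar>y t\<bar>)"

text \<open>
  The integrability clause excludes the default value 0 of the Bochner integral. It is implied by
  finiteness of the supremum in the extended sense when the space is solid: if \<open>x y\<close> is
  not integrable, replacing \<open>y\<close> by \<open>\<bar>y\<bar> sgn x\<close> gives the value infinity.
\<close>

definition kothe_dual :: "'a measure \<Rightarrow> 'a fspace \<Rightarrow> 'a fspace" where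
  "kothe_dual M X =
     \<lparr> fcarrier = {x \<in> borel_measurable M.
         (\<forall>y\<in>fcarrier X. fnorm X y \<le> 1 \<longrightarrow> integrable M (\<lambda>t. x t * y t)) \<and>
         bdd_above ((\<lambda>y. \<integral>t. x t * y t \<partial>M) ` {y \<in> fcarrier X. fnorm X y \<le> 1})},
       fnorm = (\<lambda>x. SUP y\<in>{y \<in> fcarrier X. fnorm X y \<le> 1}. \<integral>t. x t * y t \<partial>M) \<rparr>"

definition separable_fspace :: "'a fspace \<Rightarrow> bool" where
  "separable_fspace X \<longleftrightarrow>
     (\<exists>D. countable D \<and> D \<subseteq> fcarrier X \<and>
       (\<forall>x\<in>fcarrier X. \<forall>\<epsilon>>0. \<exists>d\<in>D. fnorm X (\<lambda>t. x t - d t) < \<epsilon>))"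

definition same_fspace :: "'a fspace \<Rightarrow> 'a fspace \<Rightarrow> bool" where
  "same_fspace X Y \<longleftrightarrow>
     fcarrier X = fcarrier Y \<and> (\<forall>x\<in>fcarrier X. fnorm X x = fnorm Y x)"

definition ri_space :: "real fspace \<Rightarrow> bool" where
  "ri_space E \<longleftrightarrow>
     banach_fspace mes E \<and>
     (\<exists>x\<in>fcarrier E. \<not> (AE t in mes. x t = 0)) \<and>
     (\<forall>x\<in>borel_measurable mes. \<forall>y\<in>fcarrier E.
        (AE t in mes. \<bar>x t\<bar> \<le> \<bar>y t\<bar>) \<longrightarrow> x \<in> fcarrier E \<and> fnorm E x \<le> fnorm E y) \<and>
     (\<forall>x\<in>borel_measurable mes. \<forall>y\<in>fcarrier E.
        equimeasurable mes x y \<longrightarrow> x \<in> fcarrier E \<and> fnorm E x = fnorm E y) \<and>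
     (separable_fspace E \<or> same_fspace E (kothe_dual mes (kothe_dual mes E)))"

text \<open>
  For a probability measure the infimum is over a nonempty set whenever \<open>0 < t\<close>; the
  value at the single point \<open>t = 0\<close> is irrelevant.
\<close>

definition decr_rearr :: "'a measure \<Rightarrow> ('a \<Rightarrow> real) \<Rightarrow> real \<Rightarrow> real" where
  "decr_rearr M g t = Inf {\<tau>. 0 \<le> \<tau> \<and> distribution_fun M (\<lambda>w. \<bar>g w\<bar>) \<tau> \<le> t}"

definition rearr_space :: "real fspace \<Rightarrow> 'a measure \<Rightarrow> 'a fspace" where
  "rearr_space E M =
     \<lparr> fcarrier = {g \<in> borel_measurable M. decr_rearr M g \<in> fcarrier E},
       fnorm = (\<lambda>g. fnorm E (decr_rearr M g)) \<rparr>"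

text \<open>
  \<open>N\<close> is the measure underlying the target space; linearity is required up to
  \<open>N\<close>-null sets.
\<close>

definition bounded_operator ::
    "'b measure \<Rightarrow> 'a fspace \<Rightarrow> 'b fspace \<Rightarrow> (('a \<Rightarrow> real) \<Rightarrow> 'b \<Rightarrow> real) \<Rightarrow> bool" where
  "bounded_operator N X Y T \<longleftrightarrow>
     (\<forall>x\<in>fcarrier X. T x \<in> fcarrier Y) \<and>
     (\<forall>a b. \<forall>x\<in>fcarrier X. \<forall>y\<in>fcarrier X.
        AE s in N. T (\<lambda>t. a * x t + b * y t) s = a * T x s + b * T y s) \<and>
     (\<exists>C. \<forall>x\<in>fcarrier X. fnorm Y (T x) \<le> C * fnorm X x)"

definition operator_norm ::
    "'a fspace \<Rightarrow> 'b fspace \<Rightarrow> (('a \<Rightarrow> real) \<Rightarrow> 'b \<Rightarrow> real) \<Rightarrow> real" where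
  "operator_norm X Y T = (SUP x\<in>{x \<in> fcarrier X. fnorm X x \<le> 1}. fnorm Y (T x))"

definition uniformly_bounded ::
    "real fspace \<Rightarrow> (nat \<Rightarrow> (real \<Rightarrow> real) \<Rightarrow> real \<Rightarrow> real) \<Rightarrow> bool" where
  "uniformly_bounded E T \<longleftrightarrow>
     (\<forall>n\<ge>1. bounded_operator mes E E (T n)) \<and>
     bdd_above ((\<lambda>n. operator_norm E E (T n)) ` {1..})"

definition Omega :: "(nat \<Rightarrow> real) measure" where
  "Omega = (\<Pi>\<^sub>M n\<in>UNIV. mes)"

definition kruglov_sets :: "(nat \<Rightarrow> real set) \<Rightarrow> bool" where
  "kruglov_sets B \<longleftrightarrow>
     (\<forall>n\<ge>1. B n \<in> sets mes \<and> measure mes (B n) = 1 / (exp 1 * fact n)) \<and>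
     disjoint_family_on B {1..}"

text \<open>The term for \<open>n = 0\<close> is an empty sum, so \<open>B 0\<close> plays no role.\<close>

definition kruglov_op ::
    "(nat \<Rightarrow> real set) \<Rightarrow> (real \<Rightarrow> real) \<Rightarrow> (nat \<Rightarrow> real) \<Rightarrow> real" where
  "kruglov_op B f \<omega> = (\<Sum>n. \<Sum>k=1..n. f (\<omega> k) * indicat_real (B n) (\<omega> 0))"

text \<open>
  Vectors in \<open>\<real>\<^sup>n\<close> are functions on \<open>nat\<close> of which only the values at
  \<open>1, \<dots>, n\<close> are used.
\<close>

definition opA :: "nat \<Rightarrow> (nat \<Rightarrow> real) \<Rightarrow> (nat \<Rightarrow> nat) \<Rightarrow> real" where
  "opA n x \<pi> = (\<Sum>i\<in>{i \<in> {1..n}. \<pi> i = i}. x i)"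

definition opB :: "nat \<Rightarrow> (real \<Rightarrow> real) \<Rightarrow> nat \<Rightarrow> real" where
  "opB n x i = real n * (LINT t:{(real i - 1) / real n..real i / real n}|lebesgue. x t)"

definition opC :: "nat \<Rightarrow> (nat \<Rightarrow> real) \<Rightarrow> real \<Rightarrow> real" where
  "opC n x t = (\<Sum>k=1..n. x k * indicat_real {(real k - 1) / real n<..<real k / real n} t)"

text \<open>
  \<open>\<sigma> n\<close> numbers the permutations of \<open>{1..n}\<close> by \<open>1, \<dots>, n!\<close>.
\<close>

definition perm_numbering :: "(nat \<Rightarrow> nat \<Rightarrow> nat \<Rightarrow> nat) \<Rightarrow> bool" where
  "perm_numbering \<sigma> \<longleftrightarrow> (\<forall>n\<ge>1. bij_betw (\<sigma> n) {1..fact n} {\<pi>. \<pi> permutes {1..n}})"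

definition opT :: "(nat \<Rightarrow> nat \<Rightarrow> nat \<Rightarrow> nat) \<Rightarrow> nat \<Rightarrow> (real \<Rightarrow> real) \<Rightarrow> real \<Rightarrow> real" where
  "opT \<sigma> n x = opC (fact n) (\<lambda>j. opA n (opB n x) (\<sigma> n j))"

end

theory Submission
  imports Defs "HOL-Combinatorics.Multiset_Permutations"
begin

text \<open>
  The norm of a rearrangement invariant space \<open>E\<close> depends on a function \<open>x\<close> only
  through its tail \<open>\<tau> \<mapsto> P(\<bar>x\<bar> > \<tau>)\<close>, and a domination of tails up to an integer
  factor \<open>m\<close> costs at most the factor \<open>m\<close> in the norm (\<open>dilation_star\<close>). So it is enough to
  compare the tails of \<open>T\<^sub>n x\<close> and \<open>K x\<close> up to constants.

  For a step function with values \<open>v 0, \<dots>, v (n - 1)\<close> on \<open>n\<close> cells of equal length both tails are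
  governed by sums over sets \<open>S\<close> of cells with \<open>\<Sum>i\<in>S. v i > \<tau>\<close>. A random permutation has the fixed point set
  \<open>S\<close> with a probability between \<open>(n - k)! / (3 n!)\<close> (for \<open>k \<le> n - 2\<close>) and \<open>(n - k)! / n!\<close>, where
  \<open>k = card S\<close>; the sum defining \<open>K\<close> visits exactly the cells of \<open>S\<close>, each of them once, with
  probability \<open>1 / (e n\<^sup>k)\<close>. The two weights are comparable for bounded \<open>k\<close>, but in general
  \<open>(n - k)! / n!\<close> is only bounded by \<open>(3 / n)\<^sup>k\<close>.

  If \<open>K\<close> is bounded, the factor \<open>3\<^sup>k\<close> is harmless: it counts the ways to distribute \<open>S\<close> over
  three parts, and one of the parts carries a third of the sum. Summing over the distributions yields
  \<open>P(T\<^sub>n x > \<tau>) \<le> 81 P(3 K f > \<tau>)\<close> for \<open>x \<ge> 0\<close>, where \<open>f\<close> is the average of \<open>x\<close> over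
  the cells (\<open>prob_fixed_point_sum_le\<close>, \<open>subset_weight_le_tail_ksum\<close>). Averaging is a contraction of \<open>E\<close>
  (\<open>averaging\<close>), which gives the uniform bound for the \<open>T\<^sub>n\<close>.

  Conversely let the \<open>T\<^sub>n\<close> be uniformly bounded, let \<open>f \<ge> 0\<close> be a step function on \<open>n\<close> cells and let
  \<open>K\<^sub>J\<close> be \<open>K\<close> restricted to at most \<open>J\<close> summands. Cut every cell into \<open>M\<close> cells. For large \<open>M\<close> most
  tuples of at most \<open>J\<close> small cells have no repetition, so \<open>P(K\<^sub>J f > \<tau>) \<le> 3 P(T\<^sub>n\<^sub>M f > \<tau>)\<close>
  with \<open>M\<close> independent of \<open>\<tau>\<close> (\<open>tail_ktrunc_step_le\<close>). A general \<open>x \<ge> 0\<close> may be replaced by its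
  decreasing rearrangement (\<open>tail_ksum_cong\<close>), which is an increasing limit of step functions,
  and so the rearrangement of \<open>K x\<close> is an increasing limit of functions whose norms are bounded by
  a multiple of \<open>\<parallel>x\<parallel>\<close> (\<open>ktrunc_approximation\<close>). If \<open>E = E''\<close>, the Fatou property finishes the
  proof. If \<open>E\<close> is separable, the Fatou property holds for bounded limits, and it remains to
  see that large values of \<open>K x\<close> contribute little (\<open>separable_kruglov_tail\<close>). Split \<open>x\<close> into
  a function of small norm and a function bounded by a constant \<open>b\<close>. On the second one \<open>K\<close> is at
  most \<open>b\<close> times the number of summands, a Poisson variable; far out, its tail is below that
  of \<open>K q\<close> up to numerical constants, where \<open>q\<close> is the indicator function of a short interval
  (\<open>measure_blk_ge_le_spike\<close>), and \<open>q\<close> has small norm because \<open>E\<close> is separable.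
\<close>

section \<open>Tails and decreasing rearrangements\<close>

abbreviation tail :: "'a measure \<Rightarrow> ('a \<Rightarrow> real) \<Rightarrow> real \<Rightarrow> real" where
  "tail M g \<equiv> distribution_fun M (\<lambda>w. \<bar>g w\<bar>)"

lemma prob_space_mes: "prob_space mes"
  by (rule prob_spaceI) (simp add: emeasure_restrict_space)

interpretation mes: prob_space mes
  by (rule prob_space_mes)

lemma sets_mesI: "A \<in> sets borel \<Longrightarrow> A \<subseteq> {0..1} \<Longrightarrow> A \<in> sets mes"
  by (auto simp: sets_restrict_space_iff)

lemma measure_mes_Ioo: "0 \<le> a \<Longrightarrow> a \<le> b \<Longrightarrow> b \<le> 1 \<Longrightarrow> measure mes {a<..<b} = b - a"
  by (subst measure_restrict_space) (auto simp: greaterThanLessThan_subseteq_atLeastAtMost_iff)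

lemma measure_mes_Ioc: "0 \<le> a \<Longrightarrow> a \<le> b \<Longrightarrow> b \<le> 1 \<Longrightarrow> measure mes {a<..b} = b - a"
  by (subst measure_restrict_space) (auto)

lemma AE_mes_neq: "AE t in mes. t \<noteq> c"
proof (rule AE_I'[of "{c} \<inter> {0..1}"])
  have "emeasure lborel ({c} \<inter> {0..1}) \<le> emeasure lborel {c}" by (intro emeasure_mono) auto
  then show "{c} \<inter> {0..1} \<in> null_sets mes"
    by (auto simp: null_sets_def emeasure_restrict_space sets_restrict_space_iff)
qed auto

lemma tail_eq_measure: "tail M g \<tau> = measure M {w \<in> space M. \<tau> < \<bar>g w\<bar>}"
  by (simp add: distribution_fun_def)

context prob_space
begin

lemma tail_nonneg: "0 \<le> tail M g \<tau>"
  by (simp add: distribution_fun_def)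

lemma tail_le_1: "tail M g \<tau> \<le> 1"
  by (simp add: distribution_fun_def)

lemma tail_antimono: "g \<in> borel_measurable M \<Longrightarrow> \<sigma> \<le> \<tau> \<Longrightarrow> tail M g \<tau> \<le> tail M g \<sigma>"
  unfolding distribution_fun_def by (intro finite_measure_mono) auto

text \<open>
  The equality of tails in the definition of equimeasurability also ranges over negative levels,
  where it is void.
\<close>

lemma tail_neg: "\<tau> < 0 \<Longrightarrow> tail M g \<tau> = 1"
proof -
  assume "\<tau> < 0"
  then have "{w \<in> space M. \<tau> < \<bar>g w\<bar>} = space M" by auto
  then show ?thesis by (simp add: distribution_fun_def prob_space)
qed

lemma tail_mono:
  assumes "h \<in> borel_measurable M" "AE w in M. \<bar>g w\<bar> \<le> \<bar>h w\<bar>"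
  shows "tail M g \<tau> \<le> tail M h \<tau>"
  unfolding distribution_fun_def using assms
  by (intro finite_measure_mono_AE) (auto elim: eventually_mono)

lemma tail_cong_AE:
  assumes "g \<in> borel_measurable M" "h \<in> borel_measurable M" "AE w in M. \<bar>g w\<bar> = \<bar>h w\<bar>"
  shows "tail M g \<tau> = tail M h \<tau>"
  using assms by (intro antisym tail_mono) auto

lemma tail_eventually_small:
  assumes [measurable]: "g \<in> borel_measurable M" and "0 < e"
  shows "\<exists>\<tau>\<ge>0. tail M g \<tau> < e"
proof -
  define A where "A n = {w \<in> space M. real n < \<bar>g w\<bar>}" for n :: nat
  have "(\<lambda>n. measure M (A n)) \<longlonglongrightarrow> measure M (\<Inter>n. A n)"
    by (rule finite_Lim_measure_decseq) (auto simp: A_def decseq_def)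
  moreover have "(\<Inter>n. A n) = {}"
  proof -
    have False if "w \<in> (\<Inter>n. A n)" for w
    proof -
      obtain n :: nat where "\<bar>g w\<bar> < real n" using reals_Archimedean2 by blast
      moreover have "w \<in> A n" using that by blast
      ultimately show False by (simp add: A_def)
    qed
    then show ?thesis by blast
  qed
  ultimately have "(\<lambda>n. measure M (A n)) \<longlonglongrightarrow> 0" by simp
  then have "eventually (\<lambda>n. measure M (A n) < e) sequentially"
    using \<open>0 < e\<close> by (rule order_tendstoD)
  then obtain n where "measure M (A n) < e"
    by (auto simp: eventually_sequentially)
  then show ?thesis
    by (intro exI[of _ "real n"]) (simp add: A_def distribution_fun_def)
qed

lemma tail_right_continuous:
  assumes [measurable]: "g \<in> borel_measurable M" and "t < tail M g \<tau>"
  shows "\<exists>\<tau>'>\<tau>. t < tail M g \<tau>'"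
proof -
  define A where "A n = {w \<in> space M. \<tau> + 1 / Suc n < \<bar>g w\<bar>}" for n :: nat
  have "incseq A"
  proof (rule incseq_SucI)
    fix n
    have "1 / real (Suc (Suc n)) \<le> 1 / real (Suc n)" by (simp add: field_simps)
    then show "A n \<subseteq> A (Suc n)" unfolding A_def by auto
  qed
  then have "(\<lambda>n. measure M (A n)) \<longlonglongrightarrow> measure M (\<Union>n. A n)"
    using finite_Lim_measure_incseq[of A] by (auto simp: A_def image_subset_iff)
  moreover have "(\<Union>n. A n) = {w \<in> space M. \<tau> < \<bar>g w\<bar>}"
  proof (intro set_eqI iffI)
    fix w assume w: "w \<in> {w \<in> space M. \<tau> < \<bar>g w\<bar>}"
    then obtain n where "1 / real (Suc n) < \<bar>g w\<bar> - \<tau>"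
      using nat_approx_posE[of "\<bar>g w\<bar> - \<tau>"] by (auto simp del: of_nat_Suc)
    with w show "w \<in> (\<Union>n. A n)" by (auto simp: A_def algebra_simps)
  next
    fix w assume "w \<in> (\<Union>n. A n)"
    then obtain n where w: "w \<in> space M" "\<tau> + 1 / real (Suc n) < \<bar>g w\<bar>" by (auto simp: A_def)
    have "0 < 1 / real (Suc n)" by simp
    with w have "\<tau> < \<bar>g w\<bar>" by linarith
    with w show "w \<in> {w \<in> space M. \<tau> < \<bar>g w\<bar>}" by simp
  qed
  ultimately have "(\<lambda>n. measure M (A n)) \<longlonglongrightarrow> tail M g \<tau>"
    by (simp add: distribution_fun_def)
  from order_tendstoD(1)[OF this assms(2)] obtain n where "t < measure M (A n)"
    by (auto simp: eventually_sequentially)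
  then show ?thesis
    by (intro exI[of _ "\<tau> + 1 / Suc n"]) (simp add: A_def distribution_fun_def)
qed

text \<open>
  The rearrangement is the generalised inverse of the tail, and the strict inequalities match because
  tails are right continuous. This equivalence replaces the infimum in the definition from here on.
\<close>

lemma less_decr_rearr_iff:
  assumes [measurable]: "g \<in> borel_measurable M" and "0 < t" "0 \<le> \<tau>"
  shows "\<tau> < decr_rearr M g t \<longleftrightarrow> t < tail M g \<tau>"
proof -
  let ?S = "{\<tau>. 0 \<le> \<tau> \<and> tail M g \<tau> \<le> t}"
  have ne: "?S \<noteq> {}" using tail_eventually_small[OF assms(1) \<open>0 < t\<close>] by (auto intro: less_imp_le)
  have bdd: "bdd_below ?S" by (auto intro: bdd_belowI[of _ 0])
  show ?thesis
  proof
    assume *: "\<tau> < decr_rearr M g t"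
    show "t < tail M g \<tau>"
    proof (rule ccontr)
      assume "\<not> t < tail M g \<tau>"
      then have "Inf ?S \<le> \<tau>" using \<open>0 \<le> \<tau>\<close> bdd by (intro cInf_lower) auto
      with * show False by (simp add: decr_rearr_def)
    qed
  next
    assume "t < tail M g \<tau>"
    then obtain \<tau>' where \<tau>': "\<tau> < \<tau>'" "t < tail M g \<tau>'"
      using tail_right_continuous[OF assms(1)] by blast
    have "\<tau>' \<le> Inf ?S"
    proof (rule cInf_greatest[OF ne])
      fix x assume "x \<in> ?S"
      then show "\<tau>' \<le> x" using \<tau>'(2) tail_antimono[OF assms(1), of x \<tau>'] by force
    qed
    with \<tau>' show "\<tau> < decr_rearr M g t" by (simp add: decr_rearr_def)
  qed
qed

lemma decr_rearr_nonneg: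
  assumes "g \<in> borel_measurable M" "0 < t"
  shows "0 \<le> decr_rearr M g t"
  unfolding decr_rearr_def
  by (rule cInf_greatest) (use tail_eventually_small[OF assms] in \<open>auto intro: less_imp_le\<close>)

end

text \<open>
  The decreasing rearrangement, with its value at \<open>0\<close> fixed: there the infimum may range over the
  empty set.
\<close>

definition star :: "'a measure \<Rightarrow> ('a \<Rightarrow> real) \<Rightarrow> real \<Rightarrow> real" where
  "star M g t = (if t \<le> 0 then 0 else decr_rearr M g t)"

text \<open>
  A compressed copy of the decreasing rearrangement that starts at \<open>a\<close>; copies of one function with
  disjoint supports are used to cut a function into equal parts.
\<close>

definition placed :: "'a measure \<Rightarrow> ('a \<Rightarrow> real) \<Rightarrow> real \<Rightarrow> real \<Rightarrow> real \<Rightarrow> real" where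
  "placed M g a c t = star M g (c * (t - a))"

lemma star_eq_placed: "star M g = placed M g 0 1"
  by (simp add: placed_def fun_eq_iff)

context prob_space
begin

lemma less_star_iff:
  assumes "g \<in> borel_measurable M" "0 \<le> \<tau>"
  shows "\<tau> < star M g t \<longleftrightarrow> 0 < t \<and> t < tail M g \<tau>"
  using less_decr_rearr_iff[OF assms(1) _ assms(2)] assms(2) by (auto simp: star_def)

lemma star_nonneg: "g \<in> borel_measurable M \<Longrightarrow> 0 \<le> star M g t"
  using decr_rearr_nonneg by (auto simp: star_def)

lemma star_antimono:
  assumes "g \<in> borel_measurable M" "0 < s" "s \<le> t"
  shows "star M g t \<le> star M g s"
  using less_star_iff[OF assms(1) star_nonneg[OF assms(1)], of s t] 
    less_star_iff[OF assms(1) star_nonneg[OF assms(1)], of s s] assms(2,3)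
  by force

lemma less_placed_iff:
  assumes "g \<in> borel_measurable M" "0 \<le> \<tau>" "0 < c"
  shows "\<tau> < placed M g a c t \<longleftrightarrow> a < t \<and> t < a + tail M g \<tau> / c"
  using assms(3) by (auto simp: placed_def less_star_iff[OF assms(1,2)] field_simps)

lemma placed_nonneg: "g \<in> borel_measurable M \<Longrightarrow> 0 \<le> placed M g a c t"
  by (simp add: placed_def star_nonneg)

lemma borel_measurable_placed:
  assumes "g \<in> borel_measurable M" "0 < c"
  shows "placed M g a c \<in> borel_measurable borel"
  unfolding borel_measurable_iff_greater
proof
  fix \<tau> :: real
  show "{w \<in> space borel. \<tau> < placed M g a c w} \<in> sets borel"
  proof (cases "0 \<le> \<tau>")
    case True
    then have "{w \<in> space borel. \<tau> < placed M g a c w} = {a <..< a + tail M g \<tau> / c}"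
      by (auto simp: less_placed_iff[OF assms(1) _ assms(2)])
    then show ?thesis by simp
  next
    case False
    then have "{w \<in> space borel. \<tau> < placed M g a c w} = UNIV"
      using placed_nonneg[OF assms(1)] by (auto simp: not_le intro: less_le_trans)
    then show ?thesis by simp
  qed
qed

lemma borel_measurable_star: "g \<in> borel_measurable M \<Longrightarrow> star M g \<in> borel_measurable borel"
  using borel_measurable_placed[of g 1 0] by (simp add: star_eq_placed)

end

lemma borel_measurable_mesI: "f \<in> borel_measurable borel \<Longrightarrow> f \<in> borel_measurable mes"
  by (intro measurable_restrict_space1 borel_measurable_if_D) 
    (auto intro: measurable_completion measurable_lborel1)

text \<open>
  The set where the copy exceeds \<open>\<tau>\<close> is an interval that starts at \<open>a\<close>, and \<open>a + 1 / c \<le> 1\<close>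
  keeps it inside the unit interval.
\<close>

lemma (in prob_space) tail_placed:
  assumes "g \<in> borel_measurable M" "0 \<le> \<tau>" "0 < c" "0 \<le> a" "a + 1 / c \<le> 1"
  shows "tail mes (placed M g a c) \<tau> = tail M g \<tau> / c"
proof -
  have le: "a + tail M g \<tau> / c \<le> 1"
    using tail_le_1[of g \<tau>] assms(3,5) by (meson add_left_mono divide_right_mono less_imp_le order_trans)
  have "{t \<in> space mes. \<tau> < \<bar>placed M g a c t\<bar>} = {a <..< a + tail M g \<tau> / c}"
    using le assms(4) by (auto simp: less_placed_iff[OF assms(1-3)] placed_nonneg[OF assms(1)])
  then have "tail mes (placed M g a c) \<tau> = measure mes {a <..< a + tail M g \<tau> / c}"
    by (simp add: distribution_fun_def)
  also have "\<dots> = tail M g \<tau> / c"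
    using le assms(3,4) tail_nonneg[of g \<tau>] by (subst measure_mes_Ioo) auto
  finally show ?thesis .
qed

lemma (in prob_space) tail_star:
  assumes "g \<in> borel_measurable M"
  shows "tail mes (star M g) = tail M g"
proof
  fix \<tau> :: real
  show "tail mes (star M g) \<tau> = tail M g \<tau>"
  proof (cases "0 \<le> \<tau>")
    case True
    then show ?thesis using tail_placed[OF assms True, of 1 0] by (simp add: star_eq_placed)
  next
    case False
    then show ?thesis by (simp add: tail_neg mes.tail_neg)
  qed
qed

lemma (in prob_space) borel_measurable_star_mes [measurable]:
  "g \<in> borel_measurable M \<Longrightarrow> star M g \<in> borel_measurable mes"
  by (intro borel_measurable_mesI borel_measurable_star)

lemma AE_star_eq_decr_rearr: "AE t in mes. star M g t = decr_rearr M g t"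
  using AE_mes_neq[of 0] AE_space[of mes] by eventually_elim (auto simp: star_def)

lemma (in prob_space) borel_measurable_decr_rearr:
  assumes "g \<in> borel_measurable M"
  shows "decr_rearr M g \<in> borel_measurable mes"
proof -
  have "(\<lambda>t. if t = 0 then decr_rearr M g 0 else star M g t) \<in> borel_measurable mes"
  proof -
    note [measurable] = borel_measurable_star[OF assms]
    have "(\<lambda>t. if t = 0 then decr_rearr M g 0 else star M g t) \<in> borel_measurable borel"
      by measurable
    then show ?thesis by (rule borel_measurable_mesI)
  qed
  then show ?thesis
    by (rule measurable_cong[THEN iffD1, rotated]) (auto simp: star_def)
qed

text \<open>
  Up to the passage from \<open>>\<close> to \<open>\<le>\<close> the tail is the distribution function of \<open>\<bar>g\<bar>\<close>, and a
  distribution function determines the law.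
\<close>

lemma (in prob_space) distr_abs_eqI:
  assumes g: "g \<in> borel_measurable M" and N: "prob_space N" and h: "h \<in> borel_measurable N"
    and eq: "\<And>\<tau>. 0 \<le> \<tau> \<Longrightarrow> tail M g \<tau> = tail N h \<tau>"
  shows "distr M borel (\<lambda>w. \<bar>g w\<bar>) = distr N borel (\<lambda>w. \<bar>h w\<bar>)"
proof -
  interpret N: prob_space N by fact
  have M1: "(\<lambda>w. \<bar>g w\<bar>) \<in> measurable M borel" and N1: "(\<lambda>w. \<bar>h w\<bar>) \<in> measurable N borel"
    using g h by auto
  have d1: "real_distribution (distr M borel (\<lambda>w. \<bar>g w\<bar>))"
    by (rule real_distribution_distr) (use g in auto)
  have d2: "real_distribution (distr N borel (\<lambda>w. \<bar>h w\<bar>))"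
    by (rule N.real_distribution_distr) (use h in auto)
  have cdf1: "cdf (distr M borel (\<lambda>w. \<bar>g w\<bar>)) x = 1 - tail M g x" for x
  proof -
    have "cdf (distr M borel (\<lambda>w. \<bar>g w\<bar>)) x = measure M {w \<in> space M. \<bar>g w\<bar> \<le> x}"
      unfolding cdf_def using M1 by (subst measure_distr) (auto intro!: arg_cong[where f="measure M"])
    also have "{w \<in> space M. \<bar>g w\<bar> \<le> x} = space M - {w \<in> space M. x < \<bar>g w\<bar>}" by auto
    also have "measure M \<dots> = 1 - tail M g x"
      unfolding distribution_fun_def using M1 by (subst prob_compl) auto
    finally show ?thesis .
  qed
  have cdf2: "cdf (distr N borel (\<lambda>w. \<bar>h w\<bar>)) x = 1 - tail N h x" for x
  proof -
    have "cdf (distr N borel (\<lambda>w. \<bar>h w\<bar>)) x = measure N {w \<in> space N. \<bar>h w\<bar> \<le> x}"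
      unfolding cdf_def using N1 by (subst measure_distr) (auto intro!: arg_cong[where f="measure N"])
    also have "{w \<in> space N. \<bar>h w\<bar> \<le> x} = space N - {w \<in> space N. x < \<bar>h w\<bar>}" by auto
    also have "measure N \<dots> = 1 - tail N h x"
      unfolding distribution_fun_def using N1 by (subst N.prob_compl) auto
    finally show ?thesis .
  qed
  show ?thesis
  proof (rule cdf_unique[OF d1 d2], rule ext)
    fix x :: real
    have "tail M g x = tail N h x"
      using eq[of x] by (cases "0 \<le> x") (auto simp: tail_neg N.tail_neg)
    then show "cdf (distr M borel (\<lambda>w. \<bar>g w\<bar>)) x = cdf (distr N borel (\<lambda>w. \<bar>h w\<bar>)) x"
      by (simp add: cdf1 cdf2)
  qed
qed

lemma (in prob_space) nn_integral_star:
  assumes g: "g \<in> borel_measurable M"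
  shows "(\<integral>\<^sup>+t. ennreal (star M g t) \<partial>mes) = (\<integral>\<^sup>+w. ennreal \<bar>g w\<bar> \<partial>M)"
proof -
  have s: "(\<lambda>t. \<bar>star M g t\<bar>) \<in> measurable mes borel" using g by measurable
  have "(\<integral>\<^sup>+t. ennreal (star M g t) \<partial>mes) = (\<integral>\<^sup>+t. ennreal \<bar>star M g t\<bar> \<partial>mes)"
    using star_nonneg[OF g] by simp
  also have "\<dots> = (\<integral>\<^sup>+y. ennreal y \<partial>distr mes borel (\<lambda>t. \<bar>star M g t\<bar>))"
    using s by (subst nn_integral_distr) auto
  also have "distr mes borel (\<lambda>t. \<bar>star M g t\<bar>) = distr M borel (\<lambda>t. \<bar>g t\<bar>)"
    by (rule mes.distr_abs_eqI) (use g prob_space_axioms in \<open>auto simp: tail_star\<close>)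
  also have "(\<integral>\<^sup>+y. ennreal y \<partial>distr M borel (\<lambda>t. \<bar>g t\<bar>)) = (\<integral>\<^sup>+w. ennreal \<bar>g w\<bar> \<partial>M)"
    using g by (subst nn_integral_distr) auto
  finally show ?thesis .
qed

section \<open>Step functions on cells of equal length\<close>

definition cell :: "nat \<Rightarrow> nat \<Rightarrow> real set" where
  "cell N i = {real i / real N <.. (real i + 1) / real N}"

definition step :: "nat \<Rightarrow> (nat \<Rightarrow> real) \<Rightarrow> real \<Rightarrow> real" where
  "step N v t = (\<Sum>i<N. v i * indicator (cell N i) t)"

lemma in_cell_iff: "0 < N \<Longrightarrow> t \<in> cell N i \<longleftrightarrow> real i < real N * t \<and> real N * t \<le> real i + 1"
  by (auto simp: cell_def field_simps)

lemma cell_inj: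
  assumes "0 < N" "t \<in> cell N i" "t \<in> cell N j" shows "i = j"
  using assms by (auto simp: in_cell_iff)

lemma disjoint_cells: "0 < N \<Longrightarrow> disjoint_family_on (cell N) I"
  using cell_inj[of N] unfolding disjoint_family_on_def by blast

lemma cell_subset:
  assumes "0 < N" "i < N" shows "cell N i \<subseteq> {0<..1}"
proof
  fix t assume "t \<in> cell N i"
  with assms have *: "real i < real N * t" "real N * t \<le> real i + 1" by (auto simp: in_cell_iff)
  have "0 < real N * t" using * by linarith
  moreover have "real N * t \<le> real N * 1" using * assms by linarith
  ultimately show "t \<in> {0<..1}" using assms by (auto simp: zero_less_mult_iff)
qed

lemma ex_cell:
  assumes "0 < N" "0 < t" "t \<le> 1" shows "\<exists>i<N. t \<in> cell N i"
proof -
  define i where "i = nat (\<lceil>real N * t\<rceil> - 1)"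
  have p: "0 < real N * t" using assms by simp
  then have c: "1 \<le> \<lceil>real N * t\<rceil>" by linarith
  then have i: "real i = of_int \<lceil>real N * t\<rceil> - 1" unfolding i_def by (simp add: of_nat_nat)
  have "t \<in> cell N i" using assms i by (simp add: in_cell_iff) linarith
  moreover have "real N * t \<le> real N" using assms by (simp add: mult_left_le)
  then have "i < N" using i by linarith
  ultimately show ?thesis by blast
qed

lemma step_eq:
  assumes "0 < N" "i < N" "t \<in> cell N i" shows "step N v t = v i"
proof -
  have "step N v t = (\<Sum>j<N. if j = i then v i else 0)"
    unfolding step_def
  proof (intro sum.cong refl)
    fix j assume "j \<in> {..<N}"
    show "v j * indicator (cell N j) t = (if j = i then v i else 0)"
      using assms(3) cell_inj[OF assms(1,3), of j] by (cases "j = i") (auto simp: indicator_def)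
  qed
  also have "\<dots> = v i" using assms by simp
  finally show ?thesis .
qed

lemma step_outside: "0 < N \<Longrightarrow> t \<notin> {0<..1} \<Longrightarrow> step N v t = 0"
  using cell_subset[of N] unfolding step_def by (intro sum.neutral) (force simp: indicator_def)

lemma step_eqI:
  assumes "0 < N" "\<And>i t. i < N \<Longrightarrow> t \<in> cell N i \<Longrightarrow> f t = v i" "\<And>t. t \<notin> {0<..1} \<Longrightarrow> f t = 0"
  shows "step N v = f"
proof
  fix t show "step N v t = f t"
  proof (cases "t \<in> {0<..1}")
    case True
    then obtain i where "i < N" "t \<in> cell N i" using ex_cell[of N t] assms by auto
    then show ?thesis using assms step_eq by simp
  qed (use assms step_outside in simp)
qed

lemma abs_step_le: "\<bar>step N v t\<bar> \<le> (\<Sum>i<N. \<bar>v i\<bar>)"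
proof -
  have "\<bar>step N v t\<bar> \<le> (\<Sum>i<N. \<bar>v i * indicator (cell N i) t\<bar>)"
    unfolding step_def by (rule sum_abs)
  also have "\<dots> \<le> (\<Sum>i<N. \<bar>v i\<bar>)" by (intro sum_mono) (auto simp: indicator_def)
  finally show ?thesis .
qed

lemma borel_measurable_step_borel: "step N v \<in> borel_measurable borel"
  unfolding step_def[abs_def] cell_def by measurable

lemma borel_measurable_step [measurable]: "step N v \<in> borel_measurable mes"
  by (rule borel_measurable_mesI[OF borel_measurable_step_borel])

lemma cell_sets [measurable]: "0 < N \<Longrightarrow> i < N \<Longrightarrow> cell N i \<in> sets mes"
  using cell_subset[of N i] by (intro sets_mesI) (auto simp: cell_def)

lemma measure_cell: 
  assumes "0 < N" "i < N" shows "measure mes (cell N i) = 1 / N"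
proof -
  have "(real i + 1) / real N \<le> 1" using assms by (simp add: field_simps)
  then have "measure mes (cell N i) = (real i + 1) / N - real i / N"
    unfolding cell_def using assms by (intro measure_mes_Ioc) (auto simp: field_simps)
  then show ?thesis using assms by (simp add: field_simps)
qed

lemma measure_UN_cells:
  assumes "0 < N" "I \<subseteq> {..<N}"
  shows "measure mes (\<Union>i\<in>I. cell N i) = card I / N"
proof -
  have "finite I" using assms(2) finite_subset by blast
  then have "measure mes (\<Union>i\<in>I. cell N i) = (\<Sum>i\<in>I. measure mes (cell N i))"
    using assms cell_sets[of N]
    by (intro mes.finite_measure_finite_Union disjoint_cells) auto
  also have "\<dots> = (\<Sum>i\<in>I. 1 / N)" using assms measure_cell[of N] by (intro sum.cong) auto
  finally show ?thesis by simp
qed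

lemma tail_step:
  assumes "0 < N" "0 \<le> \<tau>"
  shows "tail mes (step N v) \<tau> = card {i. i < N \<and> \<tau> < \<bar>v i\<bar>} / N"
proof -
  have "{t \<in> space mes. \<tau> < \<bar>step N v t\<bar>} = (\<Union>i\<in>{i. i < N \<and> \<tau> < \<bar>v i\<bar>}. cell N i)"
  proof (intro set_eqI iffI)
    fix t assume t: "t \<in> {t \<in> space mes. \<tau> < \<bar>step N v t\<bar>}"
    then have "t \<in> {0<..1}" using step_outside[OF assms(1), of t v] assms(2) by fastforce
    then obtain i where "i < N" "t \<in> cell N i" using ex_cell[of N t] assms by auto
    then show "t \<in> (\<Union>i\<in>{i. i < N \<and> \<tau> < \<bar>v i\<bar>}. cell N i)"
      using t step_eq[of N i t v] assms(1) by auto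
  next
    fix t assume "t \<in> (\<Union>i\<in>{i. i < N \<and> \<tau> < \<bar>v i\<bar>}. cell N i)"
    then show "t \<in> {t \<in> space mes. \<tau> < \<bar>step N v t\<bar>}"
      using step_eq[of N _ t v] assms(1) cell_subset[OF assms(1)] by fastforce
  qed
  then have "tail mes (step N v) \<tau> = measure mes (\<Union>i\<in>{i. i < N \<and> \<tau> < \<bar>v i\<bar>}. cell N i)"
    by (simp add: distribution_fun_def)
  also have "\<dots> = card {i. i < N \<and> \<tau> < \<bar>v i\<bar>} / N"
    by (rule measure_UN_cells) (use assms in auto)
  finally show ?thesis .
qed

lemma nn_integral_step:
  assumes "0 < N" "\<And>i. i < N \<Longrightarrow> 0 \<le> v i"
  shows "(\<integral>\<^sup>+t. ennreal (step N v t) \<partial>mes) = ennreal ((\<Sum>i<N. v i) / N)"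
proof -
  have "(\<integral>\<^sup>+t. ennreal (step N v t) \<partial>mes) = (\<integral>\<^sup>+t. (\<Sum>i<N. ennreal (v i) * indicator (cell N i) t) \<partial>mes)"
  proof (intro nn_integral_cong)
    fix t
    have "ennreal (step N v t) = (\<Sum>i<N. ennreal (v i * indicator (cell N i) t))"
      unfolding step_def using assms(2) by (intro sum_ennreal[symmetric]) auto
    also have "\<dots> = (\<Sum>i<N. ennreal (v i) * indicator (cell N i) t)"
      by (intro sum.cong) (auto simp: indicator_def)
    finally show "ennreal (step N v t) = (\<Sum>i<N. ennreal (v i) * indicator (cell N i) t)" .
  qed
  also have "\<dots> = (\<Sum>i<N. ennreal (v i) * emeasure mes (cell N i))"
    using assms(1) by (subst nn_integral_sum) (auto simp: nn_integral_cmult_indicator)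
  also have "\<dots> = (\<Sum>i<N. ennreal (v i / N))"
    using assms by (intro sum.cong)
      (auto simp: mes.emeasure_eq_measure measure_cell ennreal_mult'[symmetric])
  also have "\<dots> = ennreal (\<Sum>i<N. v i / N)"
    using assms by (intro sum_ennreal) auto
  finally show ?thesis by (simp add: sum_divide_distrib)
qed

text \<open>
  A cell of the coarse partition consists of \<open>M\<close> consecutive cells of the fine one, so the index of
  the coarse cell is obtained by integer division.
\<close>

lemma step_refine:
  assumes "0 < n" "0 < M"
  shows "step (n * M) (\<lambda>k. w (k div M)) = step n w"
proof (rule step_eqI)
  fix k t assume k: "k < n * M" "t \<in> cell (n * M) k"
  define i where "i = k div M"
  have i: "i < n" using k assms by (simp add: i_def less_mult_imp_div_less)
  have a: "i * M \<le> k" "k + 1 \<le> (i + 1) * M"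
    using assms dividend_less_div_times[of M k] by (auto simp: i_def)
  have b: "real k < real n * real M * t" "real n * real M * t \<le> real k + 1"
    using k assms by (auto simp: in_cell_iff)
  have "real (i * M) \<le> real k" "real (k + 1) \<le> real ((i + 1) * M)"
    using a by (simp_all only: of_nat_le_iff)
  then have "real i * real M \<le> real k" "real k + 1 \<le> (real i + 1) * real M"
    by (simp_all add: algebra_simps)
  with b have "real i * real M < real n * t * real M" "real n * t * real M \<le> (real i + 1) * real M"
    by (simp_all add: mult_ac)
  then have "t \<in> cell n i" using assms by (simp add: in_cell_iff)
  then show "step n w t = w (k div M)" using i assms by (simp add: step_eq i_def)
qed (use assms step_outside in auto)

text \<open>
  For decreasing \<open>s\<close> this is the largest step function on \<open>N\<close> cells below \<open>s\<close> on the unit interval,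
  because the right end, where \<open>s\<close> is smallest, belongs to the cell.
\<close>

definition lstep :: "nat \<Rightarrow> (real \<Rightarrow> real) \<Rightarrow> real \<Rightarrow> real" where
  "lstep N s = step N (\<lambda>i. s ((real i + 1) / N))"

lemma lstep_refine_le:
  assumes "0 < n" "0 < M" and anti: "\<And>a b. 0 < a \<Longrightarrow> a \<le> b \<Longrightarrow> s b \<le> s a"
  shows "lstep n s t \<le> lstep (n * M) s t"
proof (cases "t \<in> {0<..1}")
  case True
  with assms obtain k where k: "k < n * M" "t \<in> cell (n * M) k" using ex_cell[of "n * M" t] by auto
  have "k + 1 \<le> (k div M + 1) * M"
    using assms dividend_less_div_times[of M k] by (auto)
  then have "real (k + 1) \<le> real ((k div M + 1) * M)" by (simp only: of_nat_le_iff)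
  then have "real k + 1 \<le> (real (k div M) + 1) * real M" by (simp add: algebra_simps)
  then have "(real k + 1) / (real n * real M) \<le> (real (k div M) + 1) * real M / (real n * real M)"
    by (rule divide_right_mono) simp
  then have le: "(real k + 1) / (real n * real M) \<le> (real (k div M) + 1) / real n"
    using assms(1,2) by simp
  have "lstep n s t = s ((real (k div M) + 1) / real n)"
    unfolding lstep_def using k assms(1,2)
    by (subst step_refine[OF assms(1,2), symmetric]) (simp add: step_eq)
  also have "\<dots> \<le> s ((real k + 1) / (real n * real M))"
    using assms(1,2) le by (intro anti) auto
  also have "\<dots> = lstep (n * M) s t"
    unfolding lstep_def using k assms(1,2) by (simp add: step_eq)
  finally show ?thesis .
next
  case False
  then show ?thesis using assms(1,2) by (simp add: lstep_def step_outside)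
qed

context prob_space
begin

lemma lstep_star_le:
  assumes "g \<in> borel_measurable M" "0 < N"
  shows "lstep N (star M g) t \<le> star M g t"
proof (cases "t \<in> {0<..1}")
  case True
  with assms obtain k where k: "k < N" "t \<in> cell N k" using ex_cell[of N t] by auto
  then have "lstep N (star M g) t = star M g ((real k + 1) / N)"
    by (simp add: lstep_def step_eq)
  also have "\<dots> \<le> star M g t" using k True by (intro star_antimono assms) (auto simp: cell_def)
  finally show ?thesis .
qed (use assms in \<open>simp add: lstep_def step_outside star_nonneg\<close>)

lemma lstep_star_nonneg:
  assumes "g \<in> borel_measurable M" shows "0 \<le> lstep N (star M g) t"
  unfolding lstep_def step_def using star_nonneg[OF assms] by (intro sum_nonneg) auto

lemma star_eq_0:
  assumes "g \<in> borel_measurable M" "1 \<le> t"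
  shows "star M g t = 0"
proof -
  have "\<not> 0 < star M g t"
    using less_star_iff[OF assms(1) order_refl, of t] tail_le_1[of g 0] assms(2) by linarith
  then show ?thesis using star_nonneg[OF assms(1), of t] by linarith
qed

text \<open>
  Right continuity of the rearrangement makes the convergence hold at every point, so no exceptional
  null set has to be carried through the limits for the Kruglov operator.
\<close>

lemma lstep_star_tendsto:
  assumes "g \<in> borel_measurable M" and N: "\<And>k. 0 < N k" "filterlim N at_top sequentially"
  shows "(\<lambda>k. lstep (N k) (star M g) t) \<longlonglongrightarrow> star M g t"
proof (cases "0 < t \<and> t \<le> 1")
  case True
  show ?thesis
  proof (rule order_tendstoI)
    fix a assume "a < star M g t"
    show "eventually (\<lambda>k. a < lstep (N k) (star M g) t) sequentially"
    proof (cases "0 \<le> a")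
      case False
      then have "a < lstep (N k) (star M g) t" for k
        using lstep_star_nonneg[OF assms(1), of "N k" t] by linarith
      then show ?thesis by simp
    next
      case a: True
      define d where "d = tail M g a - t"
      have d: "0 < d" using \<open>a < star M g t\<close> less_star_iff[OF assms(1) a] by (simp add: d_def)
      have "eventually (\<lambda>k. 1 / d < real (N k)) sequentially"
        using filterlim_compose[OF filterlim_real_sequentially N(2)]
        unfolding filterlim_at_top_dense by blast
      then show ?thesis
      proof eventually_elim
        fix k assume k: "1 / d < real (N k)"
        obtain i where i: "i < N k" "t \<in> cell (N k) i"
          using ex_cell[OF N(1), of t k] True by blast
        have i2: "real i / real (N k) < t" using i by (simp add: cell_def)
        have "1 < d * real (N k)" using k d by (simp add: field_simps)
        then have i3: "1 / real (N k) < d" using N(1)[of k] by (simp add: field_simps)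
        have "(real i + 1) / N k = real i / N k + 1 / N k" by (simp add: add_divide_distrib)
        also have "\<dots> < t + d"
          using i2 i3 by (rule add_strict_mono)
        finally have "(real i + 1) / N k < tail M g a" by (simp add: d_def)
        then have "a < star M g ((real i + 1) / N k)" 
          using N(1)[of k] by (subst less_star_iff[OF assms(1) a]) simp
        then show "a < lstep (N k) (star M g) t" using i N(1)[of k] by (simp add: lstep_def step_eq)
      qed
    qed
  next
    fix a assume "star M g t < a"
    then have "lstep (N k) (star M g) t < a" for k
      using lstep_star_le[OF assms(1) N(1), of k t] by linarith
    then show "eventually (\<lambda>k. lstep (N k) (star M g) t < a) sequentially" by simp
  qed
next
  case False
  then have "t \<notin> {0<..1}" by simp
  then have "lstep (N k) (star M g) t = 0" for k
    using step_outside[OF N(1)] by (simp add: lstep_def)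
  then show ?thesis using False star_eq_0[OF assms(1), of t] by (auto simp: star_def)
qed

end

section \<open>Comparison of norms by tails\<close>

lemma (in prob_space) star_le_star:
  assumes "g \<in> borel_measurable M" "prob_space N" "h \<in> borel_measurable N"
    and "\<And>\<tau>. 0 \<le> \<tau> \<Longrightarrow> tail M g \<tau> \<le> tail N h \<tau>"
  shows "star M g t \<le> star N h t"
proof (rule ccontr)
  interpret N: prob_space N by fact
  assume "\<not> star M g t \<le> star N h t"
  then have "0 < t \<and> t < tail M g (star N h t)"
    using less_star_iff[OF assms(1) N.star_nonneg[OF assms(3)]] by (simp add: not_le)
  then have "0 < t \<and> t < tail N h (star N h t)"
    using assms(4)[of "star N h t"] N.star_nonneg[OF assms(3)] by fastforce
  then have "star N h t < star N h t"
    using N.less_star_iff[OF assms(3) N.star_nonneg[OF assms(3)]] by blast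
  then show False by simp
qed

locale ri =
  fixes E :: "real fspace"
  assumes ri: "ri_space E"
begin

abbreviation car :: "(real \<Rightarrow> real) set" where "car \<equiv> fcarrier E"
abbreviation nrm :: "(real \<Rightarrow> real) \<Rightarrow> real" where "nrm \<equiv> fnorm E"

lemma car_measurable: "x \<in> car \<Longrightarrow> x \<in> borel_measurable mes"
  using ri unfolding ri_space_def banach_fspace_def by blast

lemma zero_car: "(\<lambda>t. 0) \<in> car"
  using ri unfolding ri_space_def banach_fspace_def by blast

lemma add_car: "x \<in> car \<Longrightarrow> y \<in> car \<Longrightarrow> (\<lambda>t. x t + y t) \<in> car"
  using ri unfolding ri_space_def banach_fspace_def by blast

lemma scale_car: "x \<in> car \<Longrightarrow> (\<lambda>t. c * x t) \<in> car"
  using ri unfolding ri_space_def banach_fspace_def by blast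

lemma nrm_nonneg: "x \<in> car \<Longrightarrow> 0 \<le> nrm x"
  using ri unfolding ri_space_def banach_fspace_def by blast

lemma nrm_eq_0_iff: "x \<in> car \<Longrightarrow> nrm x = 0 \<longleftrightarrow> (AE t in mes. x t = 0)"
  using ri unfolding ri_space_def banach_fspace_def by blast

lemma nrm_scale: "x \<in> car \<Longrightarrow> nrm (\<lambda>t. c * x t) = \<bar>c\<bar> * nrm x"
  using ri unfolding ri_space_def banach_fspace_def by blast

lemma nrm_triangle: "x \<in> car \<Longrightarrow> y \<in> car \<Longrightarrow> nrm (\<lambda>t. x t + y t) \<le> nrm x + nrm y"
  using ri unfolding ri_space_def banach_fspace_def by blast

lemma nrm_complete:
  assumes "\<And>n::nat. u n \<in> car"
    and "\<And>\<epsilon>. 0 < \<epsilon> \<Longrightarrow> \<exists>N. \<forall>m\<ge>N. \<forall>n\<ge>N. nrm (\<lambda>t. u m t - u n t) < \<epsilon>"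
  shows "\<exists>x\<in>car. (\<lambda>n. nrm (\<lambda>t. u n t - x t)) \<longlonglongrightarrow> 0"
proof -
  have "\<forall>u. (\<forall>n::nat. u n \<in> car) \<and>
          (\<forall>\<epsilon>>0. \<exists>N. \<forall>m\<ge>N. \<forall>n\<ge>N. nrm (\<lambda>t. u m t - u n t) < \<epsilon>) \<longrightarrow>
          (\<exists>x\<in>car. (\<lambda>n. nrm (\<lambda>t. u n t - x t)) \<longlonglongrightarrow> 0)"
    using ri unfolding ri_space_def banach_fspace_def by blast
  then show ?thesis using assms by blast
qed

lemma nontrivial: "\<exists>x\<in>car. \<not> (AE t in mes. x t = 0)"
  using ri unfolding ri_space_def by blast

lemma solid:
  assumes "x \<in> borel_measurable mes" "y \<in> car" "AE t in mes. \<bar>x t\<bar> \<le> \<bar>y t\<bar>"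
  shows "x \<in> car" "nrm x \<le> nrm y"
  using ri assms unfolding ri_space_def by blast+

lemma rearr:
  assumes "x \<in> borel_measurable mes" "y \<in> car" "\<And>\<tau>. 0 \<le> \<tau> \<Longrightarrow> tail mes x \<tau> = tail mes y \<tau>"
  shows "x \<in> car" "nrm x = nrm y"
proof -
  have "equimeasurable mes x y"
    unfolding equimeasurable_def
  proof
    fix \<tau> show "tail mes x \<tau> = tail mes y \<tau>"
      using assms(3)[of \<tau>] by (cases "0 \<le> \<tau>") (auto simp: mes.tail_neg)
  qed
  then show "x \<in> car" "nrm x = nrm y"
    using ri assms(1,2) unfolding ri_space_def by blast+
qed

lemma separable_or_bidual:
  "separable_fspace E \<or> same_fspace E (kothe_dual mes (kothe_dual mes E))"
  using ri unfolding ri_space_def by blast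

lemma cong_AE:
  assumes "x \<in> borel_measurable mes" "y \<in> car" "AE t in mes. \<bar>x t\<bar> = \<bar>y t\<bar>"
  shows "x \<in> car" "nrm x = nrm y"
proof -
  show x: "x \<in> car" by (rule solid(1)[OF assms(1,2)]) (use assms(3) in auto)
  have "nrm x \<le> nrm y" by (rule solid(2)[OF assms(1,2)]) (use assms(3) in auto)
  moreover have "nrm y \<le> nrm x"
    by (rule solid(2)[OF car_measurable[OF assms(2)] x]) (use assms(3) in auto)
  ultimately show "nrm x = nrm y" by simp
qed

lemma abs_car:
  assumes "x \<in> car" shows "(\<lambda>t. \<bar>x t\<bar>) \<in> car" "nrm (\<lambda>t. \<bar>x t\<bar>) = nrm x"
  using cong_AE[of "\<lambda>t. \<bar>x t\<bar>" x] assms car_measurable[OF assms] by auto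

lemma diff_car:
  assumes "x \<in> car" "y \<in> car" shows "(\<lambda>t. x t - y t) \<in> car" "nrm (\<lambda>t. x t - y t) \<le> nrm x + nrm y"
  using add_car[OF assms(1) scale_car[OF assms(2), of "-1"]]
    nrm_triangle[OF assms(1) scale_car[OF assms(2), of "-1"]] nrm_scale[OF assms(2), of "-1"]
  by simp_all

lemma sum_car:
  assumes "finite I" "\<And>i. i \<in> I \<Longrightarrow> f i \<in> car"
  shows "(\<lambda>t. \<Sum>i\<in>I. f i t) \<in> car" "nrm (\<lambda>t. \<Sum>i\<in>I. f i t) \<le> (\<Sum>i\<in>I. nrm (f i))"
proof -
  have "(\<lambda>t. \<Sum>i\<in>I. f i t) \<in> car \<and> nrm (\<lambda>t. \<Sum>i\<in>I. f i t) \<le> (\<Sum>i\<in>I. nrm (f i))"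
    using assms
  proof (induction rule: finite_induct)
    case empty
    have "nrm (\<lambda>t. 0) = 0" using nrm_eq_0_iff[OF zero_car] by simp
    then show ?case using zero_car by simp
  next
    case (insert i I)
    then have *: "f i \<in> car" "(\<lambda>t. \<Sum>i\<in>I. f i t) \<in> car" "nrm (\<lambda>t. \<Sum>i\<in>I. f i t) \<le> (\<Sum>i\<in>I. nrm (f i))"
      by auto
    show ?case using add_car[OF *(1,2)] nrm_triangle[OF *(1,2)] *(3) insert.hyps by simp
  qed
  then show "(\<lambda>t. \<Sum>i\<in>I. f i t) \<in> car" "nrm (\<lambda>t. \<Sum>i\<in>I. f i t) \<le> (\<Sum>i\<in>I. nrm (f i))"
    by blast+
qed

lemma star_car_iff:
  assumes "x \<in> borel_measurable mes"
  shows "star mes x \<in> car \<longleftrightarrow> x \<in> car"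
proof -
  have m: "star mes x \<in> borel_measurable mes" using assms by measurable
  show ?thesis
    using rearr(1)[OF m, of x] rearr(1)[OF assms, of "star mes x"]
    by (auto simp: mes.tail_star[OF assms])
qed

lemma nrm_star:
  assumes "x \<in> car" shows "nrm (star mes x) = nrm x"
proof -
  have m: "star mes x \<in> borel_measurable mes" using car_measurable[OF assms] by measurable
  show ?thesis
    using rearr(2)[OF m assms] by (auto simp: mes.tail_star[OF car_measurable[OF assms]])
qed

text \<open>
  A smaller tail gives a pointwise smaller rearrangement. The function \<open>g\<close> may live on another
  probability space, which is how the values of the Kruglov operator enter \<open>E\<close>.
\<close>

lemma dominated_star:
  assumes "prob_space M" "g \<in> borel_measurable M" "z \<in> car"
    and "\<And>\<tau>. 0 \<le> \<tau> \<Longrightarrow> tail M g \<tau> \<le> tail mes z \<tau>"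
  shows "star M g \<in> car" "nrm (star M g) \<le> nrm z"
proof -
  interpret M: prob_space M by fact
  have m: "star M g \<in> borel_measurable mes" using assms(2) by measurable
  have "star M g t \<le> star mes z t" for t
    by (rule M.star_le_star) (use assms car_measurable prob_space_mes in auto)
  then have le: "AE t in mes. \<bar>star M g t\<bar> \<le> \<bar>star mes z t\<bar>"
    using M.star_nonneg[OF assms(2)] by (auto intro!: always_eventually order_trans[OF _ abs_ge_self])
  have s: "star mes z \<in> car" using assms(3) car_measurable[OF assms(3)] by (simp add: star_car_iff)
  show "star M g \<in> car" "nrm (star M g) \<le> nrm z"
    using solid[OF m s le] nrm_star[OF assms(3)] by auto
qed

lemma dominated:
  assumes "y \<in> borel_measurable mes" "z \<in> car"
    and "\<And>\<tau>. 0 \<le> \<tau> \<Longrightarrow> tail mes y \<tau> \<le> tail mes z \<tau>"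
  shows "y \<in> car" "nrm y \<le> nrm z"
proof -
  have *: "star mes y \<in> car" "nrm (star mes y) \<le> nrm z"
    using dominated_star[OF prob_space_mes assms] by auto
  then show "y \<in> car" using assms(1) by (simp add: star_car_iff)
  then show "nrm y \<le> nrm z" using * nrm_star by simp
qed

text \<open>
  Place \<open>m\<close> copies of the rearrangement of \<open>g\<close>, each compressed by the factor \<open>m\<close>, side by side.
  Every copy has the tail of \<open>g\<close> divided by \<open>m\<close>, hence norm at most \<open>\<parallel>z\<parallel>\<close>, and their sum has
  at least the tail of \<open>g\<close>.
\<close>

lemma dilation_star:
  assumes "prob_space M" "g \<in> borel_measurable M" "z \<in> car" "0 < m"
    and "\<And>\<tau>. 0 \<le> \<tau> \<Longrightarrow> tail M g \<tau> \<le> real m * tail mes z \<tau>"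
  shows "star M g \<in> car" "nrm (star M g) \<le> real m * nrm z"
proof -
  interpret M: prob_space M by fact
  define w where "w j = placed M g (real j / m) m" for j :: nat
  define W where "W t = (\<Sum>j<m. w j t)" for t
  have wb: "w j \<in> borel_measurable mes" for j
    unfolding w_def using assms(2,4) by (intro borel_measurable_mesI M.borel_measurable_placed) auto
  have w0: "0 \<le> w j t" for j t unfolding w_def by (rule M.placed_nonneg[OF assms(2)])
  have wt: "tail mes (w j) \<tau> = tail M g \<tau> / m" if "0 \<le> \<tau>" "j < m" for j \<tau>
    unfolding w_def using that assms(4)
    by (intro M.tail_placed[OF assms(2)]) (auto simp: field_simps)
  have wc: "w j \<in> car \<and> nrm (w j) \<le> nrm z" if "j < m" for j
  proof -
    have "tail mes (w j) \<tau> \<le> tail mes z \<tau>" if "0 \<le> \<tau>" for \<tau>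
    proof -
      have "real m * tail mes (w j) \<tau> \<le> real m * tail mes z \<tau>"
        using wt[OF that \<open>j < m\<close>] assms(5)[OF that] \<open>0 < m\<close> by simp
      then show ?thesis using \<open>0 < m\<close> by simp
    qed
    then show ?thesis using dominated[OF wb assms(3)] by blast
  qed
  have W: "W \<in> car" "nrm W \<le> real m * nrm z"
  proof -
    show "W \<in> car" unfolding W_def[abs_def] by (rule sum_car(1)) (use wc in auto)
    have "nrm W \<le> (\<Sum>j<m. nrm (w j))" unfolding W_def[abs_def] by (rule sum_car(2)) (use wc in auto)
    also have "\<dots> \<le> (\<Sum>j<m. nrm z)" by (rule sum_mono) (use wc in auto)
    finally show "nrm W \<le> real m * nrm z" by simp
  qed
  have "tail M g \<tau> \<le> tail mes W \<tau>" if "0 \<le> \<tau>" for \<tau>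
  proof -
    let ?A = "\<lambda>j. {t \<in> {0..1}. \<tau> < w j t}"
    have As: "?A j \<in> sets mes" for j
      using borel_measurable_iff_greater[THEN iffD1, OF wb[of j]] by simp
    have A_iff: "\<tau> < w j t \<longleftrightarrow> real j / m < t \<and> t < real j / m + tail M g \<tau> / m" for j t
      unfolding w_def using M.less_placed_iff[OF assms(2) that, of "real m"] assms(4) by simp
    have bnd: "tail M g \<tau> / m \<le> 1 / m" using M.tail_le_1 by (rule divide_right_mono) simp
    have disj: "disjoint_family_on ?A {..<m}"
      unfolding disjoint_family_on_def
    proof safe
      fix i j t assume "i \<noteq> j" and i: "\<tau> < w i t" and j: "\<tau> < w j t"
      have "real k < real m * t \<and> real m * t < real k + 1" if "\<tau> < w k t" for k
      proof -
        have "real k / m < t" "t < real k / m + 1 / m" using that bnd unfolding A_iff by auto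
        then show ?thesis using assms(4) by (simp add: field_simps)
      qed
      from this[OF i] this[OF j] have "i = j" by linarith
      with \<open>i \<noteq> j\<close> show "t \<in> {}" by blast
    qed
    have "tail M g \<tau> = (\<Sum>j<m. tail M g \<tau> / m)" using assms(4) by simp
    also have "\<dots> = (\<Sum>j<m. measure mes (?A j))"
      by (intro sum.cong refl) (use wt[OF that] w0 in \<open>auto simp: distribution_fun_def\<close>)
    also have "\<dots> = measure mes (\<Union>j<m. ?A j)"
      using As disj by (intro mes.finite_measure_finite_Union[symmetric]) auto
    also have "\<dots> \<le> tail mes W \<tau>"
      unfolding tail_eq_measure
    proof (rule mes.finite_measure_mono)
      show "{w \<in> space mes. \<tau> < \<bar>W w\<bar>} \<in> sets mes" using car_measurable[OF W(1)] by measurable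
      show "(\<Union>j<m. ?A j) \<subseteq> {w \<in> space mes. \<tau> < \<bar>W w\<bar>}"
      proof
        fix t assume "t \<in> (\<Union>j<m. ?A j)"
        then obtain j where j: "j < m" "t \<in> {0..1}" "\<tau> < w j t" by auto
        have "w j t \<le> W t" unfolding W_def using j w0 by (intro member_le_sum) auto
        with j show "t \<in> {w \<in> space mes. \<tau> < \<bar>W w\<bar>}" by auto
      qed
    qed
    finally show ?thesis .
  qed
  then show "star M g \<in> car" "nrm (star M g) \<le> real m * nrm z"
    using dominated_star[OF assms(1,2) W(1)] W(2) by force+
qed

lemma dilation:
  assumes "y \<in> borel_measurable mes" "z \<in> car" "0 < m"
    and "\<And>\<tau>. 0 \<le> \<tau> \<Longrightarrow> tail mes y \<tau> \<le> real m * tail mes z \<tau>"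
  shows "y \<in> car" "nrm y \<le> real m * nrm z"
proof -
  have *: "star mes y \<in> car" "nrm (star mes y) \<le> real m * nrm z"
    using dilation_star[OF prob_space_mes assms] by auto
  then show "y \<in> car" using assms(1) by (simp add: star_car_iff)
  then show "nrm y \<le> real m * nrm z" using * nrm_star by simp
qed

text \<open>
  Some nonzero element of the space exceeds some \<open>c > 0\<close> on a set of positive measure, and the tail of
  the constant \<open>1\<close> is at most a multiple of the tail of that element divided by \<open>c\<close>.
\<close>

lemma one_car: "(\<lambda>t. 1) \<in> car"
proof -
  obtain x where x: "x \<in> car" "\<not> (AE t in mes. x t = 0)" using nontrivial by blast
  have [measurable]: "x \<in> borel_measurable mes" by (rule car_measurable[OF x(1)])
  have "0 < tail mes x 0"
  proof (rule ccontr)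
    assume "\<not> 0 < tail mes x 0"
    then have "measure mes {t \<in> space mes. 0 < \<bar>x t\<bar>} = 0"
      using mes.tail_nonneg[of x 0] unfolding tail_eq_measure by linarith
    moreover have S: "{t \<in> space mes. 0 < \<bar>x t\<bar>} \<in> sets mes" by measurable
    ultimately have "AE t in mes. t \<notin> {t \<in> space mes. 0 < \<bar>x t\<bar>}"
      using mes.prob_eq_0[OF S] by blast
    then have "AE t in mes. x t = 0"
      using AE_space[of mes] by eventually_elim simp
    then show False using x(2) by simp
  qed
  then obtain c where c: "0 < c" "0 < tail mes x c"
    using mes.tail_right_continuous[of x 0 0] by auto
  obtain m where m: "1 / real (Suc m) < tail mes x c" using nat_approx_posE[OF c(2)] by blast
  have z: "(\<lambda>t. 1 / c * x t) \<in> car" by (rule scale_car[OF x(1)])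
  have "tail mes (\<lambda>t. 1) \<tau> \<le> real (Suc m) * tail mes (\<lambda>t. 1 / c * x t) \<tau>" if "0 \<le> \<tau>" for \<tau>
  proof (cases "\<tau> < 1")
    case True
    have "1 < real (Suc m) * tail mes x c" using m by (simp add: field_simps)
    also have "tail mes x c \<le> tail mes (\<lambda>t. 1 / c * x t) \<tau>"
      unfolding tail_eq_measure
    proof (rule mes.finite_measure_mono)
      have "\<tau> < \<bar>1 / c * x t\<bar>" if "c < \<bar>x t\<bar>" for t
      proof -
        have "1 < \<bar>1 / c * x t\<bar>" using that c by (simp add: abs_mult field_simps)
        with True show ?thesis by linarith
      qed
      then show "{w \<in> space mes. c < \<bar>x w\<bar>} \<subseteq> {w \<in> space mes. \<tau> < \<bar>1 / c * x w\<bar>}" by blast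
    qed measurable
    finally have "1 \<le> real (Suc m) * tail mes (\<lambda>t. 1 / c * x t) \<tau>" by simp
    then show ?thesis using mes.tail_le_1[of "\<lambda>t. 1" \<tau>] by linarith
  next
    case False
    then have "tail mes (\<lambda>t. 1) \<tau> = 0" by (simp add: distribution_fun_def)
    moreover have "0 \<le> real (Suc m) * tail mes (\<lambda>t. 1 / c * x t) \<tau>"
      by (rule mult_nonneg_nonneg[OF of_nat_0_le_iff mes.tail_nonneg])
    ultimately show ?thesis by linarith
  qed
  then show ?thesis by (intro dilation(1)[OF _ z, of _ "Suc m"]) auto
qed

lemma nrm_one_pos: "0 < nrm (\<lambda>t. 1)"
  using nrm_nonneg[OF one_car] nrm_eq_0_iff[OF one_car] by (auto simp: less_le)

lemma bounded_car:
  assumes "y \<in> borel_measurable mes" "AE t in mes. \<bar>y t\<bar> \<le> c" "0 \<le> c"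
  shows "y \<in> car" "nrm y \<le> c * nrm (\<lambda>t. 1)"
proof -
  have z: "(\<lambda>t. c * 1) \<in> car" "nrm (\<lambda>t. c * 1) = c * nrm (\<lambda>t. 1)"
    using scale_car[OF one_car, of c] nrm_scale[OF one_car, of c] assms(3) by auto
  show "y \<in> car" "nrm y \<le> c * nrm (\<lambda>t. 1)"
    using solid[OF assms(1) z(1)] assms(2,3) z(2) by auto
qed

lemma step_car: "step N v \<in> car"
  and step_nrm_le: "nrm (step N v) \<le> (\<Sum>i<N. \<bar>v i\<bar>) * nrm (\<lambda>t. 1)"
  by (rule bounded_car[OF borel_measurable_step AE_I2[OF abs_step_le]], simp add: sum_nonneg)+

lemma nrm_step_permute:
  assumes "0 < N" "bij_betw p {..<N} {..<N}"
  shows "nrm (step N (\<lambda>i. v (p i))) = nrm (step N v)"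
proof (rule rearr(2)[OF _ step_car])
  fix \<tau> :: real assume "0 \<le> \<tau>"
  have "p ` {i. i < N \<and> \<tau> < \<bar>v (p i)\<bar>} = {i. i < N \<and> \<tau> < \<bar>v i\<bar>}" (is "p ` ?A = ?B")
  proof
    show "p ` ?A \<subseteq> ?B" using bij_betwE[OF assms(2)] by auto
    show "?B \<subseteq> p ` ?A"
    proof
      fix i assume i: "i \<in> ?B"
      then have "i \<in> p ` {..<N}" using bij_betw_imp_surj_on[OF assms(2)] by simp
      with i show "i \<in> p ` ?A" by auto
    qed
  qed
  moreover have "inj_on p ?A"
    by (rule inj_on_subset[OF bij_betw_imp_inj_on[OF assms(2)]]) auto
  ultimately have "bij_betw p ?A ?B" unfolding bij_betw_def by blast
  then have "card {i. i < N \<and> \<tau> < \<bar>v (p i)\<bar>} = card {i. i < N \<and> \<tau> < \<bar>v i\<bar>}"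
    by (rule bij_betw_same_card)
  then show "tail mes (step N (\<lambda>i. v (p i))) \<tau> = tail mes (step N v) \<tau>"
    using \<open>0 \<le> \<tau>\<close> assms(1) by (simp add: tail_step)
qed measurable

end

section \<open>Averaging over cells\<close>

lemma bij_betw_add_mod:
  assumes "0 < (M::nat)" shows "bij_betw (\<lambda>s. (r + s) mod M) {..<M} {..<M}"
proof -
  have "inj_on (\<lambda>s. (r + s) mod M) {..<M}"
  proof (rule inj_onI)
    fix a b assume ab: "a \<in> {..<M}" "b \<in> {..<M}" "(r + a) mod M = (r + b) mod M"
    have le: "a \<le> b" if "a < M" "b < M" "(r + a) mod M = (r + b) mod M" for a b
    proof (rule ccontr)
      assume "\<not> a \<le> b"
      then have "r + b \<le> r + a" by simp
      then have "M dvd (r + a) - (r + b)"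
        using mod_eq_dvd_iff_nat[of "r + b" "r + a" M] that(3) by blast
      then have "M dvd a - b" by simp
      then show False using nat_dvd_not_less[of "a - b" M] that \<open>\<not> a \<le> b\<close> by linarith
    qed
    show "a = b" using le[of a b] le[of b a] ab by force
  qed
  moreover have "(\<lambda>s. (r + s) mod M) ` {..<M} \<subseteq> {..<M}" using assms by auto
  ultimately show ?thesis by (simp add: bij_betw_def endo_inj_surj)
qed

text \<open>
  The cyclic shift by \<open>s\<close> inside every block of \<open>M\<close> consecutive indices.
\<close>

lemma bij_betw_rotate_blocks:
  assumes "0 < (M::nat)"
  shows "bij_betw (\<lambda>k. k div M * M + (k + s) mod M) {..<n * M} {..<n * M}"
proof -
  define p where "p k = k div M * M + (k + s) mod M" for k
  have d: "p k div M = k div M" for k using assms by (simp add: p_def)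
  have m: "p k mod M = (k + s) mod M" for k by (simp add: p_def)
  have "inj_on p {..<n * M}"
  proof (rule inj_onI)
    fix a b assume eq: "p a = p b"
    then have 1: "a div M = b div M" using d[of a] d[of b] by simp
    have "(a + s) mod M = (b + s) mod M" using eq m[of a] m[of b] by simp
    then have "(s + a mod M) mod M = (s + b mod M) mod M"
      by (simp add: add.commute mod_simps)
    then have 2: "a mod M = b mod M"
      by (rule inj_onD[OF bij_betw_imp_inj_on[OF bij_betw_add_mod[OF assms]]]) (use assms in auto)
    have "a = a div M * M + a mod M" "b = b div M * M + b mod M" by simp_all
    with 1 2 show "a = b" by presburger
  qed
  moreover have "p ` {..<n * M} \<subseteq> {..<n * M}"
  proof (rule image_subsetI)
    fix k assume "k \<in> {..<n * M}"
    then have "p k div M < n" using d[of k] by (simp add: less_mult_imp_div_less)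
    then show "p k \<in> {..<n * M}" using div_less_iff_less_mult[OF assms, of "p k" n] by simp
  qed
  ultimately have "bij_betw p {..<n * M} {..<n * M}" by (simp add: bij_betw_def endo_inj_surj)
  then show ?thesis by (simp add: p_def[abs_def])
qed

context ri
begin

text \<open>
  The block means are the average of the \<open>M\<close> cyclic shifts within the blocks, and every shift only
  permutes the values of the step function.
\<close>

lemma nrm_step_block_means_le:
  assumes "0 < n" "0 < M"
  shows "nrm (step n (\<lambda>i. (\<Sum>j<M. u (i * M + j)) / M)) \<le> nrm (step (n * M) u)"
proof -
  define p where "p s k = k div M * M + (k + s) mod M" for s k
  have bij: "bij_betw (p s) {..<n * M} {..<n * M}" for s
    unfolding p_def by (rule bij_betw_rotate_blocks[OF assms(2)])
  have sum: "(\<Sum>s<M. u (p s k)) = (\<Sum>j<M. u (k div M * M + j))" for k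
    unfolding p_def
    by (rule sum.reindex_bij_betw[OF bij_betw_add_mod[OF assms(2), of k], of "\<lambda>j. u (k div M * M + j)"])
  have nM: "0 < n * M" using assms by simp
  have "step n (\<lambda>i. (\<Sum>j<M. u (i * M + j)) / M) = step (n * M) (\<lambda>k. (\<Sum>j<M. u (k div M * M + j)) / M)"
    by (rule step_refine[OF assms, symmetric])
  also have "\<dots> = (\<lambda>t. (1 / M) * (\<Sum>s<M. step (n * M) (\<lambda>k. u (p s k)) t))"
  proof
    fix t
    have "step (n * M) (\<lambda>k. (\<Sum>j<M. u (k div M * M + j)) / M) t =
      (\<Sum>k<n * M. \<Sum>s<M. (1 / M) * (u (p s k) * indicator (cell (n * M) k) t))"
      unfolding step_def sum[symmetric]
      by (intro sum.cong refl) (simp add: sum_divide_distrib sum_distrib_right)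
    also have "\<dots> = (\<Sum>s<M. \<Sum>k<n * M. (1 / M) * (u (p s k) * indicator (cell (n * M) k) t))"
      by (rule sum.swap)
    also have "\<dots> = (1 / M) * (\<Sum>s<M. step (n * M) (\<lambda>k. u (p s k)) t)"
      unfolding step_def by (simp only: sum_distrib_left)
    finally show "step (n * M) (\<lambda>k. (\<Sum>j<M. u (k div M * M + j)) / M) t =
      (1 / M) * (\<Sum>s<M. step (n * M) (\<lambda>k. u (p s k)) t)" .
  qed
  finally have eq: "step n (\<lambda>i. (\<Sum>j<M. u (i * M + j)) / M) = 
    (\<lambda>t. (1 / M) * (\<Sum>s<M. step (n * M) (\<lambda>k. u (p s k)) t))" .
  have c: "step (n * M) (\<lambda>k. u (p s k)) \<in> car" for s by (rule step_car)
  have sc: "(\<lambda>t. \<Sum>s<M. step (n * M) (\<lambda>k. u (p s k)) t) \<in> car"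
    by (rule sum_car(1)) (auto intro: c)
  have "nrm (\<lambda>t. (1 / M) * (\<Sum>s<M. step (n * M) (\<lambda>k. u (p s k)) t))
      = (1 / M) * nrm (\<lambda>t. \<Sum>s<M. step (n * M) (\<lambda>k. u (p s k)) t)"
    using nrm_scale[OF sc, of "1 / real M"] by simp
  also have "\<dots> \<le> (1 / M) * (\<Sum>s<M. nrm (step (n * M) (\<lambda>k. u (p s k))))"
    by (intro mult_left_mono sum_car(2)) (auto intro: c)
  also have "\<dots> = nrm (step (n * M) u)"
    using assms by (simp add: nrm_step_permute[OF nM bij])
  finally show ?thesis unfolding eq .
qed

end

lemma card_less_real: "real (card {j::nat. j < m \<and> real j + 1 < X}) \<le> max 0 X"
proof (cases "0 < X")
  case True
  have "{j::nat. j < m \<and> real j + 1 < X} \<subseteq> {..<nat \<lfloor>X\<rfloor>}"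
    by (auto simp: zless_nat_eq_int_zless less_floor_iff)
  then have "card {j::nat. j < m \<and> real j + 1 < X} \<le> card {..<nat \<lfloor>X\<rfloor>}" by (intro card_mono) auto
  also have "real (card {..<nat \<lfloor>X\<rfloor>}) \<le> X" using True by simp
  finally show ?thesis by simp
next
  case False
  then have "{j::nat. j < m \<and> real j + 1 < X} = {}" by auto
  then show ?thesis by (simp only: card.empty)
qed

lemma card_blocks_le:
  fixes n M :: nat
  shows "card {q. q < n * M \<and> P (q div M) (q mod M)} \<le> (\<Sum>i<n. card {j. j < M \<and> P i j})"
proof -
  have "{q. q < n * M \<and> P (q div M) (q mod M)} \<subseteq> (\<Union>i<n. (\<lambda>j. i * M + j) ` {j. j < M \<and> P i j})"
  proof
    fix q assume q: "q \<in> {q. q < n * M \<and> P (q div M) (q mod M)}"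
    then have "0 < M" by (auto intro: Nat.gr0I)
    then have "q div M < n" "q mod M < M" using q by (auto simp: less_mult_imp_div_less)
    moreover have "q = q div M * M + q mod M" by simp
    ultimately show "q \<in> (\<Union>i<n. (\<lambda>j. i * M + j) ` {j. j < M \<and> P i j})" using q by blast
  qed
  then have "card {q. q < n * M \<and> P (q div M) (q mod M)} 
    \<le> card (\<Union>i<n. (\<lambda>j. i * M + j) ` {j. j < M \<and> P i j})" by (intro card_mono) auto
  also have "\<dots> \<le> (\<Sum>i<n. card ((\<lambda>j. i * M + j) ` {j. j < M \<and> P i j}))"
    by (rule card_UN_le) simp
  also have "\<dots> \<le> (\<Sum>i<n. card {j. j < M \<and> P i j})"
    by (intro sum_mono card_image_le) auto
  finally show ?thesis .
qed

lemma sum_tail_cells_le: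
  assumes f: "f \<in> borel_measurable mes" and "0 < n" "0 \<le> \<tau>"
  shows "(\<Sum>i<n. tail mes (\<lambda>t. f t * indicator (cell n i) t) \<tau>) \<le> tail mes f \<tau>"
proof -
  let ?A = "\<lambda>i. {t \<in> space mes. \<tau> < \<bar>f t * indicator (cell n i) t\<bar>}"
  have As: "?A i \<in> sets mes" if "i < n" for i 
    using f cell_sets[OF assms(2) that] by measurable
  have sub: "?A i \<subseteq> cell n i" for i using assms(3) by (auto simp: indicator_def split: if_splits)
  have "disjoint_family_on ?A {..<n}"
    using disjoint_cells[OF assms(2), of "{..<n}"] sub unfolding disjoint_family_on_def by blast
  then have "(\<Sum>i<n. tail mes (\<lambda>t. f t * indicator (cell n i) t) \<tau>) = measure mes (\<Union>i<n. ?A i)"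
    unfolding tail_eq_measure using As by (intro mes.finite_measure_finite_Union[symmetric]) auto
  also have "\<dots> \<le> tail mes f \<tau>"
    unfolding tail_eq_measure
  proof (rule mes.finite_measure_mono)
    show "{w \<in> space mes. \<tau> < \<bar>f w\<bar>} \<in> sets mes" using f by measurable
  qed (use assms(3) in \<open>auto simp: indicator_def split: if_splits\<close>)
  finally show ?thesis .
qed

context ri
begin

text \<open>
  Inside every cell replace \<open>f\<close> by a lower step function of its rearrangement over that cell. The
  resulting step function has a smaller tail than \<open>f\<close>, and its block means \<open>L k\<close> are lower
  Riemann sums of the rearrangement, which increase to the mean of \<open>\<bar>f\<bar>\<close> over the cell.
\<close>

lemma averaging_aux:
  assumes f: "f \<in> car" and n: "0 < n"
  defines "g \<equiv> \<lambda>i t. f t * indicator (cell n i) t"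
  defines "L \<equiv> \<lambda>k i. (\<Sum>j<2 ^ k. star mes (g i) ((real j + 1) / (real n * 2 ^ k))) / 2 ^ k"
  shows "nrm (step n (L k)) \<le> nrm f"
    and "i < n \<Longrightarrow> (\<lambda>k. ennreal (L k i / n)) \<longlonglongrightarrow> (\<integral>\<^sup>+t. ennreal \<bar>g i t\<bar> \<partial>mes)"
    and "i < n \<Longrightarrow> 0 \<le> L k i"
proof -
  have gm: "g i \<in> borel_measurable mes" if "i < n" for i
    unfolding g_def using car_measurable[OF f] cell_sets[OF n that] by measurable
  have gtail: "tail mes (g i) \<tau> \<le> 1 / n" if "i < n" "0 \<le> \<tau>" for i \<tau>
  proof -
    have "tail mes (g i) \<tau> \<le> measure mes (cell n i)"
      unfolding tail_eq_measure using cell_sets[OF n that(1)] that(2)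
      by (intro mes.finite_measure_mono) (auto simp: g_def indicator_def split: if_splits)
    then show ?thesis using measure_cell[OF n that(1)] by simp
  qed
  have s0: "star mes (g i) x = 0" if "i < n" "1 / n \<le> x" for i x
  proof -
    have "\<not> 0 < star mes (g i) x"
      using mes.less_star_iff[OF gm[OF that(1)] order_refl, of x] gtail[OF that(1), of 0] that(2) by linarith
    then show ?thesis using mes.star_nonneg[OF gm[OF that(1)], of x] by linarith
  qed
  have L0: "0 \<le> L k i" if "i < n" for k i
    unfolding L_def using mes.star_nonneg[OF gm[OF that]] by (intro divide_nonneg_nonneg sum_nonneg) auto
  show "nrm (step n (L k)) \<le> nrm f"
  proof -
    define M where "M = (2::nat) ^ k"
    have M: "0 < M" "real M = 2 ^ k" by (simp_all add: M_def)
    define u where "u q = star mes (g (q div M)) ((real (q mod M) + 1) / (real n * M))" for q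
    have Lu: "step n (L k) = step n (\<lambda>i. (\<Sum>j<M. u (i * M + j)) / M)"
    proof (rule arg_cong[where f="step n"], rule ext)
      fix i
      have "u (i * M + j) = star mes (g i) ((real j + 1) / (real n * 2 ^ k))" if "j < M" for j
        using that M by (simp add: u_def)
      then show "L k i = (\<Sum>j<M. u (i * M + j)) / M"
        unfolding L_def M(2) by (simp add: M_def)
    qed
    have nM: "0 < n * M" using n M by simp
    have "nrm (step (n * M) u) \<le> nrm f"
    proof (rule dominated(2)[OF borel_measurable_step f])
      fix \<tau> :: real assume \<tau>: "0 \<le> \<tau>"
      define T where "T i = tail mes (g i) \<tau>" for i
      have T0: "0 \<le> T i" for i unfolding T_def by (rule mes.tail_nonneg)
      have abs_u: "\<tau> < \<bar>u q\<bar> \<longleftrightarrow> real (q mod M) + 1 < real (n * M) * T (q div M)" if "q < n * M" for q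
      proof -
        have "q div M < n" using that by (simp add: less_mult_imp_div_less)
        note gq = gm[OF this]
        have "\<tau> < \<bar>u q\<bar> \<longleftrightarrow> \<tau> < u q" unfolding u_def using mes.star_nonneg[OF gq] by simp
        also have "\<dots> \<longleftrightarrow> (real (q mod M) + 1) / (real n * M) < T (q div M)"
          unfolding u_def T_def using nM by (subst mes.less_star_iff[OF gq \<tau>]) simp
        also have "\<dots> \<longleftrightarrow> real (q mod M) + 1 < real (n * M) * T (q div M)"
          using nM by (simp add: field_simps)
        finally show ?thesis .
      qed
      have "tail mes (step (n * M) u) \<tau> = card {q. q < n * M \<and> \<tau> < \<bar>u q\<bar>} / real (n * M)"
        by (rule tail_step[OF nM \<tau>])
      also have "{q. q < n * M \<and> \<tau> < \<bar>u q\<bar>} = {q. q < n * M \<and> real (q mod M) + 1 < real (n * M) * T (q div M)}"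
        using abs_u by blast
      also have "card \<dots> / real (n * M) \<le> (\<Sum>i<n. real (n * M) * T i) / real (n * M)"
      proof (rule divide_right_mono)
        have "real (card {q. q < n * M \<and> real (q mod M) + 1 < real (n * M) * T (q div M)})
            \<le> of_nat (\<Sum>i<n. card {j. j < M \<and> real j + 1 < real (n * M) * T i})"
          by (rule of_nat_mono, rule card_blocks_le)
        also have "\<dots> = (\<Sum>i<n. real (card {j. j < M \<and> real j + 1 < real (n * M) * T i}))" by simp
        also have "\<dots> \<le> (\<Sum>i<n. real (n * M) * T i)"
        proof (rule sum_mono)
          fix i
          have "0 \<le> real (n * M) * T i" using T0 by simp
          then show "real (card {j. j < M \<and> real j + 1 < real (n * M) * T i}) \<le> real (n * M) * T i"
            using card_less_real[of M "real (n * M) * T i"] by linarith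
        qed
        finally show "real (card {q. q < n * M \<and> real (q mod M) + 1 < real (n * M) * T (q div M)})
            \<le> (\<Sum>i<n. real (n * M) * T i)" .
      qed simp
      also have "\<dots> = (\<Sum>i<n. T i)"
        unfolding sum_distrib_left[symmetric] using nM by simp
      also have "\<dots> \<le> tail mes f \<tau>"
        unfolding T_def g_def by (rule sum_tail_cells_le[OF car_measurable[OF f] n \<tau>])
      finally show "tail mes (step (n * M) u) \<tau> \<le> tail mes f \<tau>" .
    qed
    then show ?thesis using nrm_step_block_means_le[OF n M(1), of u] Lu by simp
  qed
  show "(\<lambda>k. ennreal (L k i / n)) \<longlonglongrightarrow> (\<integral>\<^sup>+t. ennreal \<bar>g i t\<bar> \<partial>mes)" if i: "i < n"
  proof -
    have eq: "(\<integral>\<^sup>+t. ennreal (lstep (n * 2 ^ k) (star mes (g i)) t) \<partial>mes) = ennreal (L k i / n)" for k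
    proof -
      have N: "0 < n * 2 ^ k" using n by simp
      have "(\<integral>\<^sup>+t. ennreal (lstep (n * 2 ^ k) (star mes (g i)) t) \<partial>mes) = 
         ennreal ((\<Sum>q<n * 2 ^ k. star mes (g i) ((real q + 1) / real (n * 2 ^ k))) / real (n * 2 ^ k))"
        unfolding lstep_def by (rule nn_integral_step[OF N mes.star_nonneg[OF gm[OF i]]])
      also have "(\<Sum>q<n * 2 ^ k. star mes (g i) ((real q + 1) / real (n * 2 ^ k)))
         = (\<Sum>q<2 ^ k. star mes (g i) ((real q + 1) / real (n * 2 ^ k)))"
      proof (rule sum.mono_neutral_right)
        show "{..<2 ^ k} \<subseteq> {..<n * 2 ^ k}" using n by (auto intro: less_le_trans)
        show "\<forall>q\<in>{..<n * 2 ^ k} - {..<2 ^ k}. star mes (g i) ((real q + 1) / real (n * 2 ^ k)) = 0"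
        proof
          fix q assume "q \<in> {..<n * 2 ^ k} - {..<2 ^ k}"
          then have "2 ^ k \<le> q" by simp
          then have "real (2 ^ k) \<le> real q" by (simp only: of_nat_le_iff)
          then have "2 ^ k \<le> real q" unfolding of_nat_power of_nat_numeral .
          then have "2 ^ k \<le> real q + 1" by linarith
          then have "(2 ^ k) / (real n * 2 ^ k) \<le> (real q + 1) / (real n * 2 ^ k)"
            by (intro divide_right_mono) auto
          then have "1 / n \<le> (real q + 1) / real (n * 2 ^ k)" using n by simp
          then show "star mes (g i) ((real q + 1) / real (n * 2 ^ k)) = 0" by (rule s0[OF i])
        qed
      qed simp
      finally show ?thesis by (simp add: L_def divide_divide_eq_left mult.commute)
    qed
    have "(\<lambda>k. \<integral>\<^sup>+t. ennreal (lstep (n * 2 ^ k) (star mes (g i)) t) \<partial>mes) 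
       \<longlonglongrightarrow> (\<integral>\<^sup>+t. ennreal (star mes (g i) t) \<partial>mes)"
    proof (rule nn_integral_LIMSEQ)
      show "incseq (\<lambda>k t. ennreal (lstep (n * 2 ^ k) (star mes (g i)) t))"
      proof (rule incseq_SucI, rule le_funI)
        fix k t
        have "lstep (n * 2 ^ k) (star mes (g i)) t \<le> lstep (n * 2 ^ k * 2) (star mes (g i)) t"
          by (rule lstep_refine_le) (use n mes.star_antimono[OF gm[OF i]] in auto)
        then show "ennreal (lstep (n * 2 ^ k) (star mes (g i)) t) \<le> ennreal (lstep (n * 2 ^ Suc k) (star mes (g i)) t)"
          by (intro ennreal_leI) (simp add: mult_ac)
      qed
      show "(\<lambda>t. ennreal (lstep (n * 2 ^ k) (star mes (g i)) t)) \<in> borel_measurable mes" for k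
        unfolding lstep_def by measurable
      show "(\<lambda>k. ennreal (lstep (n * 2 ^ k) (star mes (g i)) t)) \<longlonglongrightarrow> ennreal (star mes (g i) t)" for t
      proof (rule tendsto_ennrealI, rule mes.lstep_star_tendsto[OF gm[OF i]])
        show "0 < n * 2 ^ k" for k using n by simp
        show "filterlim (\<lambda>k. n * 2 ^ k) at_top sequentially"
        proof (rule filterlim_at_top_mono[OF filterlim_ident])
          show "eventually (\<lambda>k. k \<le> n * 2 ^ k) sequentially"
          proof (rule always_eventually, rule allI)
            fix k :: nat
            have "k \<le> 1 * 2 ^ k" by simp
            also have "\<dots> \<le> n * 2 ^ k" using n by (intro mult_right_mono) auto
            finally show "k \<le> n * 2 ^ k" .
          qed
        qed
      qed
    qed
    then show ?thesis unfolding eq mes.nn_integral_star[OF gm[OF i]] .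
  qed
  show "0 \<le> L k i" if "i < n" by (rule L0[OF that])
qed

text \<open>
  The Riemann sums are bounded: the average of all of them over the whole interval is a constant
  function of norm at most \<open>\<parallel>f\<parallel>\<close>. Taking \<open>n = 1\<close> this is the inclusion of the space in \<open>L\<^sub>1\<close>.
\<close>

lemma integrable_on_cell:
  assumes f: "f \<in> car" and n: "0 < n" and i: "i < n"
  shows "integrable mes (\<lambda>t. f t * indicator (cell n i) t)"
proof -
  define L where "L k i = (\<Sum>j<2 ^ k. star mes (\<lambda>t. f t * indicator (cell n i) t) 
     ((real j + 1) / (real n * 2 ^ k))) / 2 ^ k" for k i
  note L = averaging_aux[OF f n, folded L_def]
  have bound: "L k i / n \<le> nrm f / nrm (\<lambda>t. 1)" for k
  proof -
    let ?m = "(\<Sum>j<n. L k j) / n"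
    have m0: "0 \<le> ?m" by (intro divide_nonneg_nonneg sum_nonneg) (auto intro: L(3))
    have "nrm (step 1 (\<lambda>i. (\<Sum>j<n. L k (i * n + j)) / n)) \<le> nrm (step (1 * n) (L k))"
      by (rule nrm_step_block_means_le) (use n in auto)
    then have "nrm (step 1 (\<lambda>i. (\<Sum>j<n. L k (i * n + j)) / n)) \<le> nrm f" using L(1)[of k] by simp
    moreover have "nrm (step 1 (\<lambda>i. (\<Sum>j<n. L k (i * n + j)) / n)) = nrm (\<lambda>t. ?m * 1)"
    proof (rule cong_AE(2))
      show "(\<lambda>t. ?m * 1) \<in> car" by (rule scale_car[OF one_car])
      show "AE t in mes. \<bar>step 1 (\<lambda>i. (\<Sum>j<n. L k (i * n + j)) / n) t\<bar> = \<bar>?m * 1\<bar>"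
        using AE_mes_neq[of 0] AE_space[of mes]
      proof eventually_elim
        fix t :: real assume "t \<noteq> 0" "t \<in> space mes"
        then have "t \<in> cell 1 0" by (auto simp: cell_def)
        then show "\<bar>step 1 (\<lambda>i. (\<Sum>j<n. L k (i * n + j)) / n) t\<bar> = \<bar>?m * 1\<bar>"
          by (subst step_eq[of 1 0]) auto
      qed
    qed measurable
    ultimately have "?m * nrm (\<lambda>t. 1) \<le> nrm f"
      using nrm_scale[OF one_car, of ?m] unfolding abs_of_nonneg[OF m0] by linarith
    then have "?m \<le> nrm f / nrm (\<lambda>t. 1)" using nrm_one_pos by (simp add: field_simps)
    moreover have "L k i \<le> (\<Sum>j<n. L k j)"
      using i by (intro member_le_sum) (auto intro: L(3))
    then have "L k i / n \<le> ?m" by (rule divide_right_mono) simp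
    ultimately show ?thesis by linarith
  qed
  have "(\<integral>\<^sup>+t. ennreal \<bar>f t * indicator (cell n i) t\<bar> \<partial>mes) \<le> ennreal (nrm f / nrm (\<lambda>t. 1))"
    by (rule LIMSEQ_le_const2[OF L(2)[OF i]]) (use bound ennreal_leI in blast)
  also have "\<dots> < \<infinity>" by simp
  finally show ?thesis
    using car_measurable[OF f] cell_sets[OF n i] by (intro integrableI_bounded) auto
qed

text \<open>
  Finitely many cell averages are approximated uniformly by the Riemann sums, so that the bound for the
  latter passes to the limit.
\<close>

lemma averaging:
  assumes f: "f \<in> car" and n: "0 < n" and nonneg: "\<And>t. 0 \<le> f t"
  shows "nrm (step n (\<lambda>i. real n * (\<integral>t. f t * indicator (cell n i) t \<partial>mes))) \<le> nrm f"
proof -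
  define L where "L k i = (\<Sum>j<2 ^ k. star mes (\<lambda>t. f t * indicator (cell n i) t) 
     ((real j + 1) / (real n * 2 ^ k))) / 2 ^ k" for k i
  note L = averaging_aux[OF f n, folded L_def]
  define A where "A i = real n * (\<integral>t. f t * indicator (cell n i) t \<partial>mes)" for i
  have lim: "(\<lambda>k. L k i) \<longlonglongrightarrow> A i" if i: "i < n" for i
  proof -
    have "(\<integral>\<^sup>+t. ennreal \<bar>f t * indicator (cell n i) t\<bar> \<partial>mes) = ennreal (A i / n)"
      using nn_integral_eq_integral[OF integrable_on_cell[OF f n i]] nonneg n by (simp add: A_def)
    then have "(\<lambda>k. ennreal (L k i / n)) \<longlonglongrightarrow> ennreal (A i / n)" using L(2)[OF i] by simp
    moreover have "0 \<le> A i" unfolding A_def using nonneg by (intro mult_nonneg_nonneg integral_nonneg_AE) auto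
    ultimately have "(\<lambda>k. L k i / n) \<longlonglongrightarrow> A i / n"
      using L(3)[OF i] by (subst (asm) tendsto_ennreal_iff) auto
    then have "(\<lambda>k. L k i / n * n) \<longlonglongrightarrow> A i / n * n" by (rule tendsto_mult_right)
    then show ?thesis using n by simp
  qed
  have "nrm (step n A) \<le> nrm f + (\<Sum>i<n. \<bar>A i - L k i\<bar>) * nrm (\<lambda>t. 1)" for k
  proof -
    have "step n A = (\<lambda>t. step n (L k) t + step n (\<lambda>i. A i - L k i) t)"
      unfolding step_def sum.distrib[symmetric]
      by (intro ext sum.cong refl) (simp add: left_diff_distrib)
    then have "nrm (step n A) \<le> nrm (step n (L k)) + nrm (step n (\<lambda>i. A i - L k i))"
      using nrm_triangle[OF step_car[of n "L k"] step_car[of n "\<lambda>i. A i - L k i"]] by simp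
    then show ?thesis using L(1)[of k] step_nrm_le[of n "\<lambda>i. A i - L k i"] by linarith
  qed
  moreover have "(\<lambda>k. nrm f + (\<Sum>i<n. \<bar>A i - L k i\<bar>) * nrm (\<lambda>t. 1)) \<longlonglongrightarrow> nrm f + (\<Sum>i<n. \<bar>A i - A i\<bar>) * nrm (\<lambda>t. 1)"
    by (intro tendsto_intros lim) auto
  ultimately have "nrm (step n A) \<le> nrm f + (\<Sum>i<n. \<bar>A i - A i\<bar>) * nrm (\<lambda>t. 1)"
    by (intro LIMSEQ_le_const) auto
  then show ?thesis unfolding A_def by simp
qed

end

section \<open>Consequences of separability and of the Fatou property\<close>

lemma (in prob_space) tail_placed_cut:
  assumes g: "g \<in> borel_measurable M" and "0 \<le> a" "0 \<le> h" "a + h \<le> 1" "0 \<le> \<tau>"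
  shows "tail mes (\<lambda>t. placed M g a 1 t * indicator {..<a + h} t) \<tau> = min (tail M g \<tau>) h"
proof -
  have "{t \<in> space mes. \<tau> < \<bar>placed M g a 1 t * indicator {..<a + h} t\<bar>}
      = {a <..< a + min (tail M g \<tau>) h}"
    using less_placed_iff[OF g assms(5), of 1 a] placed_nonneg[OF g, of a 1] assms
    by (auto simp: indicator_def split: if_splits)
  then have "tail mes (\<lambda>t. placed M g a 1 t * indicator {..<a + h} t) \<tau> 
     = measure mes {a <..< a + min (tail M g \<tau>) h}" by (simp add: tail_eq_measure)
  also have "\<dots> = min (tail M g \<tau>) h"
    using assms tail_nonneg[of g \<tau>] by (subst measure_mes_Ioo) auto
  finally show ?thesis .
qed

lemma (in prob_space) tail_star_cut:
  assumes g: "g \<in> borel_measurable M" and "0 \<le> h" "h \<le> 1" "0 \<le> \<tau>"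
  shows "tail mes (\<lambda>t. star M g t * indicator {..<h} t) \<tau> = min (tail M g \<tau>) h"
  using tail_placed_cut[OF g, of 0 h \<tau>] assms by (simp add: star_eq_placed)

context ri
begin

lemma star_cut_car:
  assumes "x \<in> car" shows "(\<lambda>t. star mes x t * indicator {..<h} t) \<in> car"
proof (rule solid(1))
  have [measurable]: "star mes x \<in> borel_measurable borel"
    by (rule mes.borel_measurable_star[OF car_measurable[OF assms]])
  show "(\<lambda>t. star mes x t * indicator {..<h} t) \<in> borel_measurable mes"
    by (rule borel_measurable_mesI) measurable
  show "star mes x \<in> car" using assms car_measurable[OF assms] by (simp add: star_car_iff)
qed (auto simp: indicator_def)

text \<open>
  Elements of a countable dense set closer than \<open>e / 2\<close> to different members of the family
  are different, but the family is indexed by an uncountable interval.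
\<close>

lemma separable_no_separated_family:
  assumes sep: "separable_fspace E" and "0 < e" and X: "\<And>\<theta>::real. 0 < \<theta> \<Longrightarrow> \<theta> < 1 \<Longrightarrow> X \<theta> \<in> car"
    and dist: "\<And>\<theta> \<theta>'. 0 < \<theta> \<Longrightarrow> \<theta> < \<theta>' \<Longrightarrow> \<theta>' < 1 \<Longrightarrow> e \<le> nrm (\<lambda>t. X \<theta> t - X \<theta>' t)"
  shows False
proof -
  obtain D where D: "countable D" "D \<subseteq> car" 
      "\<forall>x\<in>car. \<forall>\<epsilon>>0. \<exists>d\<in>D. nrm (\<lambda>t. x t - d t) < \<epsilon>"
    using sep unfolding separable_fspace_def by blast
  have "\<forall>\<theta>\<in>{0<..<1}. \<exists>d\<in>D. nrm (\<lambda>t. X \<theta> t - d t) < e / 2"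
    using D(3) X \<open>0 < e\<close> by (metis greaterThanLessThan_iff half_gt_zero)
  then obtain d where d: "\<And>\<theta>. \<theta> \<in> {0<..<1} \<Longrightarrow> d \<theta> \<in> D \<and> nrm (\<lambda>t. X \<theta> t - d \<theta> t) < e / 2"
    by metis
  have ne: "d \<theta> \<noteq> d \<theta>'" if "0 < \<theta>" "\<theta> < \<theta>'" "\<theta>' < 1" for \<theta> \<theta>'
  proof
    assume eq: "d \<theta> = d \<theta>'"
    have in1: "\<theta> \<in> {0<..<1}" "\<theta>' \<in> {0<..<1}" using that by auto
    have c: "X \<theta> \<in> car" "X \<theta>' \<in> car" "d \<theta> \<in> car" using X that d[OF in1(1)] D(2) by auto
    have c1: "(\<lambda>t. X \<theta> t - d \<theta> t) \<in> car" "(\<lambda>t. X \<theta>' t - d \<theta> t) \<in> car"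
      using diff_car(1) c by auto
    have "e \<le> nrm (\<lambda>t. X \<theta> t - X \<theta>' t)" by (rule dist[OF that])
    also have "\<dots> = nrm (\<lambda>t. (X \<theta> t - d \<theta> t) - (X \<theta>' t - d \<theta> t))" by simp
    also have "\<dots> \<le> nrm (\<lambda>t. X \<theta> t - d \<theta> t) + nrm (\<lambda>t. X \<theta>' t - d \<theta> t)"
      by (rule diff_car(2)[OF c1])
    also have "\<dots> < e / 2 + e / 2"
      using d[OF in1(1)] d[OF in1(2)] eq by (intro add_strict_mono) auto
    finally show False by simp
  qed
  have "inj_on d {0<..<1}"
  proof (rule inj_onI)
    fix a b :: real assume *: "a \<in> {0<..<1}" "b \<in> {0<..<1}" "d a = d b"
    then show "a = b" using ne[of a b] ne[of b a] by (cases a b rule: linorder_cases) auto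
  qed
  moreover have "countable (d ` {0<..<1})"
    by (rule countable_subset[OF _ D(1)]) (use d in auto)
  ultimately have "countable {0<..<1::real}" by (rule countable_image_inj_on[rotated])
  then show False using uncountable_open_interval[of 0 "1::real"] by simp
qed

text \<open>
  Shift the rearrangement of \<open>x\<close> to the right by \<open>\<theta>\<close>. Two shifts by \<open>\<theta> < \<theta>'\<close> differ on the
  interval between \<open>\<theta>\<close> and \<open>\<theta>'\<close>, where the second one vanishes, by a copy of the initial piece of
  length \<open>\<theta>' - \<theta>\<close>. If all initial pieces had norm at least \<open>e\<close>, the shifts would be an uncountable
  separated family.
\<close>

lemma separable_star_cut_small:
  assumes sep: "separable_fspace E" and x: "x \<in> car" and "0 < e"
  shows "\<exists>h>0. h \<le> 1 \<and> nrm (\<lambda>t. star mes x t * indicator {..<h} t) < e"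
proof (rule ccontr)
  assume neg: "\<not> (\<exists>h>0. h \<le> 1 \<and> nrm (\<lambda>t. star mes x t * indicator {..<h} t) < e)"
  note xm = car_measurable[OF x]
  \<comment> \<open>\<open>X \<theta>\<close> is the rearrangement of \<open>x\<close> shifted to the right by \<open>\<theta>\<close>.\<close>
  define X where "X \<theta> = placed mes x \<theta> 1" for \<theta>
  have Xb[measurable]: "X \<theta> \<in> borel_measurable borel" for \<theta>
    unfolding X_def by (rule mes.borel_measurable_placed[OF xm]) simp
  have cut_m: "(\<lambda>t. X \<theta> t * indicator {..<c} t) \<in> borel_measurable mes" for \<theta> c
    by (rule borel_measurable_mesI) measurable
  have Xc: "X \<theta> \<in> car" if "0 < \<theta>" "\<theta> < 1" for \<theta>
  proof -
    have cut: "(\<lambda>t. X \<theta> t * indicator {..<\<theta> + (1 - \<theta>)} t) \<in> car"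
    proof (rule dominated(1)[OF cut_m x])
      fix \<tau> :: real assume "0 \<le> \<tau>"
      show "tail mes (\<lambda>t. X \<theta> t * indicator {..<\<theta> + (1 - \<theta>)} t) \<tau> \<le> tail mes x \<tau>"
        unfolding X_def using that \<open>0 \<le> \<tau>\<close> by (subst mes.tail_placed_cut[OF xm]) auto
    qed
    show ?thesis
    proof (rule cong_AE(1)[OF borel_measurable_mesI[OF Xb] cut])
      show "AE t in mes. \<bar>X \<theta> t\<bar> = \<bar>X \<theta> t * indicator {..<\<theta> + (1 - \<theta>)} t\<bar>"
        using AE_mes_neq[of 1] AE_space[of mes] by eventually_elim (auto simp: indicator_def)
    qed
  qed
  have "e \<le> nrm (\<lambda>t. X \<theta> t - X \<theta>' t)" if "0 < \<theta>" "\<theta> < \<theta>'" "\<theta>' < 1" for \<theta> \<theta>'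
  proof -
    define h where "h = \<theta>' - \<theta>"
    have h: "0 < h" "h \<le> 1" "\<theta> + h = \<theta>'" using that by (auto simp: h_def)
    have diff: "(\<lambda>t. X \<theta> t - X \<theta>' t) \<in> car" using Xc that by (intro diff_car(1)) auto
    have cut: "(\<lambda>t. X \<theta> t * indicator {..<\<theta> + h} t) \<in> car" 
       "nrm (\<lambda>t. X \<theta> t * indicator {..<\<theta> + h} t) \<le> nrm (\<lambda>t. X \<theta> t - X \<theta>' t)"
    proof -
      have ae: "AE t in mes. \<bar>X \<theta> t * indicator {..<\<theta> + h} t\<bar> \<le> \<bar>X \<theta> t - X \<theta>' t\<bar>"
        by (auto simp: X_def placed_def star_def indicator_def h)
      show "(\<lambda>t. X \<theta> t * indicator {..<\<theta> + h} t) \<in> car" 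
       "nrm (\<lambda>t. X \<theta> t * indicator {..<\<theta> + h} t) \<le> nrm (\<lambda>t. X \<theta> t - X \<theta>' t)"
        by (rule solid[OF cut_m diff ae])+
    qed
    have "nrm (\<lambda>t. star mes x t * indicator {..<h} t) = nrm (\<lambda>t. X \<theta> t * indicator {..<\<theta> + h} t)"
    proof (rule rearr(2)[OF car_measurable[OF star_cut_car[OF x]] cut(1)])
      fix \<tau> :: real assume "0 \<le> \<tau>"
      then show "tail mes (\<lambda>t. star mes x t * indicator {..<h} t) \<tau> =
         tail mes (\<lambda>t. X \<theta> t * indicator {..<\<theta> + h} t) \<tau>"
        unfolding X_def using that h
        by (subst mes.tail_placed_cut[OF xm]; (subst mes.tail_star_cut[OF xm])?) auto
    qed
    moreover have "e \<le> nrm (\<lambda>t. star mes x t * indicator {..<h} t)" using neg h by force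
    ultimately show ?thesis using cut(2) by linarith
  qed
  then show False using separable_no_separated_family[OF sep \<open>0 < e\<close>, of X] Xc by blast
qed

text \<open>
  The part of \<open>x\<close> above a high level is supported on a set of small measure, so its tail is below that
  of a short initial piece of the rearrangement.
\<close>

lemma separable_truncation:
  assumes sep: "separable_fspace E" and x: "x \<in> car" and "0 < e"
  shows "\<exists>b\<ge>0. (\<lambda>t. x t * indicator {t. b < \<bar>x t\<bar>} t) \<in> car \<and> 
    nrm (\<lambda>t. x t * indicator {t. b < \<bar>x t\<bar>} t) < e"
proof -
  note xm = car_measurable[OF x]
  obtain h where h: "0 < h" "h \<le> 1" "nrm (\<lambda>t. star mes x t * indicator {..<h} t) < e"
    using separable_star_cut_small[OF assms] by blast
  obtain b where b: "0 \<le> b" "tail mes x b < h" using mes.tail_eventually_small[OF xm h(1)] by blast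
  have m: "(\<lambda>t. x t * indicator {t. b < \<bar>x t\<bar>} t) \<in> borel_measurable mes"
    unfolding indicator_def using xm by measurable
  have "tail mes (\<lambda>t. x t * indicator {t. b < \<bar>x t\<bar>} t) \<tau>
      \<le> tail mes (\<lambda>t. star mes x t * indicator {..<h} t) \<tau>" if "0 \<le> \<tau>" for \<tau>
  proof -
    have "tail mes (\<lambda>t. x t * indicator {t. b < \<bar>x t\<bar>} t) \<tau> \<le> tail mes x \<tau>"
      by (rule mes.tail_mono[OF xm]) (auto simp: indicator_def)
    moreover have "tail mes (\<lambda>t. x t * indicator {t. b < \<bar>x t\<bar>} t) \<tau> \<le> tail mes x b"
      unfolding tail_eq_measure
    proof (rule mes.finite_measure_mono)
      show "{w \<in> space mes. b < \<bar>x w\<bar>} \<in> sets mes" using xm by measurable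
    qed (use that in \<open>auto simp: indicator_def split: if_splits\<close>)
    ultimately show ?thesis using mes.tail_star_cut[OF xm _ h(2) that] h b by auto
  qed
  from dominated[OF m star_cut_car[OF x] this] h(3) b(1) show ?thesis by force
qed

lemma separable_small_sets:
  assumes sep: "separable_fspace E" and "0 < e"
  shows "\<exists>h>0. h \<le> 1 \<and> (\<forall>A\<in>sets mes. measure mes A \<le> h \<longrightarrow> nrm (indicator A) < e)"
proof -
  obtain h where h: "0 < h" "h \<le> 1" "nrm (\<lambda>t. star mes (\<lambda>t. 1) t * indicator {..<h} t) < e"
    using separable_star_cut_small[OF sep one_car assms(2)] by blast
  have "nrm (indicator A) < e" if A: "A \<in> sets mes" "measure mes A \<le> h" for A
  proof -
    have Am: "(indicator A :: real \<Rightarrow> real) \<in> borel_measurable mes" using A by measurable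
    have "tail mes (indicator A) \<tau> \<le> tail mes (\<lambda>t. star mes (\<lambda>t. 1) t * indicator {..<h} t) \<tau>"
      if "0 \<le> \<tau>" for \<tau>
    proof -
      have "tail mes (indicator A) \<tau> \<le> tail mes (\<lambda>t. 1) \<tau>"
        by (rule mes.tail_mono) (auto simp: indicator_def)
      moreover have "tail mes (indicator A) \<tau> \<le> measure mes A"
        unfolding tail_eq_measure using A(1) that
        by (intro mes.finite_measure_mono) (auto simp: indicator_def split: if_splits)
      ultimately show ?thesis using mes.tail_star_cut[OF _ _ h(2) that, of "\<lambda>t. 1"] h A(2) by auto
    qed
    from dominated(2)[OF Am star_cut_car[OF one_car] this] h(3) show ?thesis by force
  qed
  then show ?thesis using h by blast
qed

text \<open>
  The limit exceeds \<open>u k\<close> by a small constant off a set whose measure tends to \<open>0\<close>, and on that set by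
  at most \<open>c\<close>; indicator functions of small sets have small norm.
\<close>

lemma separable_bounded_fatou:
  assumes sep: "separable_fspace E"
    and m: "\<And>k. u k \<in> borel_measurable mes" "v \<in> borel_measurable mes"
    and nonneg: "\<And>k t. 0 \<le> u k t" and le: "\<And>k t. u k t \<le> v t" "\<And>t. v t \<le> c"
    and mono: "\<And>t. incseq (\<lambda>k. u k t)" and lim: "\<And>t. (\<lambda>k. u k t) \<longlonglongrightarrow> v t"
    and bound: "\<And>k. nrm (u k) \<le> D"
  shows "nrm v \<le> D"
proof (rule field_le_epsilon)
  fix e :: real assume "0 < e"
  have v0: "0 \<le> v t" for t using nonneg le(1) order_trans by blast
  then have c0: "0 \<le> c" using le(2) order_trans by blast
  have uc: "u k \<in> car" for k
  proof (rule bounded_car(1)[OF m(1) _ c0], rule AE_I2)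
    fix t show "\<bar>u k t\<bar> \<le> c" using nonneg[of k t] le(1)[of k t] le(2)[of t] by linarith
  qed
  define d where "d = e / (2 * nrm (\<lambda>t. 1))"
  have d: "0 < d" "d * nrm (\<lambda>t. 1) = e / 2" using \<open>0 < e\<close> nrm_one_pos by (auto simp: d_def)
  have "0 < e / (2 * (c + 1))" using \<open>0 < e\<close> c0 by simp
  then obtain h where h: "0 < h" "\<And>A. A \<in> sets mes \<Longrightarrow> measure mes A \<le> h \<Longrightarrow> nrm (indicator A) < e / (2 * (c + 1))"
    using separable_small_sets[OF sep] by blast
  define A where "A k = {t \<in> space mes. d < v t - u k t}" for k
  have Am [measurable]: "A k \<in> sets mes" for k unfolding A_def using m by measurable
  have "(\<lambda>k. measure mes (A k)) \<longlonglongrightarrow> measure mes (\<Inter>k. A k)"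
  proof (rule mes.finite_Lim_measure_decseq)
    show "decseq A"
    proof (rule decseq_SucI)
      fix k
      have "u k t \<le> u (Suc k) t" for t using mono[of t] by (rule incseq_SucD)
      then show "A (Suc k) \<subseteq> A k" unfolding A_def by (auto intro: less_le_trans)
    qed
  qed (use Am in auto)
  moreover have "(\<Inter>k. A k) = {}"
  proof -
    have False if "t \<in> (\<Inter>k. A k)" for t
    proof -
      have "eventually (\<lambda>k. v t - d < u k t) sequentially"
        using order_tendstoD(1)[OF lim[of t], of "v t - d"] d(1) by simp
      then obtain k where "v t - d < u k t" by (auto simp: eventually_sequentially)
      moreover have "t \<in> A k" using that by blast
      ultimately show False by (simp add: A_def)
    qed
    then show ?thesis by blast
  qed
  ultimately have "(\<lambda>k. measure mes (A k)) \<longlonglongrightarrow> 0" by simp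
  from order_tendstoD(2)[OF this h(1)] obtain k where k: "measure mes (A k) < h"
    by (auto simp: eventually_sequentially)
  have ind: "indicator (A k) \<in> car"
    by (rule bounded_car(1)[of _ 1]) (auto simp: indicator_def)
  have cc: "(\<lambda>t. d * 1) \<in> car" "(\<lambda>t. c * indicator (A k) t) \<in> car"
    by (rule scale_car[OF one_car], rule scale_car[OF ind])
  have vu: "(\<lambda>t. u k t + (d * 1 + c * indicator (A k) t)) \<in> car"
    by (intro add_car uc cc)
  have "nrm v \<le> nrm (\<lambda>t. u k t + (d * 1 + c * indicator (A k) t))"
  proof (rule solid(2)[OF m(2) vu], rule AE_I2)
    fix t assume t: "t \<in> space mes"
    have "v t \<le> u k t + (d * 1 + c * indicator (A k) t)"
      using t le(2)[of t] nonneg[of k t] d(1) c0 by (cases "t \<in> A k") (auto simp: A_def not_less)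
    then show "\<bar>v t\<bar> \<le> \<bar>u k t + (d * 1 + c * indicator (A k) t)\<bar>" using v0[of t] by linarith
  qed
  also have "\<dots> \<le> nrm (u k) + nrm (\<lambda>t. d * 1 + c * indicator (A k) t)"
    by (rule nrm_triangle[OF uc add_car[OF cc]])
  also have "nrm (\<lambda>t. d * 1 + c * indicator (A k) t) \<le> nrm (\<lambda>t. d * 1) + nrm (\<lambda>t. c * indicator (A k) t)"
    by (rule nrm_triangle[OF cc])
  also have "nrm (\<lambda>t. d * 1) = e / 2" using nrm_scale[OF one_car, of d] d by simp
  also have "nrm (\<lambda>t. c * indicator (A k) t) \<le> e / 2"
  proof -
    have "nrm (\<lambda>t. c * indicator (A k) t) = c * nrm (indicator (A k))"
      using nrm_scale[OF ind, of c] c0 by simp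
    also have "\<dots> \<le> (c + 1) * (e / (2 * (c + 1)))"
      using h(2)[OF Am[of k]] k c0 nrm_nonneg[OF ind] by (intro mult_mono) auto
    also have "\<dots> = e / 2" using c0 by (simp add: field_simps)
    finally show ?thesis .
  qed
  finally show "nrm v \<le> D + e" using bound[of k] by linarith
qed

text \<open>
  The truncations of \<open>u\<close> at the levels \<open>n\<close> form a Cauchy sequence, and the limit that completeness
  provides agrees with \<open>u\<close> wherever \<open>u\<close> is below a given level.
\<close>

lemma car_if_truncations_Cauchy:
  assumes um: "u \<in> borel_measurable mes" and nonneg: "\<And>t. 0 \<le> u t"
    and bound: "\<And>c. 0 \<le> c \<Longrightarrow> nrm (\<lambda>t. min (u t) c) \<le> D"
    and small: "\<And>e. 0 < e \<Longrightarrow> \<exists>b. \<forall>c\<ge>0. nrm (\<lambda>t. u t * indicator {t. b < u t \<and> u t \<le> c} t) \<le> e"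
  shows "u \<in> car" "nrm u \<le> D"
proof -
  define w where "w n t = u t * indicator {t. u t \<le> real n} t" for n t
  have cut_m: "(\<lambda>t. u t * indicator {t. b < u t \<and> u t \<le> c} t) \<in> borel_measurable mes" for b c
    unfolding indicator_def using um by measurable
  have cut_c: "(\<lambda>t. u t * indicator {t. b < u t \<and> u t \<le> c} t) \<in> car" if "0 \<le> c" for b c
    by (rule bounded_car(1)[OF cut_m _ that]) (use nonneg that in \<open>auto simp: indicator_def\<close>)
  have wm: "w n \<in> borel_measurable mes" for n
    unfolding w_def[abs_def] indicator_def using um by measurable
  have wc: "w n \<in> car" for n
    by (rule bounded_car(1)[OF wm, of _ "real n"]) (use nonneg in \<open>auto simp: indicator_def w_def\<close>)
  have "\<exists>N. \<forall>m\<ge>N. \<forall>n\<ge>N. nrm (\<lambda>t. w m t - w n t) < e" if e: "0 < e" for e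
  proof -
    obtain b where b: "\<And>c. 0 \<le> c \<Longrightarrow> nrm (\<lambda>t. u t * indicator {t. b < u t \<and> u t \<le> c} t) \<le> e / 2"
      using small[of "e / 2"] e by auto
    obtain N :: nat where N: "b \<le> real N" using real_arch_simple by blast
    have "nrm (\<lambda>t. w m t - w n t) < e" if mn: "N \<le> m" "N \<le> n" for m n
    proof -
      have "nrm (\<lambda>t. w m t - w n t) \<le> nrm (\<lambda>t. u t * indicator {t. b < u t \<and> u t \<le> real (max m n)} t)"
      proof (rule solid(2)[OF _ cut_c])
        show "(\<lambda>t. w m t - w n t) \<in> borel_measurable mes" using wm by measurable
        show "AE t in mes. \<bar>w m t - w n t\<bar> \<le> \<bar>u t * indicator {t. b < u t \<and> u t \<le> real (max m n)} t\<bar>"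
          using nonneg N mn by (auto simp: w_def indicator_def)
      qed simp
      then show ?thesis using b[of "real (max m n)"] e by linarith
    qed
    then show ?thesis by blast
  qed
  from nrm_complete[OF wc this] obtain x where x: "x \<in> car" and lim: "(\<lambda>n. nrm (\<lambda>t. w n t - x t)) \<longlonglongrightarrow> 0"
    by blast
  have xm: "x \<in> borel_measurable mes" by (rule car_measurable[OF x])
  have eq_k: "AE t in mes. u t \<le> real k \<longrightarrow> u t = x t" for k :: nat
  proof -
    define z where "z t = (u t - x t) * indicator {t. u t \<le> real k} t" for t
    have zm: "z \<in> borel_measurable mes" unfolding z_def[abs_def] indicator_def using um xm by measurable
    have le: "z \<in> car \<and> nrm z \<le> nrm (\<lambda>t. w n t - x t)" if "k \<le> n" for n
    proof -
      have "AE t in mes. \<bar>z t\<bar> \<le> \<bar>w n t - x t\<bar>"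
        using that by (intro AE_I2) (auto simp: z_def w_def indicator_def)
      then show ?thesis using solid[OF zm diff_car(1)[OF wc x]] by blast
    qed
    have "nrm z \<le> 0" by (rule LIMSEQ_le_const[OF lim]) (use le in blast)
    then have "nrm z = 0" using nrm_nonneg[of z] le[OF order_refl] by simp
    then have "AE t in mes. z t = 0" using nrm_eq_0_iff[of z] le[OF order_refl] by simp
    then show ?thesis by eventually_elim (auto simp: z_def)
  qed
  have "AE t in mes. \<forall>k. u t \<le> real k \<longrightarrow> u t = x t" using eq_k by (subst AE_all_countable) blast
  then have ux: "AE t in mes. u t = x t"
    by eventually_elim (use real_arch_simple in blast)
  then have abs: "AE t in mes. \<bar>u t\<bar> = \<bar>x t\<bar>" by eventually_elim simp
  show uc: "u \<in> car" by (rule cong_AE(1)[OF um x abs])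
  have "nrm u \<le> D + nrm (\<lambda>t. w n t - x t)" for n
  proof -
    have "nrm u = nrm x" by (rule cong_AE(2)[OF um x abs])
    also have "\<dots> = nrm (\<lambda>t. w n t - (w n t - x t))" by simp
    also have "\<dots> \<le> nrm (w n) + nrm (\<lambda>t. w n t - x t)"
      by (rule diff_car(2)[OF wc diff_car(1)[OF wc x]])
    also have "nrm (w n) \<le> nrm (\<lambda>t. min (u t) (real n))"
    proof (rule solid(2)[OF wm])
      show "(\<lambda>t. min (u t) (real n)) \<in> car"
        by (rule bounded_car(1)[of _ "real n"]) (use um nonneg in auto)
      show "AE t in mes. \<bar>w n t\<bar> \<le> \<bar>min (u t) (real n)\<bar>"
        using nonneg by (auto simp: w_def indicator_def)
    qed
    finally show ?thesis using bound[of "real n"] by linarith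
  qed
  moreover have "(\<lambda>n. D + nrm (\<lambda>t. w n t - x t)) \<longlonglongrightarrow> D + 0" by (intro tendsto_intros lim)
  ultimately show "nrm u \<le> D" using LIMSEQ_le_const[of _ "D + 0" "nrm u"] by auto
qed

text \<open>
  The pairing of \<open>u k\<close> with the absolute value of an element of the unit ball of \<open>E'\<close> is at most
  \<open>D\<close>; monotone convergence carries this bound over to \<open>v\<close>.
\<close>

lemma bidual_fatou:
  assumes bid: "same_fspace E (kothe_dual mes (kothe_dual mes E))"
    and um: "\<And>k. u k \<in> car" and vm: "v \<in> borel_measurable mes"
    and nonneg: "\<And>k t. 0 \<le> u k t"
    and mono: "\<And>t. incseq (\<lambda>k. u k t)" and lim: "\<And>t. (\<lambda>k. u k t) \<longlonglongrightarrow> v t"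
    and bound: "\<And>k. nrm (u k) \<le> D"
  shows "v \<in> car" "nrm v \<le> D"
proof -
  define E' where "E' = kothe_dual mes E"
  define U where "U = {y \<in> fcarrier E'. fnorm E' y \<le> 1}"
  have carE'': "fcarrier (kothe_dual mes E') = {x \<in> borel_measurable mes.
         (\<forall>y\<in>fcarrier E'. fnorm E' y \<le> 1 \<longrightarrow> integrable mes (\<lambda>t. x t * y t)) \<and>
         bdd_above ((\<lambda>y. \<integral>t. x t * y t \<partial>mes) ` U)}"
    and nrmE'': "fnorm (kothe_dual mes E') x = (SUP y\<in>U. \<integral>t. x t * y t \<partial>mes)" for x
    unfolding kothe_dual_def[of mes E'] U_def by simp_all
  have car: "car = fcarrier (kothe_dual mes E')" 
    and nrm: "\<And>x. x \<in> car \<Longrightarrow> nrm x = (SUP y\<in>U. \<integral>t. x t * y t \<partial>mes)"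
    using bid nrmE'' unfolding same_fspace_def E'_def[symmetric] by auto
  have pair: "integrable mes (\<lambda>t. x t * y t)" "(\<integral>t. x t * y t \<partial>mes) \<le> nrm x" if "x \<in> car" "y \<in> U" for x y
  proof -
    show "integrable mes (\<lambda>t. x t * y t)" using that unfolding car carE'' U_def by blast
    have "bdd_above ((\<lambda>y. \<integral>t. x t * y t \<partial>mes) ` U)" using that(1) unfolding car carE'' by simp
    then show "(\<integral>t. x t * y t \<partial>mes) \<le> nrm x"
      unfolding nrm[OF that(1)] using that(2) by (rule cSUP_upper[rotated])
  qed
  have ym: "y \<in> borel_measurable mes" if "y \<in> U" for y
    using that unfolding U_def E'_def kothe_dual_def by simp
  have main: "integrable mes (\<lambda>t. v t * y t) \<and> (\<integral>t. v t * y t \<partial>mes) \<le> D" if y: "y \<in> U" for y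
  proof -
    have v0: "0 \<le> v t" for t by (rule LIMSEQ_le_const[OF lim]) (use nonneg in blast)
    have [measurable]: "y \<in> borel_measurable mes" "v \<in> borel_measurable mes" "u k \<in> borel_measurable mes" for k
      using ym[OF y] vm car_measurable[OF um] by auto
    have D0: "0 \<le> D" using nrm_nonneg[OF um[of 0]] bound[of 0] by linarith
    have uk: "(\<integral>\<^sup>+t. ennreal (u k t * \<bar>y t\<bar>) \<partial>mes) \<le> ennreal D" for k
    proof -
      have sm: "(\<lambda>t. u k t * sgn (y t)) \<in> borel_measurable mes" by measurable
      have ae: "AE t in mes. \<bar>u k t * sgn (y t)\<bar> \<le> \<bar>u k t\<bar>"
        by (auto simp: abs_mult sgn_if)
      note s = solid[OF sm um ae]
      have eq: "u k t * sgn (y t) * y t = u k t * \<bar>y t\<bar>" for t by (simp add: sgn_if)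
      have "(\<integral>\<^sup>+t. ennreal (u k t * \<bar>y t\<bar>) \<partial>mes) = ennreal (\<integral>t. u k t * \<bar>y t\<bar> \<partial>mes)"
        using pair(1)[OF s(1) y] nonneg[of k] unfolding eq by (intro nn_integral_eq_integral) auto
      also have "\<dots> \<le> ennreal D"
        using pair(2)[OF s(1) y] s(2) bound[of k] unfolding eq by (intro ennreal_leI) linarith
      finally show ?thesis .
    qed
    have "(\<lambda>k. \<integral>\<^sup>+t. ennreal (u k t * \<bar>y t\<bar>) \<partial>mes) \<longlonglongrightarrow> (\<integral>\<^sup>+t. ennreal (v t * \<bar>y t\<bar>) \<partial>mes)"
    proof (rule nn_integral_LIMSEQ)
      show "incseq (\<lambda>k t. ennreal (u k t * \<bar>y t\<bar>))"
      proof (rule incseq_SucI, rule le_funI, rule ennreal_leI)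
        fix k t show "u k t * \<bar>y t\<bar> \<le> u (Suc k) t * \<bar>y t\<bar>"
          using incseq_SucD[OF mono[of t], of k] by (rule mult_right_mono) simp
      qed
      show "(\<lambda>k. ennreal (u k t * \<bar>y t\<bar>)) \<longlonglongrightarrow> ennreal (v t * \<bar>y t\<bar>)" for t
        by (intro tendsto_ennrealI tendsto_intros lim)
    qed measurable
    then have fin: "(\<integral>\<^sup>+t. ennreal (v t * \<bar>y t\<bar>) \<partial>mes) \<le> ennreal D"
      by (rule LIMSEQ_le_const2) (use uk in blast)
    have abs: "\<bar>v t * y t\<bar> = v t * \<bar>y t\<bar>" for t using v0[of t] by (simp add: abs_mult)
    have int: "integrable mes (\<lambda>t. v t * y t)"
    proof (rule integrableI_bounded)
      have "(\<integral>\<^sup>+t. ennreal (norm (v t * y t)) \<partial>mes) \<le> ennreal D" using fin by (simp add: abs)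
      also have "\<dots> < \<infinity>" by simp
      finally show "(\<integral>\<^sup>+t. ennreal (norm (v t * y t)) \<partial>mes) < \<infinity>" .
    qed measurable
    have int2: "integrable mes (\<lambda>t. v t * \<bar>y t\<bar>)" using integrable_abs[OF int] unfolding abs .
    have "(\<integral>t. v t * y t \<partial>mes) \<le> (\<integral>t. v t * \<bar>y t\<bar> \<partial>mes)"
      using v0 by (intro integral_mono int int2 mult_left_mono) auto
    also have "\<dots> \<le> D"
    proof -
      have "ennreal (\<integral>t. v t * \<bar>y t\<bar> \<partial>mes) = (\<integral>\<^sup>+t. ennreal (v t * \<bar>y t\<bar>) \<partial>mes)"
        using v0 by (intro nn_integral_eq_integral[symmetric] int2) auto
      then show ?thesis using fin D0 by (metis ennreal_le_iff)
    qed
    finally show ?thesis using int by blast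
  qed
  show vc: "v \<in> car"
    unfolding car carE'' using vm main by (auto simp: U_def intro!: bdd_aboveI[of _ D])
  have "U \<noteq> {}"
  proof -
    have "(\<lambda>t. 0) \<in> fcarrier E'" unfolding E'_def kothe_dual_def by (auto intro!: bdd_aboveI[of _ 0])
    moreover have "fnorm E' (\<lambda>t. 0) \<le> 1"
    proof -
      have "{y \<in> car. nrm y \<le> 1} \<noteq> {}" using zero_car nrm_eq_0_iff[OF zero_car] by auto
      then show ?thesis unfolding E'_def kothe_dual_def by simp
    qed
    ultimately show ?thesis unfolding U_def by blast
  qed
  then show "nrm v \<le> D" unfolding nrm[OF vc] using main by (intro cSUP_least) auto
qed

end

section \<open>Fixed points of random permutations\<close>

definition fixed_points :: "'a set \<Rightarrow> ('a \<Rightarrow> 'a) \<Rightarrow> 'a set" where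
  "fixed_points U \<pi> = {i \<in> U. \<pi> i = i}"

lemma card_permutes_fixing:
  assumes "finite U" "S \<subseteq> U"
  shows "card {\<pi>. \<pi> permutes U \<and> S \<subseteq> fixed_points U \<pi>} = fact (card U - card S)"
proof -
  have "{\<pi>. \<pi> permutes U \<and> S \<subseteq> fixed_points U \<pi>} = {\<pi>. \<pi> permutes (U - S)}"
  proof (intro set_eqI iffI; clarify)
    fix \<pi> assume p: "\<pi> permutes U" and "S \<subseteq> fixed_points U \<pi>"
    then show "\<pi> permutes (U - S)"
      by (intro permutes_superset[OF p]) (auto simp: fixed_points_def)
  next
    fix \<pi> assume p: "\<pi> permutes (U - S)"
    have "\<pi> permutes U" by (rule permutes_subset[OF p]) auto
    moreover have "S \<subseteq> fixed_points U \<pi>"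
      using assms(2) permutes_not_in[OF p] unfolding fixed_points_def by blast
    ultimately show "\<pi> permutes U \<and> S \<subseteq> fixed_points U \<pi>" by blast
  qed
  then show ?thesis
    using assms by (simp add: card_permutations card_Diff_subset finite_subset)
qed

lemma card_filter_eq_sum:
  assumes "finite A"
  shows "card {x \<in> A. P x} = (\<Sum>x\<in>A. if P x then 1 else 0)"
  unfolding card_eq_sum by (rule sum.inter_filter[OF assms])

text \<open>
  Count pairs of a permutation and a \<open>k\<close>-element set of its fixed points in the other order.
\<close>

lemma sum_choose_fixed_points:
  assumes "finite U"
  shows "(\<Sum>\<pi> | \<pi> permutes U. card (fixed_points U \<pi>) choose k) = (card U choose k) * fact (card U - k)"
proof -
  let ?P = "{\<pi>. \<pi> permutes U}" and ?K = "{S. S \<subseteq> U \<and> card S = k}"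
  have fin: "finite ?P" "finite ?K" using assms by (auto simp: finite_permutations)
  have "(\<Sum>\<pi>\<in>?P. card (fixed_points U \<pi>) choose k) = (\<Sum>\<pi>\<in>?P. card {S \<in> ?K. S \<subseteq> fixed_points U \<pi>})"
  proof (rule sum.cong[OF refl])
    fix \<pi> assume "\<pi> \<in> ?P"
    have "finite (fixed_points U \<pi>)" using assms by (simp add: fixed_points_def)
    then have "card (fixed_points U \<pi>) choose k = card {S. S \<subseteq> fixed_points U \<pi> \<and> card S = k}"
      by (simp add: n_subsets)
    also have "{S. S \<subseteq> fixed_points U \<pi> \<and> card S = k} = {S \<in> ?K. S \<subseteq> fixed_points U \<pi>}"
      by (auto simp: fixed_points_def)
    finally show "card (fixed_points U \<pi>) choose k = card {S \<in> ?K. S \<subseteq> fixed_points U \<pi>}" .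
  qed
  also have "\<dots> = (\<Sum>\<pi>\<in>?P. \<Sum>S\<in>?K. if S \<subseteq> fixed_points U \<pi> then 1 else 0)"
    by (intro sum.cong refl card_filter_eq_sum fin)
  also have "\<dots> = (\<Sum>S\<in>?K. \<Sum>\<pi>\<in>?P. if S \<subseteq> fixed_points U \<pi> then 1 else 0)" by (rule sum.swap)
  also have "\<dots> = (\<Sum>S\<in>?K. card {\<pi>. \<pi> permutes U \<and> S \<subseteq> fixed_points U \<pi>})"
    unfolding card_filter_eq_sum[OF fin(1), symmetric] by simp
  also have "\<dots> = (\<Sum>S\<in>?K. fact (card U - k))"
    by (intro sum.cong refl) (use assms in \<open>auto simp: card_permutes_fixing\<close>)
  also have "\<dots> = (card U choose k) * fact (card U - k)"
    using assms by (simp add: n_subsets)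
  finally show ?thesis .
qed

text \<open>
  For \<open>f = g + 1\<close> the left-hand side is \<open>- (g choose 3)\<close>; summed over all permutations this
  is inclusion and exclusion stopped after the third term.
\<close>

lemma bonferroni_pointwise:
  "1 - real f + real (f choose 2) - real (f choose 3) \<le> (if f = 0 then 1 else 0)"
proof (cases f)
  case (Suc g)
  have "Suc g choose 2 = g + (g choose 2)" "Suc g choose 3 = (g choose 2) + (g choose 3)"
    by (simp_all add: numeral_2_eq_2 numeral_3_eq_3)
  then show ?thesis using Suc by simp
qed (simp add: numeral_2_eq_2 numeral_3_eq_3)

text \<open>
  Truncated inclusion and exclusion gives the proportion \<open>1 - 1 + 1/2 - 1/6 = 1/3\<close>.
\<close>

lemma card_derangements_ge:
  assumes "finite U" "2 \<le> card U"
  shows "fact (card U) \<le> 3 * real (card {\<pi>. \<pi> permutes U \<and> fixed_points U \<pi> = {}})"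
proof -
  let ?P = "{\<pi>. \<pi> permutes U}" and ?m = "card U"
  define c where "c \<pi> = card (fixed_points U \<pi>)" for \<pi>
  have fin: "finite ?P" using assms by (auto simp: finite_permutations)
  have S: "(\<Sum>\<pi>\<in>?P. real (c \<pi> choose k)) = fact ?m / fact k" if "k \<le> ?m" for k
  proof -
    have "(\<Sum>\<pi>\<in>?P. real (c \<pi> choose k)) = real ((?m choose k) * fact (?m - k))"
      unfolding c_def sum_choose_fixed_points[OF assms(1), symmetric] by simp
    also have "\<dots> = fact ?m / fact k" using that by (simp add: binomial_fact)
    finally show ?thesis .
  qed
  have S3: "(\<Sum>\<pi>\<in>?P. real (c \<pi> choose 3)) \<le> fact ?m / 6"
  proof (cases "3 \<le> ?m")
    case True
    then show ?thesis using S[of 3] by (simp add: eval_nat_numeral)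
  next
    case False
    have "c \<pi> choose 3 = 0" for \<pi>
    proof -
      have "c \<pi> \<le> ?m" unfolding c_def fixed_points_def using assms(1) by (intro card_mono) auto
      then show ?thesis using False by simp
    qed
    then have "(\<Sum>\<pi>\<in>?P. real (c \<pi> choose 3)) = 0" by (simp only: of_nat_0 sum.neutral_const)
    then show ?thesis by simp
  qed
  have "fact ?m / 3 \<le> fact ?m - fact ?m + fact ?m / 2 - fact ?m / (6::real)" by simp
  also have "\<dots> \<le> (\<Sum>\<pi>\<in>?P. 1) - (\<Sum>\<pi>\<in>?P. real (c \<pi>)) + (\<Sum>\<pi>\<in>?P. real (c \<pi> choose 2)) - (\<Sum>\<pi>\<in>?P. real (c \<pi> choose 3))"
    using S[of 0] S[of 1] S[of 2] S3 assms(2) by simp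
  also have "\<dots> = (\<Sum>\<pi>\<in>?P. 1 - real (c \<pi>) + real (c \<pi> choose 2) - real (c \<pi> choose 3))"
    by (simp add: sum.distrib sum_subtractf)
  also have "\<dots> \<le> (\<Sum>\<pi>\<in>?P. if c \<pi> = 0 then 1 else 0)"
    by (intro sum_mono bonferroni_pointwise)
  also have "\<dots> = real (card {\<pi> \<in> ?P. c \<pi> = 0})"
    unfolding card_filter_eq_sum[OF fin] of_nat_sum by (intro sum.cong refl) simp
  also have "{\<pi> \<in> ?P. c \<pi> = 0} = {\<pi>. \<pi> permutes U \<and> fixed_points U \<pi> = {}}"
    using assms(1) by (auto simp: c_def fixed_points_def)
  finally show ?thesis by simp
qed

text \<open>
  A permutation with fixed point set \<open>S\<close> is a derangement of the complement of \<open>S\<close>; there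
  are none if the complement has exactly one element, which explains the last hypothesis.
\<close>

lemma card_exact_fixed_points_ge:
  assumes "finite U" "S \<subseteq> U" "card S + 2 \<le> card U"
  shows "fact (card U - card S) \<le> 3 * real (card {\<pi>. \<pi> permutes U \<and> fixed_points U \<pi> = S})"
proof -
  have c: "card (U - S) = card U - card S" using assms by (simp add: card_Diff_subset finite_subset)
  have "fact (card (U - S)) \<le> 3 * real (card {\<pi>. \<pi> permutes (U - S) \<and> fixed_points (U - S) \<pi> = {}})"
    using assms c by (intro card_derangements_ge) auto
  also have "{\<pi>. \<pi> permutes (U - S) \<and> fixed_points (U - S) \<pi> = {}} \<subseteq> {\<pi>. \<pi> permutes U \<and> fixed_points U \<pi> = S}"
  proof clarify
    fix \<pi> assume p: "\<pi> permutes (U - S)" and f: "fixed_points (U - S) \<pi> = {}"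
    have "\<pi> permutes U" by (rule permutes_subset[OF p]) auto
    moreover have "fixed_points U \<pi> = S"
      using f assms(2) permutes_not_in[OF p] unfolding fixed_points_def by blast
    ultimately show "\<pi> permutes U \<and> fixed_points U \<pi> = S" by blast
  qed
  then have "card {\<pi>. \<pi> permutes (U - S) \<and> fixed_points (U - S) \<pi> = {}} \<le> card {\<pi>. \<pi> permutes U \<and> fixed_points U \<pi> = S}"
    using assms(1) by (intro card_mono finite_subset[OF _ finite_permutations[OF assms(1)]]) auto
  finally show ?thesis unfolding c by simp
qed

lemma card_exact_fixed_points_le:
  assumes "finite U" "S \<subseteq> U"
  shows "card {\<pi>. \<pi> permutes U \<and> fixed_points U \<pi> = S} \<le> fact (card U - card S)"
proof -
  have "card {\<pi>. \<pi> permutes U \<and> fixed_points U \<pi> = S} \<le> card {\<pi>. \<pi> permutes U \<and> S \<subseteq> fixed_points U \<pi>}"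
    using assms(1) by (intro card_mono finite_subset[OF _ finite_permutations[OF assms(1)]]) auto
  then show ?thesis using card_permutes_fixing[OF assms] by simp
qed

lemma card_permutes_by_fixed_points:
  assumes "finite U"
  shows "card {\<pi>. \<pi> permutes U \<and> Q (fixed_points U \<pi>)} 
    = (\<Sum>S | S \<subseteq> U \<and> Q S. card {\<pi>. \<pi> permutes U \<and> fixed_points U \<pi> = S})"
proof -
  have "{\<pi>. \<pi> permutes U \<and> Q (fixed_points U \<pi>)} 
     = (\<Union>S\<in>{S. S \<subseteq> U \<and> Q S}. {\<pi>. \<pi> permutes U \<and> fixed_points U \<pi> = S})"
    by (auto simp: fixed_points_def)
  also have "card \<dots> = (\<Sum>S | S \<subseteq> U \<and> Q S. card {\<pi>. \<pi> permutes U \<and> fixed_points U \<pi> = S})"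
    using assms by (intro card_UN_disjoint) (auto intro: finite_subset[OF _ finite_permutations[OF assms]])
  finally show ?thesis .
qed

text \<open>
  With \<open>a = 1 / card U\<close> this is, up to the factor \<open>e\<close>, the probability that the Kruglov sum visits
  each cell at most once and exceeds \<open>\<tau>\<close>.
\<close>

definition subset_weight :: "'a set \<Rightarrow> ('a \<Rightarrow> real) \<Rightarrow> real \<Rightarrow> real \<Rightarrow> real" where
  "subset_weight U v a \<tau> = (\<Sum>S | S \<subseteq> U \<and> \<tau> < sum v S. a ^ card S)"

lemma subset_weight_eq_sum_Pow:
  assumes "finite U"
  shows "subset_weight U v a \<tau> = (\<Sum>S\<in>Pow U. if \<tau> < sum v S then a ^ card S else 0)"
proof -
  have "{S. S \<subseteq> U \<and> \<tau> < sum v S} = {S \<in> Pow U. \<tau> < sum v S}" by blast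
  then show ?thesis unfolding subset_weight_def using assms by (simp only: sum.inter_filter finite_Pow_iff)
qed

lemma sum_power_subsets:
  fixes a b :: real assumes "finite S"
  shows "(\<Sum>T\<in>Pow S. a ^ card T * b ^ card (S - T)) = (a + b) ^ card S"
  using prod_add[OF assms, of "\<lambda>_. a" "\<lambda>_. b"] by simp

text \<open>
  Expand \<open>(a + b)\<close> to the power \<open>card S\<close> as a sum over the splittings of \<open>S\<close> into \<open>T\<close> and
  \<open>R = S - T\<close>: either \<open>T\<close> carries more than \<open>s\<close> or \<open>R\<close> carries more than \<open>t\<close>, and the other part may
  be summed freely.
\<close>

lemma subset_weight_add_le:
  assumes U: "finite U" and ab: "0 \<le> a" "0 \<le> b"
  shows "subset_weight U v (a + b) (s + t)
     \<le> subset_weight U v a s * (1 + b) ^ card U + (1 + a) ^ card U * subset_weight U v b t"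
proof -
  \<comment> \<open>\<open>p T R\<close> counts a splitting once for every part that carries enough.\<close>
  define p where "p T R = ((if s < sum v T then 1 else 0) + (if t < sum v R then 1 else 0)) * (a ^ card T * b ^ card R)"
    for T R
  have p0: "0 \<le> p T R" for T R unfolding p_def using ab by simp
  let ?G = "{S. S \<subseteq> U \<and> s + t < sum v S}"
  have fG: "finite ?G" using U by simp
  have fS: "finite S" if "S \<in> ?G" for S
    by (rule finite_subset[OF _ U]) (use that in blast)
  have "subset_weight U v (a + b) (s + t) = (\<Sum>S\<in>?G. \<Sum>T\<in>Pow S. a ^ card T * b ^ card (S - T))"
    unfolding subset_weight_def by (intro sum.cong refl sum_power_subsets[symmetric] fS)
  also have "\<dots> \<le> (\<Sum>S\<in>?G. \<Sum>T\<in>Pow S. p T (S - T))"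
  proof (intro sum_mono)
    fix S T assume S: "S \<in> ?G" and T: "T \<in> Pow S"
    have "sum v S = sum v (S - T) + sum v T" using T fS[OF S] by (intro sum.subset_diff) auto
    moreover have "s + t < sum v S" using S by blast
    ultimately have "s < sum v T \<or> t < sum v (S - T)" by linarith
    then have "1 \<le> (if s < sum v T then 1 else 0) + (if t < sum v (S - T) then 1 else (0::real))"
      by (elim disjE) simp_all
    moreover have "0 \<le> a ^ card T * b ^ card (S - T)" using ab by simp
    ultimately show "a ^ card T * b ^ card (S - T) \<le> p T (S - T)"
      unfolding p_def using mult_right_mono by fastforce
  qed
  also have "\<dots> = (\<Sum>(S, T)\<in>(SIGMA S:?G. Pow S). p T (S - T))"
  proof (rule sum.Sigma[OF fG], rule ballI)
    fix S assume "S \<in> ?G"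
    then show "finite (Pow S)" using fS by blast
  qed
  also have "\<dots> = (\<Sum>(T, R)\<in>(\<lambda>(S, T). (T, S - T)) ` (SIGMA S:?G. Pow S). p T R)"
  proof (subst sum.reindex)
    show "inj_on (\<lambda>(S, T). (T, S - T)) (SIGMA S:?G. Pow S)"
    proof (rule inj_onI, clarify)
      fix S T S' assume "T \<subseteq> S" "T \<subseteq> S'" "S - T = S' - T"
      then show "S = S' \<and> T = T" by blast
    qed
  qed (intro sum.cong refl, auto)
  also have "\<dots> \<le> (\<Sum>(T, R)\<in>Pow U \<times> Pow U. p T R)"
  proof (rule sum_mono2)
    show "finite (Pow U \<times> Pow U)" using U by simp
    show "(\<lambda>(S, T). (T, S - T)) ` (SIGMA S:?G. Pow S) \<subseteq> Pow U \<times> Pow U" by auto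
    show "0 \<le> (case x of (T, R) \<Rightarrow> p T R)" for x using p0 by (cases x) simp
  qed
  also have "\<dots> = (\<Sum>T\<in>Pow U. \<Sum>R\<in>Pow U. p T R)"
    by (rule sum.cartesian_product[symmetric])
  also have "\<dots> = (\<Sum>T\<in>Pow U. \<Sum>R\<in>Pow U. (if s < sum v T then a ^ card T else 0) * b ^ card R)
     + (\<Sum>T\<in>Pow U. \<Sum>R\<in>Pow U. a ^ card T * (if t < sum v R then b ^ card R else 0))"
    unfolding sum.distrib[symmetric] by (intro sum.cong refl) (simp add: p_def)
  also have "\<dots> = (\<Sum>T\<in>Pow U. if s < sum v T then a ^ card T else 0) * (\<Sum>R\<in>Pow U. b ^ card R)
     + (\<Sum>T\<in>Pow U. a ^ card T) * (\<Sum>R\<in>Pow U. if t < sum v R then b ^ card R else 0)"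
    by (simp only: sum_product)
  also have "(\<Sum>R\<in>Pow U. b ^ card R) = (1 + b) ^ card U"
    using sum_power_subsets[OF U, of b 1] by (simp add: add.commute)
  also have "(\<Sum>R\<in>Pow U. a ^ card R) = (1 + a) ^ card U"
    using sum_power_subsets[OF U, of a 1] by (simp add: add.commute)
  also have "(\<Sum>T\<in>Pow U. if s < sum v T then a ^ card T else 0) = subset_weight U v a s"
    by (rule subset_weight_eq_sum_Pow[OF U, symmetric])
  also have "(\<Sum>T\<in>Pow U. if t < sum v T then b ^ card T else 0) = subset_weight U v b t"
    by (rule subset_weight_eq_sum_Pow[OF U, symmetric])
  finally show ?thesis .
qed

lemma subset_weight_nonneg: "0 \<le> a \<Longrightarrow> 0 \<le> subset_weight U v a \<tau>"
  unfolding subset_weight_def by (intro sum_nonneg) auto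

lemma one_add_power_le_exp:
  assumes "0 < n" "0 \<le> c" shows "(1 + c / real n) ^ n \<le> exp c"
proof -
  have "(1 + c / real n) ^ n \<le> exp (c / real n) ^ n"
    using assms by (intro power_mono exp_ge_add_one_self) auto
  also have "\<dots> = exp c" using assms by (simp flip: exp_of_nat_mult)
  finally show ?thesis .
qed

text \<open>
  Splitting twice removes the factor \<open>3\<close> at the price of a third of the level.
\<close>

lemma subset_weight_triple_le:
  assumes n: "0 < card U" 
  shows "subset_weight U v (3 / card U) (3 * s) \<le> 3 * exp 2 * subset_weight U v (1 / card U) s"
proof -
  have U: "finite U" using n card_ge_0_finite by blast
  let ?w = "subset_weight U v (1 / card U) s" and ?n = "card U"
  have w0: "0 \<le> ?w" by (rule subset_weight_nonneg) simp
  have "subset_weight U v (2 / ?n) (2 * s) \<le> ?w * (1 + 1 / ?n) ^ ?n + (1 + 1 / ?n) ^ ?n * ?w"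
    using subset_weight_add_le[OF U, of "1 / ?n" "1 / ?n" v s s] by simp
  also have "\<dots> \<le> ?w * exp 1 + exp 1 * ?w"
    by (intro add_mono mult_left_mono mult_right_mono one_add_power_le_exp n w0) auto
  finally have two: "subset_weight U v (2 / ?n) (2 * s) \<le> 2 * exp 1 * ?w" by simp
  have "2 / real ?n + 1 / real ?n = 3 / real ?n" by (simp flip: add_divide_distrib)
  then have "subset_weight U v (3 / ?n) (3 * s)
     \<le> subset_weight U v (2 / ?n) (2 * s) * (1 + 1 / ?n) ^ ?n + (1 + 2 / ?n) ^ ?n * ?w"
    using subset_weight_add_le[OF U, of "2 / ?n" "1 / ?n" v "2 * s" s] by simp
  also have "\<dots> \<le> (2 * exp 1 * ?w) * exp 1 + exp 2 * ?w"
    using w0 by (intro add_mono mult_mono mult_right_mono one_add_power_le_exp n w0 two) auto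
  also have "\<dots> = 3 * exp 2 * ?w"
  proof -
    have "exp (2::real) = exp 1 * exp 1" by (simp flip: exp_add)
    then show ?thesis by (simp add: algebra_simps)
  qed
  finally show ?thesis .
qed

lemma power_le_exp_fact: "real k ^ k \<le> exp (real k) * fact k"
proof -
  have "(\<Sum>i\<in>{k}. real k ^ i /\<^sub>R fact i) \<le> (\<Sum>i. real k ^ i /\<^sub>R fact i)"
    by (intro sum_le_suminf summable_exp_generic) auto
  then have "real k ^ k / fact k \<le> exp (real k)" by (simp add: exp_def divide_inverse mult.commute)
  then show ?thesis by (simp add: field_simps)
qed

text \<open>
  Combine \<open>n choose k \<ge> (n / k)\<^sup>k\<close> with \<open>k! \<ge> (k / e)\<^sup>k \<ge> (k / 3)\<^sup>k\<close>.
\<close>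

lemma fact_quotient_le:
  assumes "k \<le> n" "0 < n"
  shows "fact (n - k) / fact n \<le> (3 / real n) ^ k"
proof (cases "k = 0")
  case False
  have "(real n / 3) ^ k = (real n / k) ^ k * (real k ^ k / 3 ^ k)"
    using False by (simp add: power_divide)
  also have "\<dots> \<le> real (n choose k) * fact k"
  proof (rule mult_mono)
    show "(real n / k) ^ k \<le> real (n choose k)" by (rule binomial_ge_n_over_k_pow_k[OF assms(1)])
    have "real k ^ k \<le> exp (real k) * fact k" by (rule power_le_exp_fact)
    also have "exp (real k) = exp 1 ^ k" by (simp flip: exp_of_nat_mult)
    also have "exp 1 ^ k * fact k \<le> 3 ^ k * (fact k :: real)"
      by (intro mult_right_mono power_mono exp_le) auto
    finally show "real k ^ k / 3 ^ k \<le> fact k" by (simp add: field_simps)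
  qed auto
  also have "\<dots> = fact n / fact (n - k)" using assms by (simp add: binomial_fact)
  finally have *: "(real n / 3) ^ k \<le> fact n / fact (n - k)" .
  have "fact (n - k) / fact n = 1 / (fact n / fact (n - k) :: real)" by simp
  also have "\<dots> \<le> 1 / (real n / 3) ^ k"
    using assms by (intro divide_left_mono * mult_pos_pos) auto
  also have "\<dots> = (3 / real n) ^ k" by (simp add: power_divide)
  finally show ?thesis .
qed simp

lemma prob_fixed_point_sum_le:
  assumes n: "0 < card U"
  shows "real (card {\<pi>. \<pi> permutes U \<and> \<tau> < sum v (fixed_points U \<pi>)}) / fact (card U)
     \<le> 3 * exp 2 * subset_weight U v (1 / card U) (\<tau> / 3)"
proof -
  have U: "finite U" using n card_ge_0_finite by blast
  have "real (card {\<pi>. \<pi> permutes U \<and> \<tau> < sum v (fixed_points U \<pi>)}) / fact (card U)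
     = (\<Sum>S | S \<subseteq> U \<and> \<tau> < sum v S. real (card {\<pi>. \<pi> permutes U \<and> fixed_points U \<pi> = S}) / fact (card U))"
    unfolding card_permutes_by_fixed_points[OF U, of "\<lambda>S. \<tau> < sum v S"] by (simp add: sum_divide_distrib)
  also have "\<dots> \<le> (\<Sum>S | S \<subseteq> U \<and> \<tau> < sum v S. (3 / card U) ^ card S)"
  proof (rule sum_mono)
    fix S assume "S \<in> {S. S \<subseteq> U \<and> \<tau> < sum v S}"
    then have S: "S \<subseteq> U" by simp
    have "real (card {\<pi>. \<pi> permutes U \<and> fixed_points U \<pi> = S}) \<le> real (fact (card U - card S))"
      unfolding of_nat_le_iff by (rule card_exact_fixed_points_le[OF U S])
    then have "real (card {\<pi>. \<pi> permutes U \<and> fixed_points U \<pi> = S}) / fact (card U)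
       \<le> fact (card U - card S) / fact (card U)" by (intro divide_right_mono) auto
    also have "\<dots> \<le> (3 / card U) ^ card S"
      by (rule fact_quotient_le[OF card_mono[OF U S] n])
    finally show "real (card {\<pi>. \<pi> permutes U \<and> fixed_points U \<pi> = S}) / fact (card U) \<le> (3 / card U) ^ card S" .
  qed
  also have "\<dots> = subset_weight U v (3 / card U) (3 * (\<tau> / 3))" by (simp add: subset_weight_def)
  also have "\<dots> \<le> 3 * exp 2 * subset_weight U v (1 / card U) (\<tau> / 3)"
    by (rule subset_weight_triple_le[OF n])
  finally show ?thesis .
qed

text \<open>
  The lower bound \<open>(n - k)! / (3 n!)\<close> for the probability of a fixed point set with \<open>k\<close> elements
  is at least \<open>1 / (3 n\<^sup>k)\<close>.
\<close>

lemma prob_fixed_point_sum_ge: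
  assumes n: "J + 2 \<le> card U"
  shows "(\<Sum>S | S \<subseteq> U \<and> card S \<le> J \<and> \<tau> < sum v S. (1 / card U) ^ card S)
     \<le> 3 * (real (card {\<pi>. \<pi> permutes U \<and> \<tau> < sum v (fixed_points U \<pi>)}) / fact (card U))"
proof -
  have n0: "0 < card U" using n by simp
  then have U: "finite U" using card_ge_0_finite by blast
  have "(\<Sum>S | S \<subseteq> U \<and> card S \<le> J \<and> \<tau> < sum v S. (1 / card U) ^ card S)
    \<le> (\<Sum>S | S \<subseteq> U \<and> card S \<le> J \<and> \<tau> < sum v S. 3 * (real (card {\<pi>. \<pi> permutes U \<and> fixed_points U \<pi> = S}) / fact (card U)))"
  proof (rule sum_mono)
    fix S assume "S \<in> {S. S \<subseteq> U \<and> card S \<le> J \<and> \<tau> < sum v S}"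
    then have S: "S \<subseteq> U" "card S \<le> J" by auto
    then have le: "card S \<le> card U" using card_mono[OF U] by blast
    have pos: "0 < real (card U) ^ card S" using n0 by simp
    have "(fact (card U) :: nat) = fact (card U - card S) * (fact (card U) div fact (card U - card S))"
      by (rule dvd_mult_div_cancel[symmetric], rule fact_dvd) simp
    also have "\<dots> \<le> fact (card U - card S) * card U ^ card S"
      by (rule mult_left_mono[OF fact_div_fact_le_pow[OF le]]) simp
    finally have "real (fact (card U)) \<le> real (fact (card U - card S) * card U ^ card S)"
      by (rule of_nat_mono)
    then have "fact (card U) \<le> fact (card U - card S) * real (card U) ^ card S" by simp
    also have "\<dots> \<le> (3 * real (card {\<pi>. \<pi> permutes U \<and> fixed_points U \<pi> = S})) * real (card U) ^ card S"
      using card_exact_fixed_points_ge[OF U S(1)] S(2) n by (intro mult_right_mono) auto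
    finally show "(1 / card U) ^ card S \<le> 3 * (real (card {\<pi>. \<pi> permutes U \<and> fixed_points U \<pi> = S}) / fact (card U))"
      using pos by (simp add: power_one_over divide_simps mult.commute)
  qed
  also have "\<dots> \<le> (\<Sum>S | S \<subseteq> U \<and> \<tau> < sum v S. 3 * (real (card {\<pi>. \<pi> permutes U \<and> fixed_points U \<pi> = S}) / fact (card U)))"
    using U by (intro sum_mono2) auto
  also have "\<dots> = 3 * (real (card {\<pi>. \<pi> permutes U \<and> \<tau> < sum v (fixed_points U \<pi>)}) / fact (card U))"
    unfolding card_permutes_by_fixed_points[OF U, of "\<lambda>S. \<tau> < sum v S"] by (simp add: sum_divide_distrib sum_distrib_left)
  finally show ?thesis .
qed

section \<open>Tuples without repetition\<close>

definition tuples :: "nat \<Rightarrow> 'a set \<Rightarrow> 'a list set" where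
  "tuples m U = {xs. length xs = m \<and> set xs \<subseteq> U}"

lemma finite_tuples: "finite U \<Longrightarrow> finite (tuples m U)"
  unfolding tuples_def using finite_lists_length_eq[of U m] by (simp add: conj_commute)

text \<open>
  The sum of the values along a tuple without repetitions depends only on the set of its entries, and
  every \<open>m\<close>-element set has \<open>m!\<close> orderings.
\<close>

lemma card_distinct_tuples:
  assumes "finite U"
  shows "card {xs \<in> tuples m U. distinct xs \<and> \<tau> < sum_list (map v xs)}
    = fact m * card {S. S \<subseteq> U \<and> card S = m \<and> \<tau> < sum v S}"
proof -
  let ?G = "{S. S \<subseteq> U \<and> card S = m \<and> \<tau> < sum v S}"
  have fG: "finite ?G" using assms by simp
  have fS: "finite S" if "S \<in> ?G" for S by (rule finite_subset[OF _ assms]) (use that in blast)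
  have "{xs \<in> tuples m U. distinct xs \<and> \<tau> < sum_list (map v xs)} = (\<Union>S\<in>?G. permutations_of_set S)"
  proof (intro set_eqI iffI)
    fix xs assume xs: "xs \<in> {xs \<in> tuples m U. distinct xs \<and> \<tau> < sum_list (map v xs)}"
    then have d: "distinct xs" and "length xs = m" "set xs \<subseteq> U" "\<tau> < sum_list (map v xs)"
      by (auto simp: tuples_def)
    then have "set xs \<in> ?G"
      using distinct_card[OF d] sum_list_distinct_conv_sum_set[OF d, of v] by simp
    moreover have "xs \<in> permutations_of_set (set xs)" using xs by (simp add: permutations_of_set_def)
    ultimately show "xs \<in> (\<Union>S\<in>?G. permutations_of_set S)" by blast
  next
    fix xs assume "xs \<in> (\<Union>S\<in>?G. permutations_of_set S)"
    then obtain S where S: "S \<in> ?G" "set xs = S" "distinct xs" by (auto simp: permutations_of_set_def)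
    then show "xs \<in> {xs \<in> tuples m U. distinct xs \<and> \<tau> < sum_list (map v xs)}"
      by (auto simp: tuples_def distinct_card[symmetric] sum_list_distinct_conv_sum_set)
  qed
  also have "card \<dots> = (\<Sum>S\<in>?G. card (permutations_of_set S))"
  proof (rule card_UN_disjoint[OF fG])
    show "\<forall>S\<in>?G. finite (permutations_of_set S)" by simp
    show "\<forall>S\<in>?G. \<forall>S'\<in>?G. S \<noteq> S' \<longrightarrow> permutations_of_set S \<inter> permutations_of_set S' = {}"
      by (auto simp: permutations_of_set_def)
  qed
  also have "\<dots> = (\<Sum>S\<in>?G. fact m)"
  proof (rule sum.cong[OF refl])
    fix S assume S: "S \<in> ?G"
    then show "card (permutations_of_set S) = fact m"
      using card_permutations_of_set[OF fS[OF S]] by simp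
  qed
  also have "\<dots> = fact m * card ?G" by simp
  finally show ?thesis .
qed

lemma div_fiber:
  fixes M :: nat assumes "0 < M" shows "{q. q div M = j} = {j * M..<j * M + M}"
proof (intro set_eqI iffI)
  fix q assume "q \<in> {q. q div M = j}"
  then have "q div M * M = j * M" by simp
  then have "q = j * M + q mod M" "q mod M < M"
    using assms div_mult_mod_eq[of q M] by auto
  then have "j * M \<le> q" "q < j * M + M" by linarith+
  then show "q \<in> {j * M..<j * M + M}" by simp
next
  fix q assume "q \<in> {j * M..<j * M + M}"
  then have "q div M = j" by (intro div_nat_eqI) (auto simp: mult.commute add.commute)
  then show "q \<in> {q. q div M = j}" by simp
qed

lemma card_block_tuples:
  fixes M :: nat assumes "0 < M"
  shows "finite {xs. map (\<lambda>q. q div M) xs = js}"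
    and "card {xs. map (\<lambda>q. q div M) xs = js} = M ^ length js"
proof -
  note B = div_fiber[OF assms]
  have "finite {xs. map (\<lambda>q. q div M) xs = js} \<and> card {xs. map (\<lambda>q. q div M) xs = js} = M ^ length js"
  proof (induction js)
    case Nil
    have "{xs. map (\<lambda>q. q div M) xs = []} = {[]}" by auto
    then show ?case by simp
  next
    case (Cons j js)
    have eq: "{xs. map (\<lambda>q. q div M) xs = j # js} = (\<lambda>(q, xs). q # xs) ` ({q. q div M = j} \<times> {xs. map (\<lambda>q. q div M) xs = js})"
      by (auto simp: map_eq_Cons_conv image_iff)
    have "card ((\<lambda>(q, xs). q # xs) ` ({q. q div M = j} \<times> {xs. map (\<lambda>q. q div M) xs = js}))
      = card ({q. q div M = j} \<times> {xs. map (\<lambda>q. q div M) xs = js})"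
      by (rule card_image) (auto intro!: inj_onI)
    then show ?case unfolding eq using Cons by (simp add: card_cartesian_product B)
  qed
  then show "finite {xs. map (\<lambda>q. q div M) xs = js}"
    "card {xs. map (\<lambda>q. q div M) xs = js} = M ^ length js" by blast+
qed

text \<open>
  Choose the entries one after another; each block has \<open>M\<close> elements, of which fewer than \<open>m\<close> are
  already in use.
\<close>

lemma card_distinct_block_tuples_ge:
  fixes M :: nat assumes M: "0 < M" and "length js \<le> m"
  shows "(M - m) ^ length js \<le> card {xs. distinct xs \<and> map (\<lambda>q. q div M) xs = js}"
  using assms(2)
proof (induction js)
  case Nil
  have "{xs. distinct xs \<and> map (\<lambda>q. q div M) xs = []} = {[]}" by auto
  then show ?case by simp
next
  case (Cons j js)
  let ?D = "{xs. distinct xs \<and> map (\<lambda>q. q div M) xs = js}"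
  have fD: "finite ?D" by (rule finite_subset[OF _ card_block_tuples(1)[OF M, of js]]) blast
  define F where "F xs = {q. q div M = j} - set xs" for xs
  have B: "finite {q. q div M = j} \<and> card {q. q div M = j} = M"
    by (simp add: div_fiber[OF M])
  have F: "finite (F xs) \<and> M - m \<le> card (F xs)" if "xs \<in> ?D" for xs
  proof -
    have "length (map (\<lambda>q. q div M) xs) = length js" using that by simp
    then have "card (set xs) \<le> m" using card_length[of xs] Cons.prems by simp
    moreover have "M - card (set xs) \<le> card (F xs)"
      unfolding F_def using diff_card_le_card_Diff[of "set xs" "{q. q div M = j}"] B by simp
    ultimately show ?thesis using B by (simp add: F_def)
  qed
  have eq: "{xs. distinct xs \<and> map (\<lambda>q. q div M) xs = j # js} = (\<lambda>(xs, q). q # xs) ` (SIGMA xs:?D. F xs)"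
  proof (intro set_eqI iffI)
    fix ys assume "ys \<in> {xs. distinct xs \<and> map (\<lambda>q. q div M) xs = j # js}"
    then obtain q xs where "ys = q # xs" "q div M = j" "map (\<lambda>q. q div M) xs = js" "distinct xs" "q \<notin> set xs"
      by (cases ys) auto
    then show "ys \<in> (\<lambda>(xs, q). q # xs) ` (SIGMA xs:?D. F xs)" by (auto simp: F_def)
  qed (auto simp: F_def)
  have "card {xs. distinct xs \<and> map (\<lambda>q. q div M) xs = j # js} = card (SIGMA xs:?D. F xs)"
    unfolding eq by (rule card_image) (auto intro!: inj_onI)
  also have "\<dots> = (\<Sum>xs\<in>?D. card (F xs))" using F by (intro card_SigmaI fD) blast
  also have "\<dots> \<ge> (\<Sum>xs\<in>?D. M - m)" using F by (intro sum_mono) blast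
  finally have "card ?D * (M - m) \<le> card {xs. distinct xs \<and> map (\<lambda>q. q div M) xs = j # js}" by simp
  moreover have "(M - m) ^ length js * (M - m) \<le> card ?D * (M - m)"
    using Cons by (intro mult_right_mono) auto
  moreover have "(M - m) ^ length (j # js) = (M - m) ^ length js * (M - m)" by simp
  ultimately show ?case by linarith
qed

text \<open>
  Compare the tuples block by block: for every tuple of blocks there are \<open>M\<^sup>m\<close> tuples of
  elements and at least \<open>(M - m)\<^sup>m\<close> without repetition, and Bernoulli's inequality bounds the
  quotient by \<open>2\<close>. The bound does not depend on the property \<open>P\<close> of the tuple of blocks, which later
  makes it uniform in the level \<open>\<tau>\<close>.
\<close>

lemma card_tuples_le_twice_distinct:
  fixes n M m :: nat
  assumes M: "0 < M" "2 * m ^ 2 \<le> M"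
  shows "card {xs \<in> tuples m {..<n * M}. P (map (\<lambda>q. q div M) xs)}
     \<le> 2 * card {xs \<in> tuples m {..<n * M}. distinct xs \<and> P (map (\<lambda>q. q div M) xs)}"
proof -
  let ?J = "{js \<in> tuples m {..<n}. P js}"
  have fJ: "finite ?J" using finite_tuples[of "{..<n}" m] by simp
  have in_J: "map (\<lambda>q. q div M) xs \<in> tuples m {..<n} \<longleftrightarrow> xs \<in> tuples m {..<n * M}" for xs
    using div_less_iff_less_mult[OF M(1)] by (auto simp: tuples_def)
  have eq: "{xs \<in> tuples m {..<n * M}. Q xs \<and> P (map (\<lambda>q. q div M) xs)}
     = (\<Union>js\<in>?J. {xs. Q xs \<and> map (\<lambda>q. q div M) xs = js})" for Q
    using in_J by blast
  have card: "card {xs \<in> tuples m {..<n * M}. Q xs \<and> P (map (\<lambda>q. q div M) xs)}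
     = (\<Sum>js\<in>?J. card {xs. Q xs \<and> map (\<lambda>q. q div M) xs = js})" for Q
    unfolding eq
  proof (rule card_UN_disjoint[OF fJ])
    show "\<forall>js\<in>?J. finite {xs. Q xs \<and> map (\<lambda>q. q div M) xs = js}"
    proof
      fix js show "finite {xs. Q xs \<and> map (\<lambda>q. q div M) xs = js}"
        by (rule finite_subset[OF _ card_block_tuples(1)[OF M(1), of js]]) auto
    qed
  qed auto
  have pow: "M ^ m \<le> 2 * (M - m) ^ m"
  proof (cases "m = 0")
    case False
    have "m * 1 \<le> m * m" using False by (intro mult_left_mono) auto
    then have mM: "m \<le> M" using M(2) unfolding power2_eq_square by linarith
    have "1 / 2 \<le> 1 + real m * (- (real m / real M))"
    proof -
      have "real (2 * m ^ 2) \<le> real M" using M(2) by (simp only: of_nat_le_iff)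
      then have "2 * (real m * real m) \<le> real M" by (simp add: power2_eq_square)
      then have "real m * real m / real M \<le> 1 / 2" using M(1) by (simp add: pos_divide_le_eq)
      then show ?thesis by simp
    qed
    also have "\<dots> \<le> (1 + - (real m / real M)) ^ m"
      using mM M(1) by (intro Bernoulli_inequality) simp
    also have "1 + - (real m / real M) = real (M - m) / real M"
      using mM M(1) by (simp add: of_nat_diff diff_divide_distrib)
    finally have "1 / 2 \<le> real (M - m) ^ m / real M ^ m" unfolding power_divide .
    then have "1 / 2 * real M ^ m \<le> real (M - m) ^ m"
      using M(1) by (subst (asm) pos_le_divide_eq) simp_all
    then have "real M ^ m \<le> 2 * real (M - m) ^ m" by simp
    then have "real (M ^ m) \<le> real (2 * (M - m) ^ m)" by simp
    then show ?thesis by (simp only: of_nat_le_iff)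
  qed simp
  have "card {xs \<in> tuples m {..<n * M}. P (map (\<lambda>q. q div M) xs)} = (\<Sum>js\<in>?J. card {xs. map (\<lambda>q. q div M) xs = js})"
    using card[of "\<lambda>_. True"] by (simp only: simp_thms)
  also have "\<dots> \<le> (\<Sum>js\<in>?J. 2 * card {xs. distinct xs \<and> map (\<lambda>q. q div M) xs = js})"
  proof (rule sum_mono)
    fix js assume "js \<in> ?J"
    then have "length js = m" by (simp add: tuples_def)
    then show "card {xs. map (\<lambda>q. q div M) xs = js} \<le> 2 * card {xs. distinct xs \<and> map (\<lambda>q. q div M) xs = js}"
      using card_block_tuples(2)[OF M(1), of js] card_distinct_block_tuples_ge[OF M(1), of js m] pow
      by (metis (no_types, lifting) mult_le_mono2 order_refl order_trans)
  qed
  also have "\<dots> = 2 * card {xs \<in> tuples m {..<n * M}. distinct xs \<and> P (map (\<lambda>q. q div M) xs)}"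
    unfolding card[of distinct] sum_distrib_left ..
  finally show ?thesis .
qed

section \<open>The distribution of Kruglov sums\<close>

interpretation Omega_product: product_prob_space "\<lambda>_::nat. mes" UNIV
  by unfold_locales

interpretation Omega: prob_space Omega
  unfolding Omega_def by (rule Omega_product.P.prob_space_axioms)

lemma space_Omega: "space Omega = {\<omega>. \<forall>k. \<omega> k \<in> {0..1}}"
  by (auto simp: Omega_def space_PiM PiE_iff)

lemma measurable_Omega_component [measurable]: "(\<lambda>\<omega>. \<omega> k) \<in> measurable Omega mes"
  unfolding Omega_def by (rule measurable_component_singleton) simp

lemma borel_measurable_Omega_component:
  "f \<in> borel_measurable mes \<Longrightarrow> (\<lambda>\<omega>. f (\<omega> k)) \<in> borel_measurable Omega"
  using measurable_compose[OF measurable_Omega_component] .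

lemma measure_Omega_box:
  assumes "finite J" "\<And>i. i \<in> J \<Longrightarrow> X i \<in> sets mes"
  shows "measure Omega {\<omega> \<in> space Omega. \<forall>i\<in>J. \<omega> i \<in> X i} = (\<Prod>i\<in>J. measure mes (X i))"
proof -
  have "emeasure Omega {\<omega> \<in> space Omega. \<forall>i\<in>J. \<omega> i \<in> X i} = (\<Prod>i\<in>J. emeasure mes (X i))"
    unfolding Omega_def by (rule Omega_product.emeasure_PiM_Collect) (use assms in auto)
  also have "\<dots> = ennreal (\<Prod>i\<in>J. measure mes (X i))"
    by (simp add: mes.emeasure_eq_measure prod_ennreal)
  finally show ?thesis by (simp add: Omega.emeasure_eq_measure prod_nonneg)
qed

lemma AE_Omega_pos: "AE \<omega> in Omega. \<forall>k. 0 < \<omega> k \<and> \<omega> k \<le> 1"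
proof -
  have "AE t in mes. 0 < t \<and> t \<le> 1"
    using AE_mes_neq[of 0] AE_space[of mes] by eventually_elim auto
  then have "AE \<omega> in Omega. 0 < \<omega> k \<and> \<omega> k \<le> 1" for k :: nat
    unfolding Omega_def by (rule Omega_product.AE_component[rotated]) simp
  then show ?thesis by (subst AE_all_countable) blast
qed

text \<open>
  Since the sets \<open>B m\<close> with \<open>m \<ge> 1\<close> are disjoint, the coordinate \<open>\<omega> 0\<close> only selects the number
  \<open>blk (\<omega> 0)\<close> of summands, which has the Poisson distribution with parameter \<open>1\<close>, and
  \<open>ksum\<close> is the Kruglov operator in this form.
\<close>

locale kruglov =
  fixes B :: "nat \<Rightarrow> real set"
  assumes kruglov_sets: "kruglov_sets B"
begin

definition blk :: "real \<Rightarrow> nat" where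
  "blk t = (if \<exists>m\<ge>1. t \<in> B m then THE m. 1 \<le> m \<and> t \<in> B m else 0)"

definition ksum :: "(real \<Rightarrow> real) \<Rightarrow> (nat \<Rightarrow> real) \<Rightarrow> real" where
  "ksum f \<omega> = (\<Sum>k=1..blk (\<omega> 0). f (\<omega> k))"

lemma B_sets: "1 \<le> m \<Longrightarrow> B m \<in> sets mes"
  and measure_B: "1 \<le> m \<Longrightarrow> measure mes (B m) = 1 / (exp 1 * fact m)"
  using kruglov_sets unfolding kruglov_sets_def by auto

lemma blk_eq_iff: "1 \<le> m \<Longrightarrow> blk t = m \<longleftrightarrow> t \<in> B m"
proof -
  assume m: "1 \<le> m"
  have uniq: "a = b" if "1 \<le> a" "t \<in> B a" "1 \<le> b" "t \<in> B b" for a b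
    using kruglov_sets that unfolding kruglov_sets_def disjoint_family_on_def by blast
  have in_B: "blk t = a" if "1 \<le> a" "t \<in> B a" for a
  proof -
    have "(THE m. 1 \<le> m \<and> t \<in> B m) = a" using that uniq by (intro the_equality) blast+
    then show ?thesis unfolding blk_def using that by auto
  qed
  show ?thesis
  proof
    assume b: "blk t = m"
    then have "\<exists>m\<ge>1. t \<in> B m" using m unfolding blk_def by (auto split: if_splits)
    then show "t \<in> B m" using in_B b by auto
  qed (use in_B m in blast)
qed

lemma kruglov_op_eq_ksum: "kruglov_op B f = ksum f"
proof
  fix \<omega>
  have "kruglov_op B f \<omega> = (\<Sum>n\<in>{blk (\<omega> 0)}. \<Sum>k=1..n. f (\<omega> k) * indicat_real (B n) (\<omega> 0))"
    unfolding kruglov_op_def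
  proof (rule suminf_finite)
    fix n assume "n \<notin> {blk (\<omega> 0)}"
    then show "(\<Sum>k=1..n. f (\<omega> k) * indicat_real (B n) (\<omega> 0)) = 0"
      using blk_eq_iff[of n "\<omega> 0"] by (cases "n = 0") auto
  qed simp
  also have "\<dots> = ksum f \<omega>"
    using blk_eq_iff[of "blk (\<omega> 0)" "\<omega> 0"] by (cases "blk (\<omega> 0) = 0") (auto simp: ksum_def)
  finally show "kruglov_op B f \<omega> = ksum f \<omega>" .
qed

lemma measurable_blk [measurable]: "blk \<in> measurable mes (count_space UNIV)"
proof -
  have pos: "blk -` {m} \<inter> space mes \<in> sets mes" if "1 \<le> m" for m
  proof -
    have "B m \<subseteq> space mes" using B_sets[OF that] by (rule sets.sets_into_space)
    then have "blk -` {m} \<inter> space mes = B m" using blk_eq_iff[OF that] by auto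
    then show ?thesis using B_sets[OF that] by simp
  qed
  have "blk -` {m} \<inter> space mes \<in> sets mes" for m
  proof (cases "m = 0")
    case True
    have "blk -` {m} \<inter> space mes = space mes - (\<Union>j\<in>{1..}. blk -` {j} \<inter> space mes)"
      using True by auto
    also have "\<dots> \<in> sets mes" using pos by (intro sets.compl_sets sets.countable_UN') auto
    finally show ?thesis .
  qed (use pos in simp)
  then show ?thesis
    unfolding measurable_count_space_eq2_countable by blast
qed

lemma measurable_blk_Omega [measurable]: "(\<lambda>\<omega>. blk (\<omega> 0)) \<in> measurable Omega (count_space UNIV)"
  by (rule measurable_compose[OF measurable_Omega_component measurable_blk])

lemma borel_measurable_ksum [measurable]:
  assumes "f \<in> borel_measurable mes" shows "ksum f \<in> borel_measurable Omega"
  unfolding ksum_def[abs_def]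
  by (rule measurable_compose_countable[OF _ measurable_blk_Omega])
     (intro borel_measurable_sum borel_measurable_Omega_component assms)

lemma measure_blk_box:
  assumes "1 \<le> m" "\<And>k. k \<in> {1..m} \<Longrightarrow> A k \<in> sets mes"
  shows "measure Omega {\<omega> \<in> space Omega. blk (\<omega> 0) = m \<and> (\<forall>k\<in>{1..m}. \<omega> k \<in> A k)}
     = (\<Prod>k\<in>{1..m}. measure mes (A k)) / (exp 1 * fact m)"
proof -
  define X where "X k = (if k = 0 then B m else A k)" for k
  have "{\<omega> \<in> space Omega. blk (\<omega> 0) = m \<and> (\<forall>k\<in>{1..m}. \<omega> k \<in> A k)} = {\<omega> \<in> space Omega. \<forall>i\<in>{0..m}. \<omega> i \<in> X i}"
  proof -
    have ins: "{0..m} = insert 0 {1..m}" by auto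
    have "blk (\<omega> 0) = m \<and> (\<forall>k\<in>{1..m}. \<omega> k \<in> A k) \<longleftrightarrow> (\<forall>i\<in>{0..m}. \<omega> i \<in> X i)" for \<omega>
      unfolding ins using blk_eq_iff[OF assms(1), of "\<omega> 0"] by (auto simp: X_def)
    then show ?thesis by blast
  qed
  also have "measure Omega \<dots> = (\<Prod>i\<in>{0..m}. measure mes (X i))"
    by (rule measure_Omega_box) (use assms B_sets in \<open>auto simp: X_def\<close>)
  also have "{0..m} = insert 0 {1..m}" by auto
  also have "(\<Prod>i\<in>insert 0 {1..m}. measure mes (X i)) = measure mes (B m) * (\<Prod>k\<in>{1..m}. measure mes (A k))"
    by (subst prod.insert) (auto simp: X_def)
  finally show ?thesis using measure_B[OF assms(1)] by simp
qed

definition level :: "(real \<Rightarrow> real) \<Rightarrow> nat \<Rightarrow> real \<Rightarrow> (nat \<Rightarrow> real) set" where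
  "level f m \<tau> = {\<omega> \<in> space Omega. blk (\<omega> 0) = m \<and> \<tau> < ksum f \<omega>}"

lemma level_sets [measurable]: "f \<in> borel_measurable mes \<Longrightarrow> level f m \<tau> \<in> sets Omega"
  unfolding level_def by measurable

text \<open>
  Given that there are \<open>m\<close> summands, the cells visited by the coordinates \<open>1, \<dots>, m\<close> form a
  uniformly distributed tuple.
\<close>

lemma measure_level_step:
  assumes N: "0 < N" and m: "1 \<le> m"
  shows "measure Omega (level (step N v) m \<tau>)
    = card {xs \<in> tuples m {..<N}. \<tau> < sum_list (map v xs)} / (real N ^ m * (exp 1 * fact m))"
proof -
  let ?X = "{xs \<in> tuples m {..<N}. \<tau> < sum_list (map v xs)}"
  define box where "box xs = {\<omega> \<in> space Omega. blk (\<omega> 0) = m \<and> (\<forall>k\<in>{1..m}. \<omega> k \<in> cell N (xs ! (k - 1)))}" for xs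
  have fX: "finite ?X" using finite_tuples[of "{..<N}" m] by simp
  have nth_lt: "xs ! (k - 1) < N" if "xs \<in> tuples m {..<N}" "k \<in> {1..m}" for xs k
  proof -
    have "xs ! (k - 1) \<in> set xs" using that by (intro nth_mem) (auto simp: tuples_def)
    then show ?thesis using that(1) by (auto simp: tuples_def)
  qed
  have box_sets: "box xs \<in> sets Omega" if "xs \<in> tuples m {..<N}" for xs
  proof -
    have "{\<omega> \<in> space Omega. \<omega> k \<in> cell N (xs ! (k - 1))} \<in> sets Omega" if "k \<in> {1..m}" for k
      using measurable_sets[OF measurable_Omega_component cell_sets[OF N nth_lt[OF \<open>xs \<in> _\<close> that]], of k]
      by (simp add: vimage_def Int_def conj_commute)
    then have "{\<omega> \<in> space Omega. \<forall>k\<in>{1..m}. \<omega> k \<in> cell N (xs ! (k - 1))} \<in> sets Omega"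
      using m by (intro sets.sets_Collect_finite_All') auto
    moreover have "{\<omega> \<in> space Omega. blk (\<omega> 0) = m} \<in> sets Omega" by measurable
    ultimately have "{\<omega> \<in> space Omega. blk (\<omega> 0) = m} \<inter> {\<omega> \<in> space Omega. \<forall>k\<in>{1..m}. \<omega> k \<in> cell N (xs ! (k - 1))} \<in> sets Omega"
      by (intro sets.Int)
    also have "{\<omega> \<in> space Omega. blk (\<omega> 0) = m} \<inter> {\<omega> \<in> space Omega. \<forall>k\<in>{1..m}. \<omega> k \<in> cell N (xs ! (k - 1))} = box xs"
      unfolding box_def by blast
    finally show ?thesis .
  qed
  have box_measure: "measure Omega (box xs) = 1 / (real N ^ m * (exp 1 * fact m))" if "xs \<in> tuples m {..<N}" for xs
  proof -
    have "measure Omega (box xs) = (\<Prod>k\<in>{1..m}. measure mes (cell N (xs ! (k - 1)))) / (exp 1 * fact m)"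
      unfolding box_def by (rule measure_blk_box[OF m]) (rule cell_sets[OF N nth_lt[OF that]])
    also have "(\<Prod>k\<in>{1..m}. measure mes (cell N (xs ! (k - 1)))) = (\<Prod>k\<in>{1..m}. 1 / N)"
      by (intro prod.cong refl measure_cell[OF N nth_lt[OF that]])
    also have "\<dots> = 1 / real N ^ m" by (simp add: power_one_over)
    finally show ?thesis by simp
  qed
  have box_sum: "ksum (step N v) \<omega> = sum_list (map v xs)" if "xs \<in> tuples m {..<N}" "\<omega> \<in> box xs" for xs \<omega>
  proof -
    have "ksum (step N v) \<omega> = (\<Sum>k=1..m. v (xs ! (k - 1)))"
      unfolding ksum_def using that(2) nth_lt[OF that(1)] N
      by (intro sum.cong) (auto simp: box_def step_eq)
    also have "\<dots> = (\<Sum>k<m. v (xs ! k))"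
      by (rule sum.reindex_bij_witness[of _ Suc "\<lambda>k. k - 1"]) auto
    also have "\<dots> = sum_list (map v xs)"
      using that(1) by (simp add: sum_list_sum_nth tuples_def lessThan_atLeast0)
    finally show ?thesis .
  qed
  have "measure Omega (level (step N v) m \<tau>) = measure Omega (\<Union>xs\<in>?X. box xs)"
  proof (rule measure_eq_AE)
    show "level (step N v) m \<tau> \<in> sets Omega" by (intro level_sets borel_measurable_step)
    show "(\<Union>xs\<in>?X. box xs) \<in> sets Omega" using fX box_sets by auto
    show "AE \<omega> in Omega. \<omega> \<in> level (step N v) m \<tau> \<longleftrightarrow> \<omega> \<in> (\<Union>xs\<in>?X. box xs)"
      using AE_Omega_pos AE_space[of Omega]
    proof eventually_elim
      fix \<omega> assume pos: "\<forall>k. 0 < \<omega> k \<and> \<omega> k \<le> 1" and sp: "\<omega> \<in> space Omega"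
      show "\<omega> \<in> level (step N v) m \<tau> \<longleftrightarrow> \<omega> \<in> (\<Union>xs\<in>?X. box xs)"
      proof
        assume L: "\<omega> \<in> level (step N v) m \<tau>"
        have "\<forall>k. \<exists>i. i < N \<and> \<omega> k \<in> cell N i" using ex_cell[OF N] pos by blast
        then obtain idx where idx: "\<And>k. idx k < N \<and> \<omega> k \<in> cell N (idx k)" by metis
        define xs where "xs = map (\<lambda>k. idx (Suc k)) [0..<m]"
        have xs: "xs \<in> tuples m {..<N}" unfolding xs_def tuples_def using idx by auto
        have b: "\<omega> \<in> box xs"
          unfolding box_def using L sp idx by (auto simp: level_def xs_def)
        have "xs \<in> ?X" using L box_sum[OF xs b] xs by (simp add: level_def)
        then show "\<omega> \<in> (\<Union>xs\<in>?X. box xs)" using b by blast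
      next
        assume "\<omega> \<in> (\<Union>xs\<in>?X. box xs)"
        then obtain xs where "xs \<in> ?X" "\<omega> \<in> box xs" by blast
        then show "\<omega> \<in> level (step N v) m \<tau>"
          using box_sum[of xs \<omega>] by (auto simp: level_def box_def)
      qed
    qed
  qed
  also have "\<dots> = (\<Sum>xs\<in>?X. measure Omega (box xs))"
  proof (rule Omega.finite_measure_finite_Union[OF fX])
    show "box ` ?X \<subseteq> sets Omega" using box_sets by auto
    show "disjoint_family_on box ?X"
      unfolding disjoint_family_on_def
    proof (intro ballI impI)
      fix xs ys assume xs: "xs \<in> ?X" and ys: "ys \<in> ?X" and "xs \<noteq> ys"
      have False if "\<omega> \<in> box xs" "\<omega> \<in> box ys" for \<omega>
      proof -
        have "xs = ys"
        proof (rule nth_equalityI)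
          show "length xs = length ys" using xs ys by (simp add: tuples_def)
          fix i assume "i < length xs"
          then have "Suc i \<in> {1..m}" using xs by (auto simp: tuples_def)
          then have "\<omega> (Suc i) \<in> cell N (xs ! i)" "\<omega> (Suc i) \<in> cell N (ys ! i)"
            using that unfolding box_def by force+
          then show "xs ! i = ys ! i" by (rule cell_inj[OF N])
        qed
        then show False using \<open>xs \<noteq> ys\<close> by simp
      qed
      then show "box xs \<inter> box ys = {}" by blast
    qed
  qed
  also have "\<dots> = (\<Sum>xs\<in>?X. 1 / (real N ^ m * (exp 1 * fact m)))"
    by (intro sum.cong refl box_measure) simp
  finally show ?thesis by simp
qed

lemma level_disjoint: "disjoint_family_on (\<lambda>m. level f m \<tau>) I"
  by (auto simp: disjoint_family_on_def level_def)

lemma sum_level_le_tail: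
  assumes f: "f \<in> borel_measurable mes" and "finite I"
  shows "(\<Sum>m\<in>I. measure Omega (level f m \<tau>)) \<le> tail Omega (ksum f) \<tau>"
proof -
  have "(\<Sum>m\<in>I. measure Omega (level f m \<tau>)) = measure Omega (\<Union>m\<in>I. level f m \<tau>)"
    using assms by (intro Omega.finite_measure_finite_Union[symmetric] level_disjoint) auto
  also have "\<dots> \<le> tail Omega (ksum f) \<tau>"
    unfolding tail_eq_measure
  proof (rule Omega.finite_measure_mono)
    show "{w \<in> space Omega. \<tau> < \<bar>ksum f w\<bar>} \<in> sets Omega" using f by measurable
    show "(\<Union>m\<in>I. level f m \<tau>) \<subseteq> {w \<in> space Omega. \<tau> < \<bar>ksum f w\<bar>}"
      by (auto simp: level_def)
  qed
  finally show ?thesis .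
qed

text \<open>
  The Kruglov sum cut off at \<open>J\<close> summands: it takes finitely many values on a step function, so
  that its tail is compared with a random permutation of finitely many cells.
\<close>

definition ktrunc :: "nat \<Rightarrow> (real \<Rightarrow> real) \<Rightarrow> (nat \<Rightarrow> real) \<Rightarrow> real" where
  "ktrunc J f \<omega> = (if blk (\<omega> 0) \<le> J then ksum f \<omega> else 0)"

lemma borel_measurable_ktrunc [measurable]:
  assumes "f \<in> borel_measurable mes" shows "ktrunc J f \<in> borel_measurable Omega"
proof -
  note [measurable] = borel_measurable_ksum[OF assms]
  show ?thesis unfolding ktrunc_def[abs_def] by measurable
qed

lemma ksum_nonneg: "(\<And>t. 0 \<le> f t) \<Longrightarrow> 0 \<le> ksum f \<omega>"
  unfolding ksum_def by (intro sum_nonneg) simp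

lemma tail_ktrunc:
  assumes f: "f \<in> borel_measurable mes" "\<And>t. 0 \<le> f t" and "0 \<le> \<tau>"
  shows "tail Omega (ktrunc J f) \<tau> = (\<Sum>m\<in>{1..J}. measure Omega (level f m \<tau>))"
proof -
  have "{w \<in> space Omega. \<tau> < \<bar>ktrunc J f w\<bar>} = (\<Union>m\<in>{1..J}. level f m \<tau>)"
  proof (intro set_eqI iffI)
    fix w assume w: "w \<in> {w \<in> space Omega. \<tau> < \<bar>ktrunc J f w\<bar>}"
    then have *: "blk (w 0) \<le> J" "\<tau> < ksum f w" "w \<in> space Omega"
      using assms(3) ksum_nonneg[OF f(2), where \<omega>=w] by (auto simp: ktrunc_def split: if_splits)
    have "blk (w 0) \<noteq> 0" using *(2) assms(3) by (intro notI) (simp add: ksum_def)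
    then show "w \<in> (\<Union>m\<in>{1..J}. level f m \<tau>)" using * by (auto simp: level_def)
  next
    fix w assume "w \<in> (\<Union>m\<in>{1..J}. level f m \<tau>)"
    then show "w \<in> {w \<in> space Omega. \<tau> < \<bar>ktrunc J f w\<bar>}"
      by (auto simp: level_def ktrunc_def)
  qed
  then show ?thesis
    unfolding tail_eq_measure using f
    by (simp only:) (intro Omega.finite_measure_finite_Union level_disjoint; auto)
qed

end

text \<open>
  The operators of the theorem number the coordinates from \<open>1\<close>, cells are numbered from \<open>0\<close>.
\<close>

lemma bij_betw_shift_subsets:
  "bij_betw ((`) Suc) {S. S \<subseteq> {..<N} \<and> P (card S) (\<Sum>i\<in>S. w (Suc i))} {S. S \<subseteq> {1..N} \<and> P (card S) (sum w S)}"
proof (rule bij_betw_imageI)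
  show "inj_on ((`) Suc) {S. S \<subseteq> {..<N} \<and> P (card S) (\<Sum>i\<in>S. w (Suc i))}"
    by (rule inj_onI) (simp add: inj_image_eq_iff)
  have card: "card (Suc ` S) = card S" for S by (rule card_image) simp
  have sum: "sum w (Suc ` S) = (\<Sum>i\<in>S. w (Suc i))" for S by (subst sum.reindex) simp_all
  have "{1..N} = Suc ` {..<N}" by (simp add: image_Suc_lessThan)
  then show "(`) Suc ` {S. S \<subseteq> {..<N} \<and> P (card S) (\<Sum>i\<in>S. w (Suc i))} = {S. S \<subseteq> {1..N} \<and> P (card S) (sum w S)}"
    by (auto simp: subset_image_iff card sum image_iff)
qed

lemma subset_weight_shift:
  "subset_weight {1..N} w a \<tau> = subset_weight {..<N} (\<lambda>i. w (Suc i)) a \<tau>"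
proof -
  have "subset_weight {..<N} (\<lambda>i. w (Suc i)) a \<tau> = (\<Sum>S | S \<subseteq> {..<N} \<and> \<tau> < (\<Sum>i\<in>S. w (Suc i)). a ^ card (Suc ` S))"
    unfolding subset_weight_def by (simp add: card_image)
  also have "\<dots> = subset_weight {1..N} w a \<tau>"
    unfolding subset_weight_def
    by (rule sum.reindex_bij_betw[OF bij_betw_shift_subsets[of N "\<lambda>k s. \<tau> < s" w]])
  finally show ?thesis ..
qed

lemma sum_by_card:
  assumes "finite U"
  shows "(\<Sum>S | S \<subseteq> U \<and> card S \<in> I \<and> Q S. (a::real) ^ card S)
     = (\<Sum>m\<in>I \<inter> {..card U}. a ^ m * card {S. S \<subseteq> U \<and> card S = m \<and> Q S})"
proof -
  have "{S. S \<subseteq> U \<and> card S \<in> I \<and> Q S} = (\<Union>m\<in>I \<inter> {..card U}. {S. S \<subseteq> U \<and> card S = m \<and> Q S})"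
    using card_mono[OF assms] by auto
  then have "(\<Sum>S | S \<subseteq> U \<and> card S \<in> I \<and> Q S. a ^ card S)
     = (\<Sum>m\<in>I \<inter> {..card U}. \<Sum>S | S \<subseteq> U \<and> card S = m \<and> Q S. a ^ card S)"
    using assms by (simp only:) (intro sum.UNION_disjoint; auto)
  also have "\<dots> = (\<Sum>m\<in>I \<inter> {..card U}. a ^ m * card {S. S \<subseteq> U \<and> card S = m \<and> Q S})"
    by (intro sum.cong refl) simp
  finally show ?thesis .
qed

context kruglov
begin

text \<open>
  Keep only the tuples of cells without repetition: a set with \<open>m\<close> elements has \<open>m!\<close> orderings,
  which cancels the factor \<open>m!\<close> in the measure of \<open>B m\<close>.
\<close>

lemma subset_weight_le_tail_ksum:
  assumes n: "0 < n" and "0 \<le> \<tau>"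
  shows "subset_weight {..<n} v (1 / n) \<tau> \<le> exp 1 * tail Omega (ksum (step n v)) \<tau>"
proof -
  let ?c = "\<lambda>m. card {S. S \<subseteq> {..<n} \<and> card S = m \<and> \<tau> < sum v S}"
  have "{S. S \<subseteq> {..<n} \<and> \<tau> < sum v S} = {S. S \<subseteq> {..<n} \<and> card S \<in> {1..n} \<and> \<tau> < sum v S}"
  proof -
    have "card S \<in> {1..n}" if S: "S \<subseteq> {..<n}" "\<tau> < sum v S" for S
    proof -
      have "card S \<le> n" using card_mono[OF _ S(1)] by simp
      moreover have "S \<noteq> {}" "finite S" using S assms(2) finite_subset[OF S(1)] by auto
      ultimately show ?thesis by (simp add: Suc_le_eq card_gt_0_iff)
    qed
    then show ?thesis by blast
  qed
  then have "subset_weight {..<n} v (1 / n) \<tau> = (\<Sum>m\<in>{1..n} \<inter> {..card {..<n}}. (1 / n) ^ m * ?c m)"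
    unfolding subset_weight_def by (simp only: sum_by_card finite_lessThan)
  also have "{1..n} \<inter> {..card {..<n}} = {1..n}" by auto
  also have "(\<Sum>m\<in>{1..n}. (1 / n) ^ m * ?c m) \<le> (\<Sum>m\<in>{1..n}. exp 1 * measure Omega (level (step n v) m \<tau>))"
  proof (rule sum_mono)
    fix m assume "m \<in> {1..n}"
    then have m: "1 \<le> m" by simp
    have "fact m * ?c m = card {xs \<in> tuples m {..<n}. distinct xs \<and> \<tau> < sum_list (map v xs)}"
      by (rule card_distinct_tuples[symmetric]) simp
    also have "\<dots> \<le> card {xs \<in> tuples m {..<n}. \<tau> < sum_list (map v xs)}"
      using finite_tuples[of "{..<n}" m] by (intro card_mono) auto
    finally have "real (fact m * ?c m) \<le> real (card {xs \<in> tuples m {..<n}. \<tau> < sum_list (map v xs)})"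
      by (simp only: of_nat_le_iff)
    then have "fact m * real (?c m) / (real n ^ m * fact m) \<le> real (card {xs \<in> tuples m {..<n}. \<tau> < sum_list (map v xs)}) / (real n ^ m * fact m)"
      by (intro divide_right_mono) auto
    also have "\<dots> = exp 1 * measure Omega (level (step n v) m \<tau>)"
      unfolding measure_level_step[OF n m] by simp
    finally show "(1 / n) ^ m * ?c m \<le> exp 1 * measure Omega (level (step n v) m \<tau>)"
      by (simp add: power_one_over)
  qed
  also have "\<dots> = exp 1 * (\<Sum>m\<in>{1..n}. measure Omega (level (step n v) m \<tau>))"
    by (simp add: sum_distrib_left)
  also have "\<dots> \<le> exp 1 * tail Omega (ksum (step n v)) \<tau>"
    by (intro mult_left_mono sum_level_le_tail) auto
  finally show ?thesis .
qed

text \<open>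
  After the refinement at most half of the tuples of up to \<open>J\<close> cells have repetitions, and the other
  ones are counted by sets, as in the lower bound for fixed points of permutations.
\<close>

lemma tail_ktrunc_step_le:
  assumes n: "0 < n" and M: "0 < M" "2 * J ^ 2 \<le> M" "J + 2 \<le> n * M" and v: "\<And>i. 0 \<le> v i" and \<tau>: "0 \<le> \<tau>"
  shows "tail Omega (ktrunc J (step n v)) \<tau> \<le> 3 * (real (card {\<pi>. \<pi> permutes {1..n * M} \<and> 
      \<tau> < (\<Sum>i\<in>fixed_points {1..n * M} \<pi>. v ((i - 1) div M))}) / fact (n * M))"
proof -
  let ?N = "n * M" and ?u = "\<lambda>q. v (q div M)"
  let ?w = "\<lambda>i. v ((i - 1) div M)"
  let ?c = "\<lambda>m. card {S. S \<subseteq> {1..?N} \<and> card S = m \<and> \<tau> < sum ?w S}"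
  have N: "0 < ?N" using n M by simp
  have st: "step n v = step ?N ?u" by (rule step_refine[OF n M(1), symmetric])
  have s0: "0 \<le> step n v t" for t unfolding step_def using v by (intro sum_nonneg) auto
  have lev: "measure Omega (level (step n v) m \<tau>) \<le> (2 / exp 1) * ((1 / ?N) ^ m * ?c m)" if m: "m \<in> {1..J}" for m
  proof -
    have "2 * m ^ 2 \<le> 2 * J ^ 2" using m by (intro mult_left_mono power_mono) auto
    then have mM: "2 * m ^ 2 \<le> M" using M(2) by linarith
    have eq: "sum_list (map v (map (\<lambda>q. q div M) xs)) = sum_list (map ?u xs)" for xs
      by (simp add: comp_def)
    have "card {xs \<in> tuples m {..<?N}. \<tau> < sum_list (map ?u xs)}
      \<le> 2 * card {xs \<in> tuples m {..<?N}. distinct xs \<and> \<tau> < sum_list (map ?u xs)}"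
      using card_tuples_le_twice_distinct[OF M(1) mM, of n "\<lambda>js. \<tau> < sum_list (map v js)"]
      unfolding eq .
    also have "\<dots> = 2 * (fact m * card {S. S \<subseteq> {..<?N} \<and> card S = m \<and> \<tau> < sum ?u S})"
      by (subst card_distinct_tuples) simp_all
    also have "card {S. S \<subseteq> {..<?N} \<and> card S = m \<and> \<tau> < sum ?u S} = ?c m"
      using bij_betw_same_card[OF bij_betw_shift_subsets[of ?N "\<lambda>k s. k = m \<and> \<tau> < s" ?w]] by simp
    finally have "real (card {xs \<in> tuples m {..<?N}. \<tau> < sum_list (map ?u xs)}) \<le> real (2 * (fact m * ?c m))"
      by (simp only: of_nat_le_iff)
    then have "real (card {xs \<in> tuples m {..<?N}. \<tau> < sum_list (map ?u xs)}) / (real ?N ^ m * (exp 1 * fact m))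
       \<le> (2 * (fact m * real (?c m))) / (real ?N ^ m * (exp 1 * fact m))"
      by (intro divide_right_mono) auto
    also have "\<dots> = (2 / exp 1) * ((1 / ?N) ^ m * ?c m)" by (simp add: power_one_over)
    finally show ?thesis unfolding st using m by (subst measure_level_step[OF N]) auto
  qed
  have "tail Omega (ktrunc J (step n v)) \<tau> = (\<Sum>m\<in>{1..J}. measure Omega (level (step n v) m \<tau>))"
    by (rule tail_ktrunc[OF _ s0 \<tau>]) measurable
  also have "\<dots> \<le> (\<Sum>m\<in>{1..J}. (2 / exp 1) * ((1 / ?N) ^ m * ?c m))"
    by (rule sum_mono[OF lev])
  also have "\<dots> = (2 / exp 1) * (\<Sum>m\<in>{1..J}. (1 / ?N) ^ m * ?c m)" by (simp only: sum_distrib_left)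
  finally have le1: "tail Omega (ktrunc J (step n v)) \<tau> \<le> (2 / exp 1) * (\<Sum>m\<in>{1..J}. (1 / ?N) ^ m * ?c m)" .
  have "(\<Sum>m\<in>{1..J}. (1 / ?N) ^ m * ?c m) \<le> (\<Sum>m\<in>{..J} \<inter> {..card {1..?N}}. (1 / ?N) ^ m * ?c m)"
    using M(3) by (intro sum_mono2) auto
  also have "\<dots> = (\<Sum>S | S \<subseteq> {1..?N} \<and> card S \<in> {..J} \<and> \<tau> < sum ?w S. (1 / ?N) ^ card S)"
    by (rule sum_by_card[symmetric]) simp
  also have "\<dots> = (\<Sum>S | S \<subseteq> {1..?N} \<and> card S \<le> J \<and> \<tau> < sum ?w S. (1 / card {1..?N}) ^ card S)" by simp
  also have "\<dots> \<le> 3 * (real (card {\<pi>. \<pi> permutes {1..?N} \<and> \<tau> < sum ?w (fixed_points {1..?N} \<pi>)}) / fact (card {1..?N}))"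
    by (rule prob_fixed_point_sum_ge) (use M in simp)
  finally have le2: "(\<Sum>m\<in>{1..J}. (1 / ?N) ^ m * ?c m) \<le> 
     3 * (real (card {\<pi>. \<pi> permutes {1..?N} \<and> \<tau> < sum ?w (fixed_points {1..?N} \<pi>)}) / fact ?N)"
    by simp
  have le: "tail Omega (ktrunc J (step n v)) \<tau> \<le> (2 / exp 1) * 
    (3 * (real (card {\<pi>. \<pi> permutes {1..?N} \<and> \<tau> < sum ?w (fixed_points {1..?N} \<pi>)}) / fact ?N))" 
    by (rule order_trans[OF le1 mult_left_mono[OF le2]]) simp
  have "2 / exp 1 \<le> (1::real)" using exp_ge_add_one_self[of "1::real"] by simp
  then have "(2 / exp 1) * (3 * (real (card {\<pi>. \<pi> permutes {1..?N} \<and> \<tau> < sum ?w (fixed_points {1..?N} \<pi>)}) / fact ?N))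
    \<le> 1 * (3 * (real (card {\<pi>. \<pi> permutes {1..?N} \<and> \<tau> < sum ?w (fixed_points {1..?N} \<pi>)}) / fact ?N))"
    by (intro mult_right_mono) auto
  with le show ?thesis by linarith
qed

text \<open>
  The Kruglov sum is a fixed function of the independent variables \<open>blk (\<omega> 0)\<close> and
  \<open>f (\<omega> k)\<close>, \<open>k \<ge> 1\<close>. Their joint law is the product of the individual laws, and the law of \<open>f\<close>
  is determined by its tail.
\<close>

lemma tail_ksum_cong:
  assumes f: "f \<in> borel_measurable mes" "\<And>t. 0 \<le> f t" and h: "h \<in> borel_measurable mes" "\<And>t. 0 \<le> h t"
    and eq: "\<And>\<tau>. 0 \<le> \<tau> \<Longrightarrow> tail mes f \<tau> = tail mes h \<tau>"
  shows "tail Omega (ksum f) \<tau> = tail Omega (ksum h) \<tau>"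
proof -
  \<comment> \<open>\<open>F\<close> are the independent variables and \<open>G\<close> is the function that turns them into the Kruglov sum.\<close>
  define F where "F f i = (\<lambda>t. if i = (0::nat) then real (blk t) else \<bar>f t\<bar>)" for f :: "real \<Rightarrow> real" and i
  define G where "G z = (\<Sum>k=1..nat \<lfloor>z 0\<rfloor>. z k)" for z :: "nat \<Rightarrow> real"
  let ?P = "PiM UNIV (\<lambda>_::nat. borel :: real measure)"
  have Gm: "G \<in> borel_measurable ?P"
  proof -
    have "(\<lambda>z. z k) \<in> borel_measurable ?P" for k by (rule measurable_component_singleton) simp
    note [measurable] = this
    have "(\<lambda>z. nat \<lfloor>z 0\<rfloor>) \<in> measurable ?P (count_space UNIV)" by measurable
    then show ?thesis unfolding G_def[abs_def]
      by (rule measurable_compose_countable[rotated]) measurable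
  qed
  have Fm: "F f i \<in> borel_measurable mes" if "f \<in> borel_measurable mes" for f i
    unfolding F_def using that measurable_compose[OF measurable_blk, of real borel] by (cases "i = 0") auto
  have FO: "(\<lambda>\<omega> i. F f i (\<omega> i)) \<in> measurable Omega ?P" if "f \<in> borel_measurable mes" for f
    by (rule measurable_PiM_single') (auto intro: borel_measurable_Omega_component[OF Fm[OF that]] simp: space_Omega PiE_iff)
  have law: "distr Omega ?P (\<lambda>\<omega> i. F f i (\<omega> i)) = PiM UNIV (\<lambda>i. distr mes borel (F f i))"
    if f: "f \<in> borel_measurable mes" for f
  proof -
    interpret D: prob_space "distr mes borel (F f i)" for i
      by (rule mes.prob_space_distr[OF Fm[OF f]])
    interpret Q: product_prob_space "\<lambda>i. distr mes borel (F f i)" UNIV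
      by unfold_locales
    show ?thesis
    proof (rule Q.PiM_eq)
      show "sets (distr Omega ?P (\<lambda>\<omega> i. F f i (\<omega> i))) = sets (PiM UNIV (\<lambda>i. distr mes borel (F f i)))"
        by (simp cong: sets_PiM_cong)
    next
      fix J :: "nat set" and X assume J: "finite J" and "J \<subseteq> UNIV" 
        and "\<And>j. j \<in> J \<Longrightarrow> X j \<in> sets (distr mes borel (F f j))"
      then have X: "X j \<in> sets borel" if "j \<in> J" for j using that by simp
      have "emeasure (distr Omega ?P (\<lambda>\<omega> i. F f i (\<omega> i)))
          (prod_emb UNIV (\<lambda>i. distr mes borel (F f i)) J (Pi\<^sub>E J X))
        = emeasure Omega ((\<lambda>\<omega> i. F f i (\<omega> i)) -` (prod_emb UNIV (\<lambda>i. distr mes borel (F f i)) J (Pi\<^sub>E J X)) \<inter> space Omega)"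
      proof (rule emeasure_distr[OF FO[OF f]])
        have "prod_emb UNIV (\<lambda>i. distr mes borel (F f i)) J (Pi\<^sub>E J X) \<in> sets (PiM UNIV (\<lambda>i. distr mes borel (F f i)))"
          using J X by (intro sets_PiM_I) auto
        then show "prod_emb UNIV (\<lambda>i. distr mes borel (F f i)) J (Pi\<^sub>E J X) \<in> sets ?P"
          by (simp cong: sets_PiM_cong)
      qed
      also have "(\<lambda>\<omega> i. F f i (\<omega> i)) -` (prod_emb UNIV (\<lambda>i. distr mes borel (F f i)) J (Pi\<^sub>E J X)) \<inter> space Omega
         = {\<omega> \<in> space Omega. \<forall>j\<in>J. \<omega> j \<in> F f j -` X j \<inter> space mes}"
        by (auto simp: prod_emb_def PiE_iff restrict_def extensional_def space_Omega)
      also have "emeasure Omega \<dots> = (\<Prod>j\<in>J. emeasure mes (F f j -` X j \<inter> space mes))"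
        unfolding Omega_def
        by (rule Omega_product.emeasure_PiM_Collect) (use J measurable_sets[OF Fm[OF f] X] in auto)
      also have "\<dots> = (\<Prod>j\<in>J. emeasure (distr mes borel (F f j)) (X j))"
        by (intro prod.cong refl emeasure_distr[symmetric] Fm[OF f] X)
      finally show "emeasure (distr Omega ?P (\<lambda>\<omega> i. F f i (\<omega> i)))
          (prod_emb UNIV (\<lambda>i. distr mes borel (F f i)) J (Pi\<^sub>E J X))
         = (\<Prod>j\<in>J. emeasure (distr mes borel (F f j)) (X j))" .
    qed
  qed
  have dist_eq: "distr mes borel (F f i) = distr mes borel (F h i)" for i
  proof (cases "i = 0")
    case False
    have "distr mes borel (\<lambda>t. \<bar>f t\<bar>) = distr mes borel (\<lambda>t. \<bar>h t\<bar>)"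
      by (rule mes.distr_abs_eqI[OF f(1) prob_space_mes h(1) eq])
    then show ?thesis using False by (simp add: F_def)
  qed (simp add: F_def)
  have tail: "tail Omega (ksum f) \<tau> = measure (distr Omega ?P (\<lambda>\<omega> i. F f i (\<omega> i))) {z \<in> space ?P. \<tau> < \<bar>G z\<bar>}"
    if f: "f \<in> borel_measurable mes" "\<And>t. 0 \<le> f t" for f
  proof -
    have S: "{z \<in> space ?P. \<tau> < \<bar>G z\<bar>} \<in> sets ?P" using Gm by measurable
    have "G (\<lambda>i. F f i (\<omega> i)) = ksum f \<omega>" for \<omega>
      using f(2) by (simp add: G_def F_def ksum_def)
    then have "(\<lambda>\<omega> i. F f i (\<omega> i)) -` {z \<in> space ?P. \<tau> < \<bar>G z\<bar>} \<inter> space Omega = {\<omega> \<in> space Omega. \<tau> < \<bar>ksum f \<omega>\<bar>}"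
      by (auto simp: space_PiM)
    then show ?thesis unfolding measure_distr[OF FO[OF f(1)] S] by (simp add: tail_eq_measure)
  qed
  show ?thesis unfolding tail[OF f] tail[OF h] law[OF f(1)] law[OF h(1)] dist_eq ..
qed

end

section \<open>The operators on permutations\<close>

lemma opC_cell:
  assumes "0 < N" "i < N" "t \<in> {real i / real N<..<(real i + 1) / real N}"
  shows "opC N w t = w (Suc i)"
proof -
  have "opC N w t = (\<Sum>k=1..N. if k = Suc i then w (Suc i) else 0)"
    unfolding opC_def
  proof (rule sum.cong[OF refl])
    fix k assume "k \<in> {1..N}"
    then obtain j where k: "k = Suc j" by (cases k) auto
    have t: "t \<in> cell N i" using assms(3) by (auto simp: cell_def)
    show "w k * indicat_real {(real k - 1) / real N<..<real k / real N} t = (if k = Suc i then w (Suc i) else 0)"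
    proof (cases "k = Suc i")
      case True
      then have "t \<in> {(real k - 1) / real N<..<real k / real N}" using assms(3) by (simp add: add.commute)
      then show ?thesis using True by simp
    next
      case False
      have "t \<notin> {(real k - 1) / real N<..<real k / real N}"
      proof
        assume "t \<in> {(real k - 1) / real N<..<real k / real N}"
        then have "t \<in> cell N j" by (auto simp: cell_def k add.commute)
        from cell_inj[OF assms(1) t this] have "i = j" .
        then show False using False k by simp
      qed
      then show ?thesis using False by simp
    qed
  qed
  also have "\<dots> = w (Suc i)" using assms(2) by simp
  finally show ?thesis .
qed

lemma borel_measurable_opC: "opC N w \<in> borel_measurable mes"
  unfolding opC_def[abs_def] by (intro borel_measurable_mesI) measurable

lemma AE_opC_eq_step:
  assumes N: "0 < N" shows "AE t in mes. opC N w t = step N (\<lambda>i. w (Suc i)) t"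
proof -
  have "AE t in mes. \<forall>i. t \<noteq> (real i + 1) / real N"
    by (subst AE_all_countable) (intro allI AE_mes_neq)
  with AE_mes_neq[of 0] AE_space[of mes] show ?thesis
  proof eventually_elim
    fix t :: real assume "t \<noteq> 0" "t \<in> space mes" and ne: "\<forall>i. t \<noteq> (real i + 1) / real N"
    then obtain i where i: "i < N" "t \<in> cell N i" using ex_cell[OF N, of t] by auto
    have "t \<in> {real i / real N<..<(real i + 1) / real N}" using i(2) ne[rule_format, of i] by (auto simp: cell_def)
    then show "opC N w t = step N (\<lambda>i. w (Suc i)) t"
      using opC_cell[OF N i(1)] step_eq[OF N i] by simp
  qed
qed

lemma opA_eq_sum: "opA n v \<pi> = sum v (fixed_points {1..n} \<pi>)"
  by (simp add: opA_def fixed_points_def)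

text \<open>
  The cells on which \<open>opT\<close> is constant have equal length and are in bijection with the
  permutations, so its tail is a proportion of permutations.
\<close>

lemma tail_opT:
  assumes \<sigma>: "perm_numbering \<sigma>" and n: "1 \<le> n" and "0 \<le> \<tau>"
  shows "tail mes (opT \<sigma> n x) \<tau> = real (card {\<pi>. \<pi> permutes {1..n} \<and> \<tau> < \<bar>sum (opB n x) (fixed_points {1..n} \<pi>)\<bar>}) / fact n"
proof -
  let ?f = "\<lambda>\<pi>. sum (opB n x) (fixed_points {1..n} \<pi>)"
  have bij: "bij_betw (\<sigma> n) {1..fact n} {\<pi>. \<pi> permutes {1..n}}"
    using \<sigma> n unfolding perm_numbering_def by blast
  have F: "0 < (fact n :: nat)" by simp
  have "tail mes (opT \<sigma> n x) \<tau> = tail mes (step (fact n) (\<lambda>i. ?f (\<sigma> n (Suc i)))) \<tau>"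
    unfolding opT_def opA_eq_sum
    using AE_opC_eq_step[OF F, of "\<lambda>j. ?f (\<sigma> n j)"]
    by (intro mes.tail_cong_AE borel_measurable_opC borel_measurable_step) auto
  also have "\<dots> = card {i. i < fact n \<and> \<tau> < \<bar>?f (\<sigma> n (Suc i))\<bar>} / fact n"
    using tail_step[OF F assms(3)] by simp
  also have "card {i. i < fact n \<and> \<tau> < \<bar>?f (\<sigma> n (Suc i))\<bar>} = card {\<pi>. \<pi> permutes {1..n} \<and> \<tau> < \<bar>?f \<pi>\<bar>}"
  proof (rule bij_betw_same_card[of "\<lambda>i. \<sigma> n (Suc i)"], rule bij_betw_imageI)
    show "inj_on (\<lambda>i. \<sigma> n (Suc i)) {i. i < fact n \<and> \<tau> < \<bar>?f (\<sigma> n (Suc i))\<bar>}"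
    proof (rule inj_onI)
      fix i j assume "i \<in> {i. i < fact n \<and> \<tau> < \<bar>?f (\<sigma> n (Suc i))\<bar>}" 
        "j \<in> {i. i < fact n \<and> \<tau> < \<bar>?f (\<sigma> n (Suc i))\<bar>}" "\<sigma> n (Suc i) = \<sigma> n (Suc j)"
      then have "Suc i = Suc j"
        by (intro inj_onD[OF bij_betw_imp_inj_on[OF bij]]) auto
      then show "i = j" by simp
    qed
    show "(\<lambda>i. \<sigma> n (Suc i)) ` {i. i < fact n \<and> \<tau> < \<bar>?f (\<sigma> n (Suc i))\<bar>} = {\<pi>. \<pi> permutes {1..n} \<and> \<tau> < \<bar>?f \<pi>\<bar>}"
    proof (intro set_eqI iffI)
      fix \<pi> assume "\<pi> \<in> (\<lambda>i. \<sigma> n (Suc i)) ` {i. i < fact n \<and> \<tau> < \<bar>?f (\<sigma> n (Suc i))\<bar>}"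
      then obtain i where i: "\<pi> = \<sigma> n (Suc i)" "i < fact n" "\<tau> < \<bar>?f (\<sigma> n (Suc i))\<bar>" by blast
      then have "\<pi> \<in> {\<pi>. \<pi> permutes {1..n}}" using bij_betwE[OF bij] by (simp add: Suc_le_eq)
      then show "\<pi> \<in> {\<pi>. \<pi> permutes {1..n} \<and> \<tau> < \<bar>?f \<pi>\<bar>}" using i by simp
    next
      fix \<pi> assume p: "\<pi> \<in> {\<pi>. \<pi> permutes {1..n} \<and> \<tau> < \<bar>?f \<pi>\<bar>}"
      then have "\<pi> \<in> \<sigma> n ` {1..fact n}" using bij_betw_imp_surj_on[OF bij] by simp
      then obtain j where j: "j \<in> {1..fact n}" "\<pi> = \<sigma> n j" by blast
      then have "\<pi> = \<sigma> n (Suc (j - 1))" "j - 1 < fact n" by auto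
      then show "\<pi> \<in> (\<lambda>i. \<sigma> n (Suc i)) ` {i. i < fact n \<and> \<tau> < \<bar>?f (\<sigma> n (Suc i))\<bar>}" using p by blast
    qed
  qed
  finally show ?thesis .
qed

text \<open>
  Changes the closed interval of Lebesgue measure into a half-open cell of the measure on \<open>[0, 1]\<close>;
  they differ in one point.
\<close>

lemma opB_eq_integral_cell:
  assumes x: "x \<in> borel_measurable mes" and n: "0 < n" and i: "i < n"
  shows "opB n x (Suc i) = real n * (\<integral>t. x t * indicator (cell n i) t \<partial>mes)"
proof -
  let ?I = "{real i / real n..(real i + 1) / real n}"
  have sub: "?I \<subseteq> {0..1}"
    using i n by (auto simp: divide_simps intro: order_trans) 
  have m: "(\<lambda>t. indicator {0..1} t *\<^sub>R x t) \<in> borel_measurable lebesgue"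
    using x by (subst (asm) borel_measurable_restrict_space_iff) auto
  have "(\<integral>t. x t * indicator (cell n i) t \<partial>mes) = (\<integral>t. indicator {0..1} t *\<^sub>R (x t * indicator (cell n i) t) \<partial>lebesgue)"
    by (rule integral_restrict_space) simp
  also have "\<dots> = (\<integral>t. indicator ?I t *\<^sub>R x t \<partial>lebesgue)"
  proof (rule integral_cong_AE)
    have "(\<lambda>t. (indicator {0..1} t *\<^sub>R x t) * indicator (cell n i) t) \<in> borel_measurable lebesgue"
      using m by (intro borel_measurable_times borel_measurable_indicator) (auto simp: cell_def)
    then show "(\<lambda>t. indicator {0..1} t *\<^sub>R (x t * indicator (cell n i) t)) \<in> borel_measurable lebesgue"
      by (simp add: mult.assoc)
    have "(\<lambda>t. indicator ?I t * (indicator {0..1} t *\<^sub>R x t)) \<in> borel_measurable lebesgue"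
      using m by (intro borel_measurable_times borel_measurable_indicator) auto
    also have "(\<lambda>t. indicator ?I t * (indicator {0..1} t *\<^sub>R x t)) = (\<lambda>t. indicator ?I t *\<^sub>R x t)"
      by (rule ext) (use subsetD[OF sub] in \<open>simp add: indicator_def\<close>)
    finally show "(\<lambda>t. indicator ?I t *\<^sub>R x t) \<in> borel_measurable lebesgue" .
    have "AE t in lebesgue. t \<noteq> real i / real n"
      by (rule AE_completion) (rule AE_lborel_singleton)
    then show "AE t in lebesgue. indicator {0..1} t *\<^sub>R (x t * indicator (cell n i) t) = indicator ?I t *\<^sub>R x t"
    proof eventually_elim
      fix t :: real assume "t \<noteq> real i / real n"
      then have "t \<in> cell n i \<longleftrightarrow> t \<in> ?I" unfolding cell_def by auto
      then show "indicator {0..1} t *\<^sub>R (x t * indicator (cell n i) t) = indicator ?I t *\<^sub>R x t"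
        using subsetD[OF sub, of t] by (cases "t \<in> ?I") (simp_all add: indicator_def)
    qed
  qed
  finally show ?thesis
    by (simp add: opB_def set_lebesgue_integral_def add.commute)
qed

lemma opB_step:
  assumes n: "0 < n" and M: "0 < M" and i: "i \<in> {1..n * M}"
  shows "opB (n * M) (step n v) i = v ((i - 1) div M)"
proof -
  let ?N = "n * M"
  have N: "0 < ?N" using n M by simp
  obtain q where q: "i = Suc q" "q < ?N" using i by (cases i) auto
  have "opB ?N (step n v) i = real ?N * (\<integral>t. step n v t * indicator (cell ?N q) t \<partial>mes)"
    unfolding q(1) by (rule opB_eq_integral_cell[OF _ N q(2)]) measurable
  also have "(\<lambda>t. step n v t * indicator (cell ?N q) t) = (\<lambda>t. v (q div M) * indicator (cell ?N q) t)"
  proof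
    fix t
    show "step n v t * indicator (cell ?N q) t = v (q div M) * indicator (cell ?N q) t"
      using step_eq[OF N q(2), of t "\<lambda>k. v (k div M)"] unfolding step_refine[OF n M]
      by (cases "t \<in> cell ?N q") simp_all
  qed
  also have "(\<integral>t. v (q div M) * indicator (cell ?N q) t \<partial>mes) = v (q div M) * measure mes (cell ?N q)"
  proof -
    have "cell ?N q \<inter> {0..1} = cell ?N q" using cell_subset[OF N q(2)] by auto
    then show ?thesis using cell_sets[OF N q(2)] by simp
  qed
  finally show ?thesis using measure_cell[OF N q(2)] N q(1) by simp
qed

context ri
begin

lemma opB_linear:
  assumes x: "x \<in> car" and y: "y \<in> car" and i: "i \<in> {1..n}"
  shows "opB n (\<lambda>t. a * x t + b * y t) i = a * opB n x i + b * opB n y i"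
proof -
  obtain q where q: "i = Suc q" "q < n" using i by (cases i) auto
  have n: "0 < n" using q by simp
  have xy: "(\<lambda>t. a * x t + b * y t) \<in> car" by (intro add_car scale_car x y)
  have "(\<integral>t. (a * x t + b * y t) * indicator (cell n q) t \<partial>mes) 
    = (\<integral>t. a * (x t * indicator (cell n q) t) + b * (y t * indicator (cell n q) t) \<partial>mes)"
    by (intro Bochner_Integration.integral_cong refl) (simp add: algebra_simps)
  also have "\<dots> = a * (\<integral>t. x t * indicator (cell n q) t \<partial>mes) + b * (\<integral>t. y t * indicator (cell n q) t \<partial>mes)"
    using integrable_on_cell[OF x n q(2)] integrable_on_cell[OF y n q(2)]
    by (subst Bochner_Integration.integral_add) auto
  finally show ?thesis
    unfolding q(1) using opB_eq_integral_cell[OF car_measurable[OF xy] n q(2)]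
      opB_eq_integral_cell[OF car_measurable[OF x] n q(2)] opB_eq_integral_cell[OF car_measurable[OF y] n q(2)]
    by (simp add: algebra_simps)
qed

lemma abs_opB_le:
  assumes x: "x \<in> car" and i: "i \<in> {1..n}"
  shows "\<bar>opB n x i\<bar> \<le> opB n (\<lambda>t. \<bar>x t\<bar>) i"
proof -
  obtain q where q: "i = Suc q" "q < n" using i by (cases i) auto
  have n: "0 < n" using q by simp
  have "\<bar>\<integral>t. x t * indicator (cell n q) t \<partial>mes\<bar> \<le> (\<integral>t. \<bar>x t * indicator (cell n q) t\<bar> \<partial>mes)"
    by (rule integral_abs_bound)
  also have "(\<lambda>t. \<bar>x t * indicator (cell n q) t\<bar>) = (\<lambda>t. \<bar>x t\<bar> * indicator (cell n q) t)"
    by (auto simp: indicator_def)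
  finally show ?thesis
    unfolding q(1) using opB_eq_integral_cell[OF car_measurable[OF x] n q(2)]
      opB_eq_integral_cell[OF car_measurable[OF abs_car(1)[OF x]] n q(2)] 
    by (simp add: abs_mult mult_left_mono)
qed

lemma opT_linear:
  assumes x: "x \<in> car" and y: "y \<in> car"
  shows "opT \<sigma> n (\<lambda>t. a * x t + b * y t) s = a * opT \<sigma> n x s + b * opT \<sigma> n y s"
proof -
  have "opA n (opB n (\<lambda>t. a * x t + b * y t)) \<pi> = a * opA n (opB n x) \<pi> + b * opA n (opB n y) \<pi>" for \<pi>
    unfolding opA_def sum_distrib_left sum.distrib[symmetric]
    by (intro sum.cong refl opB_linear[OF x y]) auto
  then show ?thesis
    unfolding opT_def opC_def sum_distrib_left sum.distrib[symmetric]
    by (intro sum.cong refl) (simp add: algebra_simps)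
qed

text \<open>
  The rearrangement in the definition of the space over \<open>Omega\<close> differs from \<open>star\<close> in at most one
  point of the unit interval.
\<close>

lemma decr_rearr_car:
  assumes "prob_space M" "g \<in> borel_measurable M"
  shows "decr_rearr M g \<in> car \<longleftrightarrow> star M g \<in> car"
    and "star M g \<in> car \<Longrightarrow> nrm (decr_rearr M g) = nrm (star M g)"
proof -
  interpret M: prob_space M by fact
  have m: "decr_rearr M g \<in> borel_measurable mes" "star M g \<in> borel_measurable mes"
    using M.borel_measurable_decr_rearr[OF assms(2)] M.borel_measurable_star_mes[OF assms(2)] by auto
  have ae: "AE t in mes. \<bar>decr_rearr M g t\<bar> = \<bar>star M g t\<bar>" "AE t in mes. \<bar>star M g t\<bar> = \<bar>decr_rearr M g t\<bar>"
    using AE_star_eq_decr_rearr[of M g] by (auto elim: eventually_mono)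
  show "decr_rearr M g \<in> car \<longleftrightarrow> star M g \<in> car"
    using cong_AE(1)[OF m(1) _ ae(1)] cong_AE(1)[OF m(2) _ ae(2)] by blast
  show "star M g \<in> car \<Longrightarrow> nrm (decr_rearr M g) = nrm (star M g)"
    using cong_AE(2)[OF m(1) _ ae(1)] by blast
qed

end

section \<open>From the Kruglov operator to the operators on permutations\<close>

locale ri_kruglov = ri E + kruglov B for E B
begin

text \<open>
  Linearity holds pointwise, so boundedness of the Kruglov operator is only a matter of the norm.
\<close>

lemma kruglov_bounded_iff:
  "bounded_operator Omega E (rearr_space E Omega) (kruglov_op B) \<longleftrightarrow>
    (\<exists>C. \<forall>x\<in>car. star Omega (ksum x) \<in> car \<and> nrm (star Omega (ksum x)) \<le> C * nrm x)"
proof -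
  have lin: "ksum (\<lambda>t. a * x t + b * y t) \<omega> = a * ksum x \<omega> + b * ksum y \<omega>" for a b x y \<omega>
    unfolding ksum_def sum_distrib_left sum.distrib ..
  have m: "ksum x \<in> borel_measurable Omega" if "x \<in> car" for x
    by (rule borel_measurable_ksum[OF car_measurable[OF that]])
  note d = decr_rearr_car[OF Omega.prob_space_axioms m]
  have 1: "fcarrier (rearr_space E Omega) = {g \<in> borel_measurable Omega. decr_rearr Omega g \<in> car}"
    "fnorm (rearr_space E Omega) = (\<lambda>g. nrm (decr_rearr Omega g))"
    by (simp_all add: rearr_space_def)
  show ?thesis
    unfolding bounded_operator_def kruglov_op_eq_ksum 1 using d m lin by (auto 0 4)
qed

text \<open>
  Apply \<open>K\<close> to the cell averages of \<open>\<bar>x\<bar>\<close>. The tail of \<open>T\<^sub>n x\<close> is at most \<open>81 \<ge> 3 e\<^sup>3\<close>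
  times that of \<open>3 K f\<close>, and \<open>243 = 81 * 3\<close>.
\<close>

lemma opT_bound_of_kruglov_bound:
  assumes \<sigma>: "perm_numbering \<sigma>" and n: "1 \<le> n" and x: "x \<in> car"
    and K: "\<And>x. x \<in> car \<Longrightarrow> star Omega (ksum x) \<in> car \<and> nrm (star Omega (ksum x)) \<le> C * nrm x"
  shows "opT \<sigma> n x \<in> car" "nrm (opT \<sigma> n x) \<le> 243 * \<bar>C\<bar> * nrm x"
proof -
  have n0: "0 < n" using n by simp
  define y where "y t = \<bar>x t\<bar>" for t
  have y: "y \<in> car" "nrm y = nrm x" unfolding y_def[abs_def] using abs_car[OF x] by auto
  define a where "a i = opB n y (Suc i)" for i
  have step_eq_avg: "step n a = step n (\<lambda>i. real n * (\<integral>t. y t * indicator (cell n i) t \<partial>mes))"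
    unfolding step_def a_def using opB_eq_integral_cell[OF car_measurable[OF y(1)] n0] by simp
  have g: "step n a \<in> car" "nrm (step n a) \<le> nrm x"
    using step_car[of n] averaging[OF y(1) n0] y(2) unfolding step_eq_avg by (auto simp: y_def)
  define z where "z = star Omega (ksum (step n a))"
  have gm: "ksum (step n a) \<in> borel_measurable Omega" by (intro borel_measurable_ksum borel_measurable_step)
  have z: "z \<in> car" "nrm z \<le> \<bar>C\<bar> * nrm x"
  proof -
    show "z \<in> car" unfolding z_def using K[OF g(1)] by blast
    have "nrm z \<le> C * nrm (step n a)" unfolding z_def using K[OF g(1)] by blast
    also have "\<dots> \<le> \<bar>C\<bar> * nrm x" using g nrm_nonneg[OF g(1)] by (intro mult_mono) auto
    finally show "nrm z \<le> \<bar>C\<bar> * nrm x" .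
  qed
  have z3: "(\<lambda>t. 3 * z t) \<in> car" "nrm (\<lambda>t. 3 * z t) = 3 * nrm z"
    using scale_car[OF z(1), of 3] nrm_scale[OF z(1), of 3] by auto
  have e3: "exp 1 ^ 3 \<le> (3::real) ^ 3" by (intro power_mono exp_le) simp
  have e: "3 * exp 2 * exp 1 \<le> (81::real)"
  proof -
    have "exp (2::real) * exp 1 = exp 1 ^ 3" by (simp add: power3_eq_cube flip: exp_add)
    then have "exp (2::real) * exp 1 \<le> 27" using e3 by (simp only:) simp
    then show ?thesis by (simp only: mult.assoc)
  qed
  have tail: "tail mes (opT \<sigma> n x) \<tau> \<le> real 81 * tail mes (\<lambda>t. 3 * z t) \<tau>" if \<tau>: "0 \<le> \<tau>" for \<tau>
  proof -
    have U: "finite {\<pi>. \<pi> permutes {1..n}}" by (rule finite_permutations) simp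
    have "card {\<pi>. \<pi> permutes {1..n} \<and> \<tau> < \<bar>sum (opB n x) (fixed_points {1..n} \<pi>)\<bar>}
       \<le> card {\<pi>. \<pi> permutes {1..n} \<and> \<tau> < sum (opB n y) (fixed_points {1..n} \<pi>)}"
    proof (rule card_mono)
      show "finite {\<pi>. \<pi> permutes {1..n} \<and> \<tau> < sum (opB n y) (fixed_points {1..n} \<pi>)}"
        by (rule finite_subset[OF _ U]) auto
      have "\<bar>sum (opB n x) (fixed_points {1..n} \<pi>)\<bar> \<le> sum (opB n y) (fixed_points {1..n} \<pi>)" for \<pi>
      proof -
        have "\<bar>sum (opB n x) (fixed_points {1..n} \<pi>)\<bar> \<le> (\<Sum>i\<in>fixed_points {1..n} \<pi>. \<bar>opB n x i\<bar>)"
          by (rule sum_abs)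
        also have "\<dots> \<le> sum (opB n y) (fixed_points {1..n} \<pi>)"
          unfolding y_def[abs_def] by (intro sum_mono abs_opB_le[OF x]) (auto simp: fixed_points_def)
        finally show ?thesis .
      qed
      then show "{\<pi>. \<pi> permutes {1..n} \<and> \<tau> < \<bar>sum (opB n x) (fixed_points {1..n} \<pi>)\<bar>}
         \<subseteq> {\<pi>. \<pi> permutes {1..n} \<and> \<tau> < sum (opB n y) (fixed_points {1..n} \<pi>)}"
        by (auto intro: less_le_trans)
    qed
    then have "tail mes (opT \<sigma> n x) \<tau> \<le> real (card {\<pi>. \<pi> permutes {1..n} \<and> \<tau> < sum (opB n y) (fixed_points {1..n} \<pi>)}) / fact (card {1..n})"
      unfolding tail_opT[OF \<sigma> n \<tau>] by (simp add: divide_right_mono)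
    also have "\<dots> \<le> 3 * exp 2 * subset_weight {1..n} (opB n y) (1 / card {1..n}) (\<tau> / 3)"
      by (rule prob_fixed_point_sum_le) (use n in simp)
    also have "subset_weight {1..n} (opB n y) (1 / card {1..n}) (\<tau> / 3) = subset_weight {..<n} a (1 / n) (\<tau> / 3)"
      unfolding subset_weight_shift a_def by simp
    also have "3 * exp 2 * subset_weight {..<n} a (1 / n) (\<tau> / 3) \<le> 3 * exp 2 * (exp 1 * tail Omega (ksum (step n a)) (\<tau> / 3))"
      using \<tau> by (intro mult_left_mono subset_weight_le_tail_ksum[OF n0]) auto
    also have "\<dots> = (3 * exp 2 * exp 1) * tail Omega (ksum (step n a)) (\<tau> / 3)" by simp
    also have "\<dots> \<le> 81 * tail Omega (ksum (step n a)) (\<tau> / 3)"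
      by (rule mult_right_mono[OF e Omega.tail_nonneg])
    also have "tail Omega (ksum (step n a)) (\<tau> / 3) = tail mes z (\<tau> / 3)"
      unfolding z_def Omega.tail_star[OF gm] ..
    also have "tail mes z (\<tau> / 3) = tail mes (\<lambda>t. 3 * z t) \<tau>"
      unfolding tail_eq_measure by (rule arg_cong[where f="measure mes"]) (auto simp: abs_mult)
    finally show ?thesis by simp
  qed
  have m: "opT \<sigma> n x \<in> borel_measurable mes" unfolding opT_def by (rule borel_measurable_opC)
  have "0 < (81::nat)" by simp
  note dil = dilation[OF m z3(1) this tail]
  show "opT \<sigma> n x \<in> car" by (rule dil(1))
  have "nrm (opT \<sigma> n x) \<le> real 81 * (3 * nrm z)" using dil(2) unfolding z3(2) .
  then show "nrm (opT \<sigma> n x) \<le> 243 * \<bar>C\<bar> * nrm x" using z(2) by simp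
qed

lemma uniformly_boundedI:
  assumes "\<And>n x. 1 \<le> n \<Longrightarrow> x \<in> car \<Longrightarrow> opT \<sigma> n x \<in> car \<and> nrm (opT \<sigma> n x) \<le> D * nrm x"
    and "0 \<le> D"
  shows "uniformly_bounded E (opT \<sigma>)"
  unfolding uniformly_bounded_def
proof (intro conjI allI impI)
  fix n :: nat assume n: "1 \<le> n"
  show "bounded_operator mes E E (opT \<sigma> n)"
    unfolding bounded_operator_def using assms(1)[OF n] opT_linear by blast
next
  show "bdd_above ((\<lambda>n. operator_norm E E (opT \<sigma> n)) ` {1..})"
  proof (rule bdd_aboveI2)
    fix n :: nat assume "n \<in> {1..}"
    then have n: "1 \<le> n" by simp
    show "operator_norm E E (opT \<sigma> n) \<le> D"
      unfolding operator_norm_def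
    proof (rule cSUP_least)
      show "{x \<in> car. nrm x \<le> 1} \<noteq> {}" using zero_car nrm_eq_0_iff[OF zero_car] by auto
      fix x assume x: "x \<in> {x \<in> car. nrm x \<le> 1}"
      then have "nrm (opT \<sigma> n x) \<le> D * nrm x" using assms(1)[OF n] by blast
      also have "\<dots> \<le> D * 1" using x assms(2) by (intro mult_left_mono) auto
      finally show "nrm (opT \<sigma> n x) \<le> D" by simp
    qed
  qed
qed

text \<open>
  The operator norms bound \<open>T\<^sub>n\<close> on all of the space by homogeneity, except on elements of norm \<open>0\<close>;
  there the boundedness of the single operator gives norm \<open>0\<close>.
\<close>

lemma uniformly_boundedD:
  assumes "uniformly_bounded E (opT \<sigma>)"
  shows "\<exists>D\<ge>0. \<forall>n\<ge>1. \<forall>x\<in>car. opT \<sigma> n x \<in> car \<and> nrm (opT \<sigma> n x) \<le> D * nrm x"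
proof -
  obtain D0 where D0: "\<And>n. 1 \<le> n \<Longrightarrow> operator_norm E E (opT \<sigma> n) \<le> D0"
    using assms unfolding uniformly_bounded_def bdd_above_def by auto
  have "opT \<sigma> n x \<in> car \<and> nrm (opT \<sigma> n x) \<le> max 0 D0 * nrm x" if n: "1 \<le> n" and x: "x \<in> car" for n x
  proof -
    have bo: "bounded_operator mes E E (opT \<sigma> n)" using assms n unfolding uniformly_bounded_def by blast
    then obtain c where c: "\<And>x. x \<in> car \<Longrightarrow> opT \<sigma> n x \<in> car" "\<And>x. x \<in> car \<Longrightarrow> nrm (opT \<sigma> n x) \<le> c * nrm x"
      unfolding bounded_operator_def by blast
    have bdd: "bdd_above ((\<lambda>x. nrm (opT \<sigma> n x)) ` {x \<in> car. nrm x \<le> 1})"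
    proof (rule bdd_aboveI2)
      fix x assume x: "x \<in> {x \<in> car. nrm x \<le> 1}"
      then have "nrm (opT \<sigma> n x) \<le> c * nrm x" using c(2) by blast
      also have "\<dots> \<le> \<bar>c\<bar> * 1" using x nrm_nonneg[of x] by (intro mult_mono) auto
      finally show "nrm (opT \<sigma> n x) \<le> \<bar>c\<bar>" by simp
    qed
    have "nrm (opT \<sigma> n x) \<le> max 0 D0 * nrm x"
    proof (cases "nrm x = 0")
      case True
      then show ?thesis using c(2)[OF x] by simp
    next
      case False
      define r where "r = nrm x"
      have r: "0 < r" using False nrm_nonneg[OF x] by (simp add: r_def)
      \<comment> \<open>The form in which linearity of \<open>opT\<close> applies.\<close>
      define x' where "x' t = (1 / r) * x t + 0 * x t" for t
      have x'_eq: "x' = (\<lambda>t. (1 / r) * x t)" by (simp add: x'_def fun_eq_iff)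
      have x': "x' \<in> car" "nrm x' \<le> 1"
        unfolding x'_eq using scale_car[OF x, of "1 / r"] nrm_scale[OF x, of "1 / r"] r by (auto simp: r_def)
      have "opT \<sigma> n x' = (\<lambda>s. (1 / r) * opT \<sigma> n x s)"
        unfolding x'_def[abs_def] using opT_linear[OF x x, of \<sigma> n "1 / r" 0] by (simp add: fun_eq_iff)
      then have "nrm (opT \<sigma> n x') = (1 / r) * nrm (opT \<sigma> n x)"
        using nrm_scale[OF c(1)[OF x], of "1 / r"] r by simp
      moreover have "nrm (opT \<sigma> n x') \<le> operator_norm E E (opT \<sigma> n)"
        unfolding operator_norm_def using x' by (intro cSUP_upper[OF _ bdd]) auto
      ultimately have "(1 / r) * nrm (opT \<sigma> n x) \<le> D0" using D0[OF n] by simp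
      then have "nrm (opT \<sigma> n x) \<le> D0 * r" using r by (simp add: field_simps)
      also have "\<dots> \<le> max 0 D0 * r" using r by (intro mult_right_mono) auto
      finally show ?thesis by (simp add: r_def)
    qed
    then show ?thesis using c(1)[OF x] by blast
  qed
  then show ?thesis by (intro exI[of _ "max 0 D0"]) auto
qed

end

section \<open>From the operators on permutations to the Kruglov operator\<close>

context prob_space
begin

lemma tail_incseq_tendsto:
  assumes gm: "\<And>k. g k \<in> borel_measurable M" and hm: "h \<in> borel_measurable M"
    and nonneg: "\<And>k w. 0 \<le> g k w"
    and mono: "\<And>w. w \<in> space M \<Longrightarrow> incseq (\<lambda>k. g k w)"
    and lim: "\<And>w. w \<in> space M \<Longrightarrow> (\<lambda>k. g k w) \<longlonglongrightarrow> h w"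
  shows "(\<lambda>k. tail M (g k) \<tau>) \<longlonglongrightarrow> tail M h \<tau>"
proof -
  define A where "A k = {w \<in> space M. \<tau> < \<bar>g k w\<bar>}" for k
  have le: "g k w \<le> h w" if "w \<in> space M" for k w
    by (rule incseq_le[OF mono lim]) (use that in auto)
  have h0: "0 \<le> h w" if "w \<in> space M" for w
    using nonneg[of 0 w] le[OF that, of 0] by linarith
  have "(\<lambda>k. measure M (A k)) \<longlonglongrightarrow> measure M (\<Union>k. A k)"
  proof (rule finite_Lim_measure_incseq)
    show "range A \<subseteq> sets M" unfolding A_def using gm by auto
    show "incseq A"
    proof (rule incseq_SucI, rule subsetI)
      fix k w assume w: "w \<in> A k"
      then have "g k w \<le> g (Suc k) w" using incseq_SucD[OF mono] by (simp add: A_def)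
      then show "w \<in> A (Suc k)" using w nonneg[of k w] nonneg[of "Suc k" w] by (simp add: A_def)
    qed
  qed
  also have "(\<Union>k. A k) = {w \<in> space M. \<tau> < \<bar>h w\<bar>}"
  proof (intro set_eqI iffI)
    fix w assume "w \<in> (\<Union>k. A k)"
    then obtain k where "w \<in> space M" "\<tau> < g k w" using nonneg by (auto simp: A_def)
    then show "w \<in> {w \<in> space M. \<tau> < \<bar>h w\<bar>}" using le[of w k] h0[of w] by simp
  next
    fix w assume w: "w \<in> {w \<in> space M. \<tau> < \<bar>h w\<bar>}"
    then have "\<tau> < h w" using h0[of w] by simp
    then obtain k where "\<tau> < g k w"
      using order_tendstoD(1)[OF lim, of w \<tau>] w by (auto simp: eventually_sequentially)
    then have "w \<in> A k" using w nonneg[of k w] by (simp add: A_def)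
    then show "w \<in> (\<Union>k. A k)" by blast
  qed
  finally show ?thesis by (simp add: A_def tail_eq_measure)
qed

text \<open>
  A strict lower bound for the limit at \<open>t\<close> says that \<open>t\<close> lies below a tail, which is then also
  true for the approximating tails.
\<close>

lemma star_incseq_tendsto:
  assumes gm: "\<And>k. g k \<in> borel_measurable M" and hm: "h \<in> borel_measurable M"
    and nonneg: "\<And>k w. 0 \<le> g k w"
    and mono: "\<And>w. w \<in> space M \<Longrightarrow> incseq (\<lambda>k. g k w)"
    and lim: "\<And>\<tau>. (\<lambda>k. tail M (g k) \<tau>) \<longlonglongrightarrow> tail M h \<tau>"
  shows "incseq (\<lambda>k. star M (g k) t)" "(\<lambda>k. star M (g k) t) \<longlonglongrightarrow> star M h t"
proof -
  have mono_tail: "incseq (\<lambda>k. tail M (g k) \<tau>)" for \<tau>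
  proof (rule incseq_SucI, rule tail_mono[OF gm], rule AE_I2)
    fix k w assume "w \<in> space M"
    then show "\<bar>g k w\<bar> \<le> \<bar>g (Suc k) w\<bar>"
      using incseq_SucD[OF mono] nonneg[of k w] nonneg[of "Suc k" w] by simp
  qed
  show "incseq (\<lambda>k. star M (g k) t)"
    by (rule incseq_SucI, rule star_le_star[OF gm prob_space_axioms gm]) (rule incseq_SucD[OF mono_tail])
  have le: "star M (g k) t \<le> star M h t" for k
    by (rule star_le_star[OF gm prob_space_axioms hm]) (rule incseq_le[OF mono_tail lim])
  show "(\<lambda>k. star M (g k) t) \<longlonglongrightarrow> star M h t"
  proof (rule order_tendstoI)
    fix a assume a: "a < star M h t"
    show "eventually (\<lambda>k. a < star M (g k) t) sequentially"
    proof (cases "0 \<le> a")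
      case True
      then have *: "0 < t" "t < tail M h a" using a less_star_iff[OF hm True] by auto
      have "eventually (\<lambda>k. t < tail M (g k) a) sequentially"
        using order_tendstoD(1)[OF lim *(2)] .
      then show ?thesis by eventually_elim (use *(1) less_star_iff[OF gm True] in blast)
    next
      case False
      then have "a < star M (g k) t" for k using star_nonneg[OF gm, of k t] by linarith
      then show ?thesis by simp
    qed
  next
    fix a assume "star M h t < a"
    then have "star M (g k) t < a" for k using le[of k] by linarith
    then show "eventually (\<lambda>k. star M (g k) t < a) sequentially" by simp
  qed
qed

end

lemma fact_ge_power_mult_fact: "j ^ i * fact j \<le> (fact (j + i) :: nat)"
proof (induction i)
  case (Suc i)
  have "j ^ Suc i * fact j = j * (j ^ i * fact j)" by simp
  also have "\<dots> \<le> (j + i + 1) * fact (j + i)" using Suc by (intro mult_mono) auto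
  also have "\<dots> = fact (j + Suc i)" by simp
  finally show ?case .
qed simp

context kruglov
begin

text \<open>
  By \<open>(L + i)! \<ge> L! i!\<close> the remainder of the exponential series is at most \<open>e / L!\<close>.
\<close>

lemma measure_blk_ge:
  assumes "1 \<le> L"
  shows "measure Omega {\<omega> \<in> space Omega. L \<le> blk (\<omega> 0)} \<le> 1 / fact L"
proof -
  define A where "A i = {\<omega> \<in> space Omega. blk (\<omega> 0) = L + i}" for i
  have eq: "{\<omega> \<in> space Omega. L \<le> blk (\<omega> 0)} = (\<Union>i. A i)"
    by (auto simp: A_def le_iff_add)
  have 1: "(\<lambda>i. measure Omega (A i)) sums measure Omega (\<Union>i. A i)"
    by (rule Omega.finite_measure_UNION) (auto simp: A_def disjoint_family_on_def)
  have 2: "measure Omega (A i) \<le> (1 / (exp 1 * fact L)) * (1 ^ i /\<^sub>R fact i)" for i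
  proof -
    have Li: "1 \<le> L + i" using assms by simp
    have "A i = {\<omega> \<in> space Omega. \<forall>k\<in>{0}. \<omega> k \<in> B (L + i)}"
      unfolding A_def blk_eq_iff[OF Li] by simp
    also have "measure Omega \<dots> = (\<Prod>k\<in>{0::nat}. measure mes (B (L + i)))"
      by (rule measure_Omega_box) (use B_sets[OF Li] in auto)
    finally have "measure Omega (A i) = 1 / (exp 1 * fact (L + i))"
      using measure_B[OF Li] by simp
    also have "\<dots> \<le> 1 / (exp 1 * (fact L * fact i))"
    proof -
      have "fact L * fact i \<le> (fact (L + i) :: nat)"
        by (intro dvd_imp_le fact_fact_dvd_fact) simp
      then have "real (fact L * fact i) \<le> real (fact (L + i))" by (simp only: of_nat_le_iff)
      then show ?thesis by (intro divide_left_mono mult_left_mono) auto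
    qed
    finally show ?thesis by (simp add: divide_inverse)
  qed
  have 3: "(\<lambda>i. (1 / (exp 1 * fact L)) * (1 ^ i /\<^sub>R fact i)) sums ((1 / (exp 1 * fact L)) * exp (1::real))"
    by (intro sums_mult exp_converges)
  have "measure Omega {\<omega> \<in> space Omega. L \<le> blk (\<omega> 0)} \<le> (1 / (exp 1 * fact L)) * exp 1"
    unfolding eq by (rule sums_le[OF 2 1 3])
  then show ?thesis by simp
qed

text \<open>
  The indicator function of the interval from \<open>0\<close> to \<open>1 / H\<close>; its Kruglov sum is a Poisson variable
  with the small parameter \<open>1 / H\<close>.
\<close>

definition spike :: "nat \<Rightarrow> real \<Rightarrow> real" where
  "spike H = indicator (cell H 0)"

lemma borel_measurable_spike: "0 < H \<Longrightarrow> spike H \<in> borel_measurable mes"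
  unfolding spike_def using cell_sets[of H 0] by (intro borel_measurable_indicator)

text \<open>
  There are \<open>j\<close> summands that all hit the short interval with probability \<open>1 / (e H\<^sup>j j!)\<close>. For
  \<open>j \<ge> H\<close> this is at least \<open>1 / (e (2 j)!)\<close>, because \<open>(2 j)! \<ge> j\<^sup>j j!\<close>: far out, halving the number of
  summands compensates for an arbitrarily small parameter.
\<close>

lemma measure_blk_ge_le_spike:
  assumes H: "0 < H" "H \<le> j" and s: "s < real j"
  shows "measure Omega {\<omega> \<in> space Omega. 2 * j \<le> blk (\<omega> 0)} \<le> 3 * tail Omega (ksum (spike H)) s"
proof -
  have j: "1 \<le> j" using H by simp
  have "real (H ^ j * fact j) \<le> real (fact (j + j))"
  proof -
    have "H ^ j * fact j \<le> j ^ j * (fact j :: nat)" using H by (intro mult_right_mono power_mono) auto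
    also have "\<dots> \<le> fact (j + j)" by (rule fact_ge_power_mult_fact)
    finally show ?thesis by (simp only: of_nat_le_iff)
  qed
  then have f: "real H ^ j * fact j \<le> fact (2 * j)" by (simp add: mult_2)
  let ?A = "{\<omega> \<in> space Omega. blk (\<omega> 0) = j \<and> (\<forall>k\<in>{1..j}. \<omega> k \<in> cell H 0)}"
  have "measure Omega ?A = (\<Prod>k\<in>{1..j}. measure mes (cell H 0)) / (exp 1 * fact j)"
    by (rule measure_blk_box[OF j]) (use H in auto)
  then have mA: "measure Omega ?A = 1 / (exp 1 * (real H ^ j * fact j))"
    using measure_cell[OF H(1), of 0] H by (simp add: power_one_over)
  have "measure Omega {\<omega> \<in> space Omega. 2 * j \<le> blk (\<omega> 0)} \<le> 1 / fact (2 * j)"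
    by (rule measure_blk_ge) (use j in simp)
  also have "\<dots> \<le> 1 / (real H ^ j * fact j)"
    using f H by (intro divide_left_mono) auto
  also have "\<dots> = exp 1 * measure Omega ?A" unfolding mA by simp
  also have "\<dots> \<le> 3 * measure Omega ?A" by (intro mult_right_mono exp_le) simp
  also have "measure Omega ?A \<le> tail Omega (ksum (spike H)) s"
    unfolding tail_eq_measure
  proof (rule Omega.finite_measure_mono)
    show "{w \<in> space Omega. s < \<bar>ksum (spike H) w\<bar>} \<in> sets Omega"
      using borel_measurable_ksum[OF borel_measurable_spike[OF H(1)]] by measurable
    show "?A \<subseteq> {w \<in> space Omega. s < \<bar>ksum (spike H) w\<bar>}"
    proof
      fix w assume w: "w \<in> ?A"
      then have "ksum (spike H) w = (\<Sum>k=1..j. 1)" unfolding ksum_def spike_def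
        by (intro sum.cong) auto
      then show "w \<in> {w \<in> space Omega. s < \<bar>ksum (spike H) w\<bar>}" using w s by simp
    qed
  qed
  finally show ?thesis by simp
qed

end

context ri_kruglov
begin

lemma star_ktrunc_step_bound:
  assumes \<sigma>: "perm_numbering \<sigma>"
    and T: "\<And>n x. 1 \<le> n \<Longrightarrow> x \<in> car \<Longrightarrow> opT \<sigma> n x \<in> car \<and> nrm (opT \<sigma> n x) \<le> D * nrm x"
    and n: "0 < n" and v: "\<And>i. 0 \<le> v i"
  shows "star Omega (ktrunc J (step n v)) \<in> car"
    and "nrm (star Omega (ktrunc J (step n v))) \<le> 3 * D * nrm (step n v)"
proof -
  \<comment> \<open>Large enough for half of the tuples to be free of repetitions and for two more points than \<open>J\<close>.\<close>
  define M where "M = 2 * J ^ 2 + J + 2"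
  have M: "0 < M" "2 * J ^ 2 \<le> M" by (simp_all add: M_def)
  have "M \<le> n * M" using n by simp
  moreover have "J + 2 \<le> M" by (simp add: M_def)
  ultimately have M3: "J + 2 \<le> n * M" by linarith
  have N: "1 \<le> n * M" using M3 by linarith
  define z where "z = opT \<sigma> (n * M) (step n v)"
  have z: "z \<in> car" "nrm z \<le> D * nrm (step n v)"
    unfolding z_def using T[OF N step_car] by auto
  have m: "ktrunc J (step n v) \<in> borel_measurable Omega" by (intro borel_measurable_ktrunc borel_measurable_step)
  have tl: "tail Omega (ktrunc J (step n v)) \<tau> \<le> real 3 * tail mes z \<tau>" if \<tau>: "0 \<le> \<tau>" for \<tau>
  proof -
    have eq: "sum (opB (n * M) (step n v)) (fixed_points {1..n * M} \<pi>) = (\<Sum>i\<in>fixed_points {1..n * M} \<pi>. v ((i - 1) div M))" for \<pi>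
      by (intro sum.cong refl opB_step[OF n M(1)]) (auto simp: fixed_points_def)
    have abs: "\<bar>\<Sum>i\<in>fixed_points {1..n * M} \<pi>. v ((i - 1) div M)\<bar> = (\<Sum>i\<in>fixed_points {1..n * M} \<pi>. v ((i - 1) div M))" for \<pi>
      by (rule abs_of_nonneg, rule sum_nonneg, rule v)
    show ?thesis
      unfolding z_def tail_opT[OF \<sigma> N \<tau>] eq abs
      using tail_ktrunc_step_le[OF n M M3 v \<tau>] by (simp only: of_nat_numeral)
  qed
  have "0 < (3::nat)" by simp
  note dil = dilation_star[OF Omega.prob_space_axioms m z(1) this tl]
  show "star Omega (ktrunc J (step n v)) \<in> car" by (rule dil(1))
  show "nrm (star Omega (ktrunc J (step n v))) \<le> 3 * D * nrm (step n v)" using dil(2) z(2) by simp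
qed

lemma lstep_star_nrm_le:
  assumes "x \<in> car" "0 < N"
  shows "nrm (lstep N (star mes x)) \<le> nrm x"
proof -
  note xm = car_measurable[OF assms(1)]
  have s: "star mes x \<in> car" using assms(1) xm by (simp add: star_car_iff)
  have "nrm (lstep N (star mes x)) \<le> nrm (star mes x)"
  proof (rule solid(2)[OF _ s])
    show "lstep N (star mes x) \<in> borel_measurable mes" unfolding lstep_def by measurable
    show "AE t in mes. \<bar>lstep N (star mes x) t\<bar> \<le> \<bar>star mes x t\<bar>"
      using mes.lstep_star_le[OF xm assms(2)] mes.lstep_star_nonneg[OF xm] mes.star_nonneg[OF xm] by simp
  qed
  then show ?thesis using nrm_star[OF assms(1)] by simp
qed

text \<open>
  Increase the number of summands and the fineness of the step functions simultaneously; the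
  function and its rearrangement have equally distributed Kruglov sums.
\<close>

lemma ktrunc_approximation:
  assumes x: "x \<in> car" "\<And>t. 0 \<le> x t"
  defines "g \<equiv> \<lambda>k. ktrunc k (lstep (2 ^ k) (star mes x))"
  shows "g k \<in> borel_measurable Omega" "0 \<le> g k w"
    and "incseq (\<lambda>k. star Omega (g k) t)" "(\<lambda>k. star Omega (g k) t) \<longlonglongrightarrow> star Omega (ksum x) t"
proof -
  note xm = car_measurable[OF x(1)]
  let ?s = "star mes x" and ?y = "\<lambda>k. lstep (2 ^ k) (star mes x)"
  have y0: "0 \<le> ?y k t" for k t by (rule mes.lstep_star_nonneg[OF xm])
  have s0: "0 \<le> ?s t" for t by (rule mes.star_nonneg[OF xm])
  have ymono: "?y k t \<le> ?y (Suc k) t" for k t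
  proof -
    have "lstep (2 ^ k) ?s t \<le> lstep (2 ^ k * 2) ?s t"
      by (rule lstep_refine_le) (auto intro: mes.star_antimono[OF xm])
    then show ?thesis by (simp only: power_Suc mult.commute)
  qed
  have ylim: "(\<lambda>k. ?y k t) \<longlonglongrightarrow> ?s t" for t
  proof (rule mes.lstep_star_tendsto[OF xm])
    show "filterlim (\<lambda>k. 2 ^ k :: nat) at_top sequentially"
    proof (rule filterlim_at_top_mono[OF filterlim_ident], rule always_eventually, rule allI)
      fix k :: nat show "k \<le> 2 ^ k" by simp
    qed
  qed simp
  have ym: "?y k \<in> borel_measurable mes" for k unfolding lstep_def by measurable
  show gm: "g k \<in> borel_measurable Omega" for k unfolding g_def by (rule borel_measurable_ktrunc[OF ym])
  have ky0: "0 \<le> ksum (?y k) w" for k w by (rule ksum_nonneg, rule y0)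
  have g0: "0 \<le> g k w" for k w
    unfolding g_def ktrunc_def using ky0[of k w] by simp
  show "0 \<le> g k w" by (rule g0)
  have gmono: "incseq (\<lambda>k. g k w)" for w
  proof (rule incseq_SucI)
    fix k
    have "ksum (?y k) w \<le> ksum (?y (Suc k)) w" unfolding ksum_def by (intro sum_mono ymono)
    then show "g k w \<le> g (Suc k) w"
      unfolding g_def ktrunc_def using ky0[of k w] ky0[of "Suc k" w] by auto
  qed
  have glim: "(\<lambda>k. g k w) \<longlonglongrightarrow> ksum ?s w" for w
  proof -
    have "(\<lambda>k. ksum (?y k) w) \<longlonglongrightarrow> ksum ?s w" unfolding ksum_def by (intro tendsto_sum ylim)
    moreover have "eventually (\<lambda>k. ksum (?y k) w = g k w) sequentially"
      unfolding eventually_sequentially g_def ktrunc_def by auto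
    ultimately show ?thesis by (rule Lim_transform_eventually)
  qed
  have sm: "?s \<in> borel_measurable mes" using xm by measurable
  have Ks: "tail Omega (ksum ?s) \<tau> = tail Omega (ksum x) \<tau>" for \<tau>
    by (rule tail_ksum_cong[OF sm s0 xm x(2)]) (simp add: mes.tail_star[OF xm])
  have lim: "(\<lambda>k. tail Omega (g k) \<tau>) \<longlonglongrightarrow> tail Omega (ksum x) \<tau>" for \<tau>
    unfolding Ks[symmetric]
    by (rule Omega.tail_incseq_tendsto[OF gm borel_measurable_ksum[OF sm] g0 gmono glim])
  show "incseq (\<lambda>k. star Omega (g k) t)" "(\<lambda>k. star Omega (g k) t) \<longlonglongrightarrow> star Omega (ksum x) t"
    by (rule Omega.star_incseq_tendsto[OF gm borel_measurable_ksum[OF xm] g0 gmono lim])+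
qed

lemma separable_small_spike:
  assumes "separable_fspace E" "0 < e"
  shows "\<exists>H>0. spike H \<in> car \<and> nrm (spike H) < e"
proof -
  obtain h where h: "0 < h" "\<And>A. A \<in> sets mes \<Longrightarrow> measure mes A \<le> h \<Longrightarrow> nrm (indicator A) < e"
    using separable_small_sets[OF assms] by blast
  obtain n where n: "1 / real (Suc n) < h" using nat_approx_posE[OF h(1)] by blast
  have H: "0 < Suc n" by simp
  have "nrm (spike (Suc n)) < e"
    unfolding spike_def
  proof (rule h(2)[OF cell_sets[OF H H]])
    show "measure mes (cell (Suc n) 0) \<le> h" using n unfolding measure_cell[OF H H] by linarith
  qed
  moreover have "spike (Suc n) \<in> car"
  proof (rule bounded_car(1)[OF borel_measurable_spike[OF H], of 1])
    show "AE t in mes. \<bar>spike (Suc n) t\<bar> \<le> 1" by (rule AE_I2) (simp add: spike_def indicator_def)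
  qed simp
  ultimately show ?thesis using H by blast
qed

text \<open>
  Write \<open>x \<le> b1 + p\<close> with \<open>p\<close> of small norm. Then \<open>K x\<close> is at most \<open>K p\<close> plus \<open>b1\<close>
  times the number of summands, and beyond a suitable level the tail of the second term is bounded by
  that of a multiple of the Kruglov sum of a narrow spike. Both comparison functions are
  truncated at the level \<open>c\<close>, because only for truncations a norm bound is known at this stage.
\<close>

lemma separable_kruglov_tail:
  assumes sep: "separable_fspace E"
    and bound: "\<And>x c. x \<in> car \<Longrightarrow> (\<And>t. 0 \<le> x t) \<Longrightarrow> 0 \<le> c \<Longrightarrow> nrm (\<lambda>t. min (star Omega (ksum x) t) c) \<le> D * nrm x"
    and x: "x \<in> car" "\<And>t. 0 \<le> x t" and e: "0 < e" and D: "0 < D"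
  shows "\<exists>b. \<forall>c\<ge>0. nrm (\<lambda>t. star Omega (ksum x) t * indicator {t. b < star Omega (ksum x) t \<and> star Omega (ksum x) t \<le> c} t) \<le> e"
proof -
  define S where "S = star Omega (ksum x)"
  note xm = car_measurable[OF x(1)]
  have Km: "ksum f \<in> borel_measurable Omega" if "f \<in> car" for f by (rule borel_measurable_ksum[OF car_measurable[OF that]])
  have S0: "0 \<le> S t" for t unfolding S_def by (rule Omega.star_nonneg[OF Km[OF x(1)]])
  have Sm: "S \<in> borel_measurable mes" unfolding S_def by (rule Omega.borel_measurable_star_mes[OF Km[OF x(1)]])
  have d: "0 < e / (16 * D)" using e D by simp
  obtain b0 where b0: "0 \<le> b0" "(\<lambda>t. x t * indicator {t. b0 < \<bar>x t\<bar>} t) \<in> car" 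
      "nrm (\<lambda>t. x t * indicator {t. b0 < \<bar>x t\<bar>} t) < e / (16 * D)"
    using separable_truncation[OF sep x(1) d] by blast
  define p where "p t = x t * indicator {t. b0 < \<bar>x t\<bar>} t" for t
  have p: "p \<in> car" "nrm p < e / (16 * D)" "\<And>t. 0 \<le> p t"
    using b0 x(2) unfolding p_def[abs_def] by auto
  define b1 where "b1 = b0 + 1"
  have b1: "1 \<le> b1" "x t \<le> b1 + p t" for t
    using b0(1) x(2)[of t] by (auto simp: b1_def p_def indicator_def)
  have d2: "0 < e / (128 * b1 * D)" using e D b1(1) by simp
  obtain H where H: "0 < H" "spike H \<in> car" "nrm (spike H) < e / (128 * b1 * D)"
    using separable_small_spike[OF sep d2] by blast
  have q0: "0 \<le> spike H t" for t by (simp add: spike_def)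
  define P where "P = star Omega (ksum p)"
  define Q where "Q = star Omega (ksum (spike H))"
  have Pm: "P \<in> borel_measurable mes" unfolding P_def by (rule Omega.borel_measurable_star_mes[OF Km[OF p(1)]])
  have Qm: "Q \<in> borel_measurable mes" unfolding Q_def by (rule Omega.borel_measurable_star_mes[OF Km[OF H(2)]])
  have P0: "0 \<le> P t" for t unfolding P_def by (rule Omega.star_nonneg[OF Km[OF p(1)]])
  have Q0: "0 \<le> Q t" for t unfolding Q_def by (rule Omega.star_nonneg[OF Km[OF H(2)]])
  \<comment> \<open>Chosen such that \<open>s \<ge> b\<close> gives an index \<open>j \<ge> H\<close> with \<open>s / (16 * b1) < j\<close> and \<open>2 * j \<le> s / (2 * b1)\<close>.\<close>
  define b where "b = 2 * b1 * (2 * real H + 4)"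
  have b_pos: "0 \<le> b" using b1(1) by (simp add: b_def)
  have ksum_le: "ksum x w \<le> ksum p w + b1 * real (blk (w 0))" for w
  proof -
    have "ksum x w \<le> (\<Sum>k=1..blk (w 0). b1 + p (w k))" unfolding ksum_def by (intro sum_mono b1(2))
    then show ?thesis by (simp add: sum.distrib ksum_def mult.commute)
  qed
  have tailS: "tail mes S s \<le> tail mes P (s / 2) + 3 * tail mes Q (s / (16 * b1))" if s: "b \<le> s" for s
  proof -
    define r where "r = s / (2 * b1)"
    have r: "2 * real H + 4 \<le> r" using s b1(1) unfolding r_def b_def by (simp add: pos_le_divide_eq mult.commute)
    define j where "j = nat \<lfloor>r / 2\<rfloor>"
    have j: "real j \<le> r / 2" "r / 2 < real j + 1" using r unfolding j_def by linarith+
    have jH: "H \<le> j" using r j by linarith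
    have rj: "r / 8 < real j" using r j by linarith
    let ?A = "{w \<in> space Omega. s / 2 < \<bar>ksum p w\<bar>}" and ?B = "{w \<in> space Omega. 2 * j \<le> blk (w 0)}"
    have As: "?A \<in> sets Omega" using Km[OF p(1)] by measurable
    have Bs: "?B \<in> sets Omega" by measurable
    have "tail mes S s = measure Omega {w \<in> space Omega. s < \<bar>ksum x w\<bar>}"
      unfolding S_def Omega.tail_star[OF Km[OF x(1)]] tail_eq_measure ..
    also have "\<dots> \<le> measure Omega (?A \<union> ?B)"
    proof (rule Omega.finite_measure_mono)
      show "?A \<union> ?B \<in> sets Omega" using As Bs by (rule sets.Un)
      show "{w \<in> space Omega. s < \<bar>ksum x w\<bar>} \<subseteq> ?A \<union> ?B"
      proof
        fix w assume w: "w \<in> {w \<in> space Omega. s < \<bar>ksum x w\<bar>}"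
        have "s < ksum p w + b1 * real (blk (w 0))" using w ksum_le[of w] ksum_nonneg[OF x(2), where \<omega>=w] by simp
        then have "s / 2 < ksum p w \<or> s / 2 < b1 * real (blk (w 0))" by linarith
        then show "w \<in> ?A \<union> ?B"
        proof
          assume "s / 2 < b1 * real (blk (w 0))"
          then have "r < real (blk (w 0))" using b1(1) unfolding r_def by (simp add: field_simps)
          then have "real (2 * j) \<le> real (blk (w 0))" using j by simp
          then show ?thesis using w by simp
        qed (use w in auto)
      qed
    qed
    also have "\<dots> \<le> measure Omega ?A + measure Omega ?B" by (rule measure_Un_le[OF As Bs])
    also have "measure Omega ?B \<le> 3 * tail Omega (ksum (spike H)) (r / 8)"
      by (rule measure_blk_ge_le_spike[OF H(1) jH rj])
    also have "measure Omega ?A = tail mes P (s / 2)"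
      unfolding P_def Omega.tail_star[OF Km[OF p(1)]] tail_eq_measure ..
    also have "tail Omega (ksum (spike H)) (r / 8) = tail mes Q (s / (16 * b1))"
      unfolding Q_def Omega.tail_star[OF Km[OF H(2)]] by (simp add: r_def)
    finally show ?thesis by simp
  qed
  have "nrm (\<lambda>t. S t * indicator {t. b < S t \<and> S t \<le> c} t) \<le> e" if c: "0 \<le> c" for c
  proof -
    define v where "v t = S t * indicator {t. b < S t \<and> S t \<le> c} t" for t
    \<comment> \<open>Both terms on the right of \<open>tailS\<close> are bounded by the tail of \<open>z\<close>, which makes four tails in all.\<close>
    define z where "z t = 2 * min (P t) c + (16 * b1) * min (Q t) c" for t
    have vm: "v \<in> borel_measurable mes" unfolding v_def[abs_def] indicator_def using Sm by measurable
    have Pc: "(\<lambda>t. min (P t) c) \<in> car" 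
      by (rule bounded_car(1)[of _ c]) (use Pm P0 c in auto)
    have Qc: "(\<lambda>t. min (Q t) c) \<in> car" 
      by (rule bounded_car(1)[of _ c]) (use Qm Q0 c in auto)
    have zc: "z \<in> car" unfolding z_def[abs_def] by (intro add_car scale_car Pc Qc)
    have zn: "nrm z \<le> e / 4"
    proof -
      have "nrm z \<le> nrm (\<lambda>t. 2 * min (P t) c) + nrm (\<lambda>t. (16 * b1) * min (Q t) c)"
        unfolding z_def[abs_def] by (intro nrm_triangle scale_car Pc Qc)
      also have "nrm (\<lambda>t. 2 * min (P t) c) = 2 * nrm (\<lambda>t. min (P t) c)" using nrm_scale[OF Pc, of 2] by simp
      also have "nrm (\<lambda>t. (16 * b1) * min (Q t) c) = (16 * b1) * nrm (\<lambda>t. min (Q t) c)"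
        using nrm_scale[OF Qc, of "16 * b1"] b1(1) by simp
      also have "nrm (\<lambda>t. min (P t) c) \<le> D * (e / (16 * D))"
        using order_trans[OF bound[OF p(1) p(3) c] mult_left_mono[OF less_imp_le[OF p(2)] less_imp_le[OF D]]]
        unfolding P_def .
      also have "nrm (\<lambda>t. min (Q t) c) \<le> D * (e / (128 * b1 * D))"
        using order_trans[OF bound[OF H(2) q0 c] mult_left_mono[OF less_imp_le[OF H(3)] less_imp_le[OF D]]]
        unfolding Q_def .
      finally have "nrm z \<le> 2 * (D * (e / (16 * D))) + 16 * b1 * (D * (e / (128 * b1 * D)))"
        using b1(1) by simp
      also have "\<dots> = e / 4" using D b1(1) by (simp add: field_simps)
      finally show ?thesis .
    qed
    have "tail mes v \<tau> \<le> real 4 * tail mes z \<tau>" if \<tau>: "0 \<le> \<tau>" for \<tau>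
    proof (cases "\<tau> < c")
      case False
      then have "{w \<in> space mes. \<tau> < \<bar>v w\<bar>} = {}" using S0 \<tau> by (auto simp: v_def indicator_def)
      then have "tail mes v \<tau> = 0" unfolding tail_eq_measure by (simp only: measure_empty)
      then show ?thesis using mes.tail_nonneg[of z \<tau>] by linarith
    next
      case True
      have z0: "0 \<le> z t" for t unfolding z_def using P0[of t] Q0[of t] c b1(1) by simp
      define s where "s = max \<tau> b"
      have s: "b \<le> s" "\<tau> \<le> s" by (auto simp: s_def)
      have "tail mes v \<tau> \<le> tail mes S s"
        unfolding tail_eq_measure
      proof (rule mes.finite_measure_mono)
        show "{w \<in> space mes. s < \<bar>S w\<bar>} \<in> sets mes" using Sm by measurable
      qed (use S0 \<tau> in \<open>auto simp: v_def s_def indicator_def split: if_splits\<close>)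
      also have "\<dots> \<le> tail mes P (s / 2) + 3 * tail mes Q (s / (16 * b1))" by (rule tailS[OF s(1)])
      also have "tail mes P (s / 2) \<le> tail mes P (\<tau> / 2)"
        by (rule mes.tail_antimono[OF Pm]) (use s in simp)
      also have "tail mes Q (s / (16 * b1)) \<le> tail mes Q (\<tau> / (16 * b1))"
        by (rule mes.tail_antimono[OF Qm]) (use s b1(1) in \<open>simp add: divide_right_mono\<close>)
      also have "tail mes P (\<tau> / 2) \<le> tail mes z \<tau>"
        unfolding tail_eq_measure
      proof (rule mes.finite_measure_mono)
        show "{w \<in> space mes. \<tau> < \<bar>z w\<bar>} \<in> sets mes" using car_measurable[OF zc] by measurable
        show "{w \<in> space mes. \<tau> / 2 < \<bar>P w\<bar>} \<subseteq> {w \<in> space mes. \<tau> < \<bar>z w\<bar>}"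
        proof
          fix w assume w: "w \<in> {w \<in> space mes. \<tau> / 2 < \<bar>P w\<bar>}"
          then have "\<tau> / 2 < min (P w) c" using P0[of w] True \<tau> by simp
          moreover have "0 \<le> (16 * b1) * min (Q w) c" using Q0[of w] c b1(1) by simp
          ultimately have "\<tau> < z w" unfolding z_def by linarith
          then show "w \<in> {w \<in> space mes. \<tau> < \<bar>z w\<bar>}" using w by auto
        qed
      qed
      also have "tail mes Q (\<tau> / (16 * b1)) \<le> tail mes z \<tau>"
        unfolding tail_eq_measure
      proof (rule mes.finite_measure_mono)
        show "{w \<in> space mes. \<tau> < \<bar>z w\<bar>} \<in> sets mes" using car_measurable[OF zc] by measurable
        show "{w \<in> space mes. \<tau> / (16 * b1) < \<bar>Q w\<bar>} \<subseteq> {w \<in> space mes. \<tau> < \<bar>z w\<bar>}"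
        proof
          fix w assume w: "w \<in> {w \<in> space mes. \<tau> / (16 * b1) < \<bar>Q w\<bar>}"
          have "\<tau> / (16 * b1) \<le> \<tau> / 1" using \<tau> b1(1) by (intro divide_left_mono) auto
          then have "\<tau> / (16 * b1) < min (Q w) c" using w Q0[of w] True by simp
          moreover have "0 < 16 * b1" using b1(1) by simp
          ultimately have "\<tau> < min (Q w) c * (16 * b1)" by (simp only: pos_divide_less_eq)
          then have "\<tau> < (16 * b1) * min (Q w) c" by (simp only: mult.commute)
          moreover have "0 \<le> 2 * min (P w) c" using P0[of w] c by simp
          ultimately have "\<tau> < z w" unfolding z_def by linarith
          then show "w \<in> {w \<in> space mes. \<tau> < \<bar>z w\<bar>}" using w by auto
        qed
      qed
      finally show ?thesis by simp
    qed
    then have "nrm v \<le> real 4 * nrm z" by (intro dilation(2)[OF vm zc]) auto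
    then show ?thesis using zn unfolding v_def[abs_def] by simp
  qed
  then show ?thesis unfolding S_def by blast
qed

text \<open>
  The step functions that approximate the rearrangement of \<open>x\<close> satisfy the bound by comparison with
  \<open>T\<^sub>n\<close> for a large \<open>n\<close>. If \<open>E\<close> is its second dual, the limit exists in \<open>E\<close>
  by the Fatou property; if \<open>E\<close> is separable, first the truncations of the limit are bounded, and then
  they converge because its large values contribute little.
\<close>

lemma kruglov_bound_of_opT_bound:
  assumes \<sigma>: "perm_numbering \<sigma>" and D: "0 \<le> D"
    and T: "\<And>n x. 1 \<le> n \<Longrightarrow> x \<in> car \<Longrightarrow> opT \<sigma> n x \<in> car \<and> nrm (opT \<sigma> n x) \<le> D * nrm x"
    and x: "x \<in> car" "\<And>t. 0 \<le> x t"
  shows "star Omega (ksum x) \<in> car" "nrm (star Omega (ksum x)) \<le> 3 * D * nrm x"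
proof -
  define g where "g x k = ktrunc k (lstep (2 ^ k) (star mes x))" for x k
  have Km: "ksum f \<in> borel_measurable Omega" if "f \<in> car" for f by (rule borel_measurable_ksum[OF car_measurable[OF that]])
  have g: "star Omega (g x k) \<in> car \<and> nrm (star Omega (g x k)) \<le> 3 * D * nrm x" if x: "x \<in> car" for x k
  proof -
    have n: "0 < (2::nat) ^ k" by simp
    have v: "0 \<le> star mes x ((real i + 1) / real (2 ^ k))" for i
      by (rule mes.star_nonneg[OF car_measurable[OF x]])
    have "star Omega (g x k) \<in> car \<and> nrm (star Omega (g x k)) \<le> 3 * D * nrm (lstep (2 ^ k) (star mes x))"
      unfolding g_def lstep_def
      by (rule conjI; rule star_ktrunc_step_bound[OF \<sigma> T n v])
    moreover have "3 * D * nrm (lstep (2 ^ k) (star mes x)) \<le> 3 * D * nrm x"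
      using D lstep_star_nrm_le[OF x n] by (intro mult_left_mono) auto
    ultimately show ?thesis by linarith
  qed
  note approx = ktrunc_approximation[folded g_def]
  have "star Omega (ksum x) \<in> car \<and> nrm (star Omega (ksum x)) \<le> 3 * D * nrm x"
    using separable_or_bidual
  proof
    assume bid: "same_fspace E (kothe_dual mes (kothe_dual mes E))"
    have u0: "0 \<le> star Omega (g x k) t" for k t
      by (rule Omega.star_nonneg[OF approx(1)[OF x]])
    have gc: "star Omega (g x k) \<in> car" "nrm (star Omega (g x k)) \<le> 3 * D * nrm x" for k
      using g[OF x(1), of k] by simp_all
    show ?thesis
      by (rule conjI; rule bidual_fatou[OF bid gc(1) Omega.borel_measurable_star_mes[OF Km[OF x(1)]] u0
            approx(3)[OF x] approx(4)[OF x] gc(2)])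
  next
    assume sep: "separable_fspace E"
    have trunc: "nrm (\<lambda>t. min (star Omega (ksum x) t) c) \<le> (3 * D + 1) * nrm x \<and> nrm (\<lambda>t. min (star Omega (ksum x) t) c) \<le> 3 * D * nrm x" 
      if x: "x \<in> car" "\<And>t. 0 \<le> x t" and c: "0 \<le> c" for x c
    proof -
      have u0: "0 \<le> star Omega (g x k) t" for k t
        by (rule Omega.star_nonneg[OF approx(1)[OF x]])
      have um: "star Omega (g x k) \<in> borel_measurable mes" for k
        by (rule Omega.borel_measurable_star_mes[OF approx(1)[OF x]])
      have le: "star Omega (g x k) t \<le> star Omega (ksum x) t" for k t
        by (rule incseq_le[OF approx(3)[OF x] approx(4)[OF x]])
      have "nrm (\<lambda>t. min (star Omega (ksum x) t) c) \<le> 3 * D * nrm x"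
      proof (rule separable_bounded_fatou[OF sep, where u="\<lambda>k t. min (star Omega (g x k) t) c" and c=c])
        show "(\<lambda>t. min (star Omega (g x k) t) c) \<in> borel_measurable mes" for k using um by measurable
        show "(\<lambda>t. min (star Omega (ksum x) t) c) \<in> borel_measurable mes"
          using Omega.borel_measurable_star_mes[OF Km[OF x(1)]] by measurable
        show "0 \<le> min (star Omega (g x k) t) c" for k t using u0 c by simp
        show "min (star Omega (g x k) t) c \<le> min (star Omega (ksum x) t) c" for k t
          using le[of k t] by (intro min.mono) auto
        show "min (star Omega (ksum x) t) c \<le> c" for t by simp
        show "incseq (\<lambda>k. min (star Omega (g x k) t) c)" for t
          by (rule incseq_SucI) (intro min.mono incseq_SucD[OF approx(3)[OF x]] order_refl)
        show "(\<lambda>k. min (star Omega (g x k) t) c) \<longlonglongrightarrow> min (star Omega (ksum x) t) c" for t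
          by (intro tendsto_min approx(4)[OF x] tendsto_const)
        show "nrm (\<lambda>t. min (star Omega (g x k) t) c) \<le> 3 * D * nrm x" for k
        proof -
          have "nrm (\<lambda>t. min (star Omega (g x k) t) c) \<le> nrm (star Omega (g x k))"
          proof (rule solid(2))
            show "(\<lambda>t. min (star Omega (g x k) t) c) \<in> borel_measurable mes" using um by measurable
            show "star Omega (g x k) \<in> car" using g[OF x(1)] by blast
            show "AE t in mes. \<bar>min (star Omega (g x k) t) c\<bar> \<le> \<bar>star Omega (g x k) t\<bar>"
            proof (rule AE_I2)
              fix t show "\<bar>min (star Omega (g x k) t) c\<bar> \<le> \<bar>star Omega (g x k) t\<bar>"
                using u0[of k t] c by linarith
            qed
          qed
          then show ?thesis using g[OF x(1), of k] by linarith
        qed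
      qed
      moreover have "3 * D * nrm x \<le> (3 * D + 1) * nrm x"
        using nrm_nonneg[OF x(1)] by (simp add: distrib_right)
      ultimately show ?thesis by linarith
    qed
    have sm: "star Omega (ksum x) \<in> borel_measurable mes"
      by (rule Omega.borel_measurable_star_mes[OF Km[OF x(1)]])
    have s0: "0 \<le> star Omega (ksum x) t" for t by (rule Omega.star_nonneg[OF Km[OF x(1)]])
    have small: "\<exists>b. \<forall>c\<ge>0. nrm (\<lambda>t. star Omega (ksum x) t * 
        indicator {t. b < star Omega (ksum x) t \<and> star Omega (ksum x) t \<le> c} t) \<le> e" if "0 < e" for e
    proof (rule separable_kruglov_tail[OF sep _ x that])
      show "nrm (\<lambda>t. min (star Omega (ksum x) t) c) \<le> (3 * D + 1) * nrm x"
        if "x \<in> car" "\<And>t. 0 \<le> x t" "0 \<le> c" for x c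
        using trunc[OF that] by (rule conjunct1)
      show "0 < 3 * D + 1" using D by simp
    qed
    show ?thesis
      by (rule conjI; rule car_if_truncations_Cauchy[OF sm s0 conjunct2[OF trunc[OF x]] small])
  qed
  then show "star Omega (ksum x) \<in> car" "nrm (star Omega (ksum x)) \<le> 3 * D * nrm x" by blast+
qed

lemma kruglov_bound_signed:
  assumes bound: "\<And>x. x \<in> car \<Longrightarrow> (\<And>t. 0 \<le> x t) \<Longrightarrow> star Omega (ksum x) \<in> car \<and> nrm (star Omega (ksum x)) \<le> C * nrm x"
    and x: "x \<in> car"
  shows "star Omega (ksum x) \<in> car \<and> nrm (star Omega (ksum x)) \<le> C * nrm x"
proof -
  let ?y = "\<lambda>t. \<bar>x t\<bar>"
  note y = abs_car[OF x]
  have b: "star Omega (ksum ?y) \<in> car" "nrm (star Omega (ksum ?y)) \<le> C * nrm x"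
    using bound[OF y(1)] y(2) by auto
  have ym: "ksum ?y \<in> borel_measurable Omega" by (rule borel_measurable_ksum[OF car_measurable[OF y(1)]])
  have "tail Omega (ksum x) \<tau> \<le> tail mes (star Omega (ksum ?y)) \<tau>" for \<tau>
    unfolding Omega.tail_star[OF ym]
  proof (rule Omega.tail_mono[OF ym], rule AE_I2)
    fix w
    have "\<bar>ksum x w\<bar> \<le> ksum ?y w" unfolding ksum_def by (rule sum_abs)
    then show "\<bar>ksum x w\<bar> \<le> \<bar>ksum ?y w\<bar>" by linarith
  qed
  from dominated_star[OF Omega.prob_space_axioms borel_measurable_ksum[OF car_measurable[OF x]] b(1) this] b(2)
  show ?thesis by force
qed

end

section \<open>The equivalence\<close>

theorem theorem10:
  fixes E :: "real fspace"
    and B :: "nat \<Rightarrow> real set"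
    and \<sigma> :: "nat \<Rightarrow> nat \<Rightarrow> nat \<Rightarrow> nat"
  assumes "ri_space E"
    and "kruglov_sets B"
    and "perm_numbering \<sigma>"
  shows "bounded_operator Omega E (rearr_space E Omega) (kruglov_op B) \<longleftrightarrow>
         uniformly_bounded E (opT \<sigma>)"
proof -
  interpret ri_kruglov E B
    using assms(1,2) by unfold_locales
  show ?thesis
    unfolding kruglov_bounded_iff
  proof
    assume "\<exists>C. \<forall>x\<in>car. star Omega (ksum x) \<in> car \<and> nrm (star Omega (ksum x)) \<le> C * nrm x"
    then obtain C where C: "\<And>x. x \<in> car \<Longrightarrow> star Omega (ksum x) \<in> car \<and> nrm (star Omega (ksum x)) \<le> C * nrm x"
      by blast
    show "uniformly_bounded E (opT \<sigma>)"
    proof (rule uniformly_boundedI)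
      fix n :: nat and x assume "1 \<le> n" "x \<in> car"
      then show "opT \<sigma> n x \<in> car \<and> nrm (opT \<sigma> n x) \<le> 243 * \<bar>C\<bar> * nrm x"
        by (intro conjI opT_bound_of_kruglov_bound[OF assms(3) _ _ C])
    qed simp
  next
    assume "uniformly_bounded E (opT \<sigma>)"
    then obtain D where D: "0 \<le> D" 
      "\<And>n x. 1 \<le> n \<Longrightarrow> x \<in> car \<Longrightarrow> opT \<sigma> n x \<in> car \<and> nrm (opT \<sigma> n x) \<le> D * nrm x"
      using uniformly_boundedD by blast
    have "star Omega (ksum x) \<in> car \<and> nrm (star Omega (ksum x)) \<le> 3 * D * nrm x"
      if "x \<in> car" "\<And>t. 0 \<le> x t" for x
      by (intro conjI kruglov_bound_of_opT_bound[OF assms(3) D that])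
    from kruglov_bound_signed[OF this]
    show "\<exists>C. \<forall>x\<in>car. star Omega (ksum x) \<in> car \<and> nrm (star Omega (ksum x)) \<le> C * nrm x"
      by blast
  qed
qed

end
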